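(* Let $\Omega\subset\mathbb{R}^d$ ($d\ge 1$) be a bounded, convex, open set, let $p$ satisfy $1<p<\infty$ if $d=1,2$ and $1<p<\frac{d+2}{d-2}$ if $d\ge 3$, and let $\gamma=\frac{p}{p-1}$. Let $u_0\in H^1_0(\Omega)$ be nontrivial and let $\{u_n\}_{n=0}^\infty$ be the sequence generated by $u_{n+1}=\mathcal{A}(u_n)$. If $$0<M[u_k]\le M[u_n]\le1$$ for some $0\le k<n$, then $$E_M[u_n]\le E_M[u_k],$$ with strict inequality if $M[u_k]<M[u_n]$. In particular, if $0<M[u_k]\le1$ (for some $k\ge 0$), then $$\liminf_{n\to\infty}E_1[u_n]\le E_M[u_k].$$
   Context: All functions are real valued and $\Omega$ is nonempty. $\langle\cdot,\cdot\rangle$ is the $L^2(\Omega)$ inner product (extended to the duality between $H^{-1}$ and $H^1_0$). $H^1_0(\Omega)$ carries the inner product $\langle f,g\rangle_{H^1}=\int_\Omega fg+\nabla f\cdot\nabla g$ with norm $\|\cdot\|_{H^1}$. $\mathcal{L}=I-\Delta:H^1_0(\Omega)\to H^{-1}(\Omega)$ (Dirichlet boundary conditions), and $\mathcal{L}^{-1}$ is its inverse. For $u\in H^1_0(\Omega)$, $u\ne0$, set $$M[u]=\frac{\langle\mathcal{L}u,u\rangle}{\langle|u|^{p-1}u,u\rangle}=\frac{\|u\|_{H^1}^2}{\|u\|_{L^{p+1}}^{p+1}},\qquad \mathcal{A}(u)=M[u]^\gamma\,\mathcal{L}^{-1}(|u|^{p-1}u).$$ The iterates are well defined, since $\mathcal{A}(u)\in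 H^1_0(\Omega)\setminus\{0\}$ whenever $u\in H^1_0(\Omega)\setminus\{0\}$. The energies are $$E_1[\psi]=\tfrac12\|\psi\|_{H^1}^2-\tfrac1{p+1}\|\psi\|_{L^{p+1}}^{p+1},$$ and, for $\psi\neq0$, $E_M[\psi]=\tfrac12\|\psi\|_{H^1}^2-\tfrac1{p+1}M[\psi]\,\|\psi\|_{L^{p+1}}^{p+1}$ if $M[\psi]\le1$, and $E_M[\psi]=+\infty$ if $M[\psi]>1$. *)

theory Defs
  imports "HOL-Analysis.Analysis"
begin

(* Sobolev functions on \<Omega> are represented by functions on the whole space.  Values outside
   \<Omega> are irrelevant, and the Sobolev notions below depend only on the class modulo a.e.
   equality on \<Omega>; wgrad and Helmholtz_inv choose a representative of such a class. *)

primrec C_k :: "nat \<Rightarrow> ('a::euclidean_space \<Rightarrow> real) \<Rightarrow> bool" where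
  "C_k 0 f \<longleftrightarrow> continuous_on UNIV f"
| "C_k (Suc k) f \<longleftrightarrow>
     (\<forall>x. f differentiable (at x)) \<and>
     (\<forall>b\<in>Basis. C_k k (\<lambda>x. frechet_derivative f (at x) b))"

definition test_functions :: "'a::euclidean_space set \<Rightarrow> ('a \<Rightarrow> real) set" where
  "test_functions \<Omega> =
     {\<phi>. (\<forall>k. C_k k \<phi>) \<and> compact (closure {x. \<phi> x \<noteq> 0}) \<and> closure {x. \<phi> x \<noteq> 0} \<subseteq> \<Omega>}"

definition locally_integrable :: "'a::euclidean_space set \<Rightarrow> ('a \<Rightarrow> 'b::euclidean_space) \<Rightarrow> bool"
  where "locally_integrable \<Omega> f \<longleftrightarrow>
    (\<forall>K. compact K \<and> K \<subseteq> \<Omega> \<longrightarrow> f absolutely_integrable_on K)"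

definition weak_gradient ::
    "'a::euclidean_space set \<Rightarrow> ('a \<Rightarrow> real) \<Rightarrow> ('a \<Rightarrow> 'a) \<Rightarrow> bool" where
  "weak_gradient \<Omega> u g \<longleftrightarrow>
     locally_integrable \<Omega> u \<and> locally_integrable \<Omega> g \<and>
     (\<forall>\<phi>\<in>test_functions \<Omega>. \<forall>b\<in>Basis.
        (LINT x|lebesgue_on \<Omega>. u x * frechet_derivative \<phi> (at x) b) =
        - (LINT x|lebesgue_on \<Omega>. (g x \<bullet> b) * \<phi> x))"

definition wgrad :: "'a::euclidean_space set \<Rightarrow> ('a \<Rightarrow> real) \<Rightarrow> 'a \<Rightarrow> 'a" where
  "wgrad \<Omega> u = (SOME g. weak_gradient \<Omega> u g)"

definition square_integrable ::
    "'a::euclidean_space set \<Rightarrow> ('a \<Rightarrow> 'b::euclidean_space) \<Rightarrow> bool" where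
  "square_integrable \<Omega> f \<longleftrightarrow>
     f \<in> borel_measurable (lebesgue_on \<Omega>) \<and>
     integrable (lebesgue_on \<Omega>) (\<lambda>x. (norm (f x))\<^sup>2)"

definition L2_inner ::
    "'a::euclidean_space set \<Rightarrow> ('a \<Rightarrow> real) \<Rightarrow> ('a \<Rightarrow> real) \<Rightarrow> real" where
  "L2_inner \<Omega> f g = (LINT x|lebesgue_on \<Omega>. f x * g x)"

definition Lp_norm :: "'a::euclidean_space set \<Rightarrow> real \<Rightarrow> ('a \<Rightarrow> real) \<Rightarrow> real" where
  "Lp_norm \<Omega> q f = (LINT x|lebesgue_on \<Omega>. \<bar>f x\<bar> powr q) powr (1 / q)"

definition H1 :: "'a::euclidean_space set \<Rightarrow> ('a \<Rightarrow> real) set" where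
  "H1 \<Omega> =
     {u. square_integrable \<Omega> u \<and> (\<exists>g. weak_gradient \<Omega> u g \<and> square_integrable \<Omega> g)}"

definition H1_inner ::
    "'a::euclidean_space set \<Rightarrow> ('a \<Rightarrow> real) \<Rightarrow> ('a \<Rightarrow> real) \<Rightarrow> real" where
  "H1_inner \<Omega> f g = (LINT x|lebesgue_on \<Omega>. f x * g x + wgrad \<Omega> f x \<bullet> wgrad \<Omega> g x)"

definition H1_norm :: "'a::euclidean_space set \<Rightarrow> ('a \<Rightarrow> real) \<Rightarrow> real" where
  "H1_norm \<Omega> f = sqrt (H1_inner \<Omega> f f)"

definition H10 :: "'a::euclidean_space set \<Rightarrow> ('a \<Rightarrow> real) set" where
  "H10 \<Omega> =
     {u \<in> H1 \<Omega>. \<exists>\<phi>::nat \<Rightarrow> 'a \<Rightarrow> real. (\<forall>n. \<phi> n \<in> test_functions \<Omega>) \<and>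
        (\<lambda>n. H1_norm \<Omega> (\<lambda>x. \<phi> n x - u x)) \<longlonglongrightarrow> 0}"

(* Elements of the dual space of H10 \<Omega> are functionals on H10 \<Omega>, extended by undefined so that
   they are equal as HOL functions iff they agree on H10 \<Omega>.  The duality pairing of F and w
   is F w; a function f is identified with the functional given by the L2 inner product. *)

definition dual_of :: "'a::euclidean_space set \<Rightarrow> ('a \<Rightarrow> real) \<Rightarrow> ('a \<Rightarrow> real) \<Rightarrow> real" where
  "dual_of \<Omega> f = (\<lambda>w\<in>H10 \<Omega>. L2_inner \<Omega> f w)"

definition Laplacian :: "'a::euclidean_space set \<Rightarrow> ('a \<Rightarrow> real) \<Rightarrow> ('a \<Rightarrow> real) \<Rightarrow> real" where
  "Laplacian \<Omega> u = (\<lambda>w\<in>H10 \<Omega>. - (LINT x|lebesgue_on \<Omega>. wgrad \<Omega> u x \<bullet> wgrad \<Omega> w x))"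

definition Helmholtz :: "'a::euclidean_space set \<Rightarrow> ('a \<Rightarrow> real) \<Rightarrow> ('a \<Rightarrow> real) \<Rightarrow> real" where
  "Helmholtz \<Omega> u = (\<lambda>w\<in>H10 \<Omega>. dual_of \<Omega> u w - Laplacian \<Omega> u w)"

(* The preimage is unique only modulo a.e. equality on \<Omega>; inv_into picks a representative. *)
definition Helmholtz_inv ::
    "'a::euclidean_space set \<Rightarrow> (('a \<Rightarrow> real) \<Rightarrow> real) \<Rightarrow> 'a \<Rightarrow> real" where
  "Helmholtz_inv \<Omega> = inv_into (H10 \<Omega>) (Helmholtz \<Omega>)"

definition nonlin :: "real \<Rightarrow> ('a \<Rightarrow> real) \<Rightarrow> 'a \<Rightarrow> real" where
  "nonlin p u = (\<lambda>x. \<bar>u x\<bar> powr (p - 1) * u x)"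

definition M :: "'a::euclidean_space set \<Rightarrow> real \<Rightarrow> ('a \<Rightarrow> real) \<Rightarrow> real" where
  "M \<Omega> p u = Helmholtz \<Omega> u u / dual_of \<Omega> (nonlin p u) u"

definition iter_map ::
    "'a::euclidean_space set \<Rightarrow> real \<Rightarrow> real \<Rightarrow> ('a \<Rightarrow> real) \<Rightarrow> 'a \<Rightarrow> real" where
  "iter_map \<Omega> p \<gamma> u = (\<lambda>x. M \<Omega> p u powr \<gamma> * Helmholtz_inv \<Omega> (dual_of \<Omega> (nonlin p u)) x)"

definition E1 :: "'a::euclidean_space set \<Rightarrow> real \<Rightarrow> ('a \<Rightarrow> real) \<Rightarrow> real" where
  "E1 \<Omega> p \<psi> =
     1 / 2 * (H1_norm \<Omega> \<psi>)\<^sup>2 - 1 / (p + 1) * Lp_norm \<Omega> (p + 1) \<psi> powr (p + 1)"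

definition EM :: "'a::euclidean_space set \<Rightarrow> real \<Rightarrow> ('a \<Rightarrow> real) \<Rightarrow> ereal" where
  "EM \<Omega> p \<psi> =
     (if M \<Omega> p \<psi> \<le> 1
      then ereal (1 / 2 * (H1_norm \<Omega> \<psi>)\<^sup>2
                  - 1 / (p + 1) * M \<Omega> p \<psi> * Lp_norm \<Omega> (p + 1) \<psi> powr (p + 1))
      else \<infinity>)"

end

theory Submission
  imports Defs
begin

text \<open>
  Write \<open>N = \<parallel>u\<parallel>\<^sup>2\<close> for the squared \<open>H1\<close> norm and \<open>P\<close> for the integral of \<open>\<bar>u\<bar> powr (p + 1)\<close>, so that
  \<open>M = N / P\<close>.  Where \<open>M \<le> 1\<close>, the energy \<open>EM\<close> equals \<open>(p - 1) / (2 (p + 1)) * N\<close>; the theorem is thus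
  about the growth of \<open>N\<close> along the iteration.

  One step replaces \<open>u\<close> by \<open>u' = M powr \<gamma> * v\<close>, where \<open>v\<close> solves the linear problem with right-hand
  side \<open>nonlin p u\<close>.  Testing this problem with \<open>u\<close> gives \<open>P\<^sup>2 \<le> \<parallel>v\<parallel>\<^sup>2 N\<close> by Cauchy-Schwarz, and testing it with
  \<open>v\<close> gives \<open>\<parallel>v\<parallel>\<^sup>2 \<le> P powr (p / (p + 1)) * Q powr (1 / (p + 1))\<close> by Hoelder, where \<open>Q\<close> is the analogue
  of \<open>P\<close> for \<open>v\<close>.  With \<open>\<gamma> = p / (p - 1)\<close> the two inequalities combine to \<open>M' \<le> 1\<close> and
  \<open>N' \<le> N * M powr (2 / (p - 1)) * M' powr (- 1 / p)\<close> for the next iterate; these are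
  \<open>step_inequality\<close> and \<open>iteration_step\<close>.

  Multiplying these bounds from step \<open>k\<close> to step \<open>n\<close>, every intermediate \<open>M\<close> appears with the
  positive exponent \<open>2 / (p - 1) - 1 / p\<close> and is at most one.  What remains is at most
  \<open>N\<^sub>n \<le> N\<^sub>k * (M\<^sub>k / M\<^sub>n) powr (1 / p)\<close>, which is the monotonicity claim.  For the limit inferior,
  suppose \<open>E1\<close> eventually exceeds some \<open>r > EM (u k)\<close>.  Since \<open>E1 \<le> EM\<close> for \<open>M \<le> 1\<close>, the norms stay
  above \<open>N\<^sub>k\<close> by a fixed factor, and since \<open>E1 > 0\<close>, the quotients \<open>M\<close> stay above \<open>2 / (p + 1)\<close>.  The
  former forces \<open>M\<close> to stay below a number smaller than one, so the product of the intermediate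
  factors tends to zero, which contradicts the lower bound on the norms
  (\<open>no_persistent_excess\<close>).

  For all this the iteration has to be meaningful: \<open>P\<close> must be finite on \<open>H10\<close> and \<open>nonlin p u\<close> must lie
  in the range of the Helmholtz operator.  Both follow from the subcritical Sobolev inequality
  (\<open>Sobolev_H10\<close>) and the Riesz representation on \<open>H10\<close> (\<open>Riesz_representation\<close>).  They rest in turn on the
  uniqueness of weak gradients (\<open>fundamental_lemma\<close>) and the completeness of \<open>L2\<close>
  (\<open>square_integrable_complete\<close>).
\<close>

section \<open>Smooth functions\<close>

lemma C_k_imp_continuous_on: "C_k k f \<Longrightarrow> continuous_on UNIV f"
proof (cases k)
  case (Suc m)
  moreover assume "C_k k f"
  ultimately show ?thesis
    by (metis C_k.simps(2) continuous_at_imp_continuous_on differentiable_imp_continuous_within)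
qed auto

lemma C_k_SucD: "C_k (Suc k) f \<Longrightarrow> C_k k f"
proof (induction k arbitrary: f)
  case 0
  show ?case using C_k_imp_continuous_on[OF 0] by simp
next
  case (Suc k)
  then show ?case by (metis C_k.simps(2))
qed

lemma C_k_const: "C_k k (\<lambda>x. c)"
  by (induction k arbitrary: c) auto

lemma C_k_add: "C_k k f \<Longrightarrow> C_k k g \<Longrightarrow> C_k k (\<lambda>x. f x + g x)"
proof (induction k arbitrary: f g)
  case 0
  then show ?case by (auto intro: continuous_on_add)
next
  case (Suc k)
  have "frechet_derivative (\<lambda>x. f x + g x) (at x) b =
      frechet_derivative f (at x) b + frechet_derivative g (at x) b" for x b
    using Suc.prems
    by (intro fun_cong[OF frechet_derivative_at[symmetric]] has_derivative_add)
       (auto simp: frechet_derivative_works[symmetric])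
  with Suc show ?case by (auto intro: differentiable_add)
qed

lemma frechet_derivative_mult:
  fixes f g :: "'a::euclidean_space \<Rightarrow> real"
  assumes "f differentiable (at x)" "g differentiable (at x)"
  shows "frechet_derivative (\<lambda>x. f x * g x) (at x) b =
     f x * frechet_derivative g (at x) b + frechet_derivative f (at x) b * g x"
proof -
  have "((\<lambda>x. f x * g x) has_derivative
     (\<lambda>b. f x * frechet_derivative g (at x) b + frechet_derivative f (at x) b * g x)) (at x)"
    by (intro has_derivative_mult) (use assms in \<open>auto simp: frechet_derivative_works\<close>)
  then show ?thesis by (simp add: frechet_derivative_at[symmetric])
qed

lemma C_k_mult: "C_k k f \<Longrightarrow> C_k k g \<Longrightarrow> C_k k (\<lambda>x. f x * g x)"
proof (induction k arbitrary: f g)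
  case 0
  then show ?case by (auto intro: continuous_on_mult)
next
  case (Suc k)
  have *: "C_k k f" "C_k k g" using Suc.prems C_k_SucD by blast+
  have "C_k k (\<lambda>x. f x * frechet_derivative g (at x) b + frechet_derivative f (at x) b * g x)"
    if "b \<in> Basis" for b
    using that Suc * by (intro C_k_add Suc.IH) auto
  with Suc.prems show ?case by (auto intro: differentiable_mult simp: frechet_derivative_mult)
qed

lemma C_k_power: "C_k k f \<Longrightarrow> C_k k (\<lambda>x. f x ^ n)"
  by (induction n) (auto intro: C_k_mult C_k_const)

lemma C_k_prod: "(\<And>i. i \<in> I \<Longrightarrow> C_k k (f i)) \<Longrightarrow> C_k k (\<lambda>x. \<Prod>i\<in>I. f i x)"
  by (induction I rule: infinite_finite_induct) (auto intro: C_k_mult C_k_const)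

text \<open>Functions of one linear coordinate inherit smoothness from the real line, because their partial
  derivatives are again of this form.  Smooth functions of several variables are built from these
  by products.\<close>

lemma C_k_inner_affine:
  fixes h :: "real \<Rightarrow> real"
  assumes "C_k k h" shows "C_k k (\<lambda>x. h (x \<bullet> c + t))"
  using assms
proof (induction k arbitrary: h)
  case 0
  then show ?case
    by (auto intro!: continuous_intros continuous_on_compose2[of UNIV h])
next
  case (Suc k)
  have d: "((\<lambda>x. h (x \<bullet> c + t)) has_derivative
      (\<lambda>b. (b \<bullet> c) * frechet_derivative h (at (x \<bullet> c + t)) 1)) (at x)" for x
  proof -
    have h: "(h has_derivative frechet_derivative h (at (x \<bullet> c + t))) (at (x \<bullet> c + t))"
      using Suc.prems by (auto simp: frechet_derivative_works)
    have "((\<lambda>x. h (x \<bullet> c + t)) has_derivative (\<lambda>b. frechet_derivative h (at (x \<bullet> c + t)) (b \<bullet> c))) (at x)"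
      by (rule has_derivative_compose[where g = h and f = "\<lambda>x. x \<bullet> c + t", OF _ h])
         (auto intro!: derivative_eq_intros)
    moreover have "frechet_derivative h (at (x \<bullet> c + t)) (b \<bullet> c) =
        (b \<bullet> c) * frechet_derivative h (at (x \<bullet> c + t)) 1" for b
      using linear_scale[OF has_derivative_linear[OF h], of "b \<bullet> c" 1] by simp
    ultimately show ?thesis by simp
  qed
  have "C_k k (\<lambda>x. (b \<bullet> c) * frechet_derivative h (at (x \<bullet> c + t)) 1)" for b
    using Suc by (intro C_k_mult C_k_const Suc.IH) auto
  then show ?case using d by (auto simp: frechet_derivative_at[OF d, symmetric] differentiable_def)
qed

text \<open>The functions \<open>exp (- 1 / t) / t ^ m\<close> on the positive half-line, extended by zero.  The
  derivative of each member of this family is a linear combination of two other members, so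
  smoothness of the whole family follows by one induction.\<close>

definition flat :: "nat \<Rightarrow> real \<Rightarrow> real" where
  "flat m t = (if t > 0 then exp (- 1 / t) / t ^ m else 0)"

text \<open>Exponential decay beats every power of \<open>1 / t\<close>; this is what makes the extension by zero
  differentiable at the origin.\<close>

lemma flat_0_limit: "((\<lambda>t. flat m t) \<longlongrightarrow> 0) (at 0)"
proof -
  have "((\<lambda>t::real. exp (- 1 / t) / t ^ m) \<longlongrightarrow> 0) (at_right 0)"
  proof -
    have "((\<lambda>s::real. s ^ m / exp s) \<longlongrightarrow> 0) at_top"
      by (rule tendsto_power_div_exp_0)
    then have "((\<lambda>t::real. (inverse t) ^ m / exp (inverse t)) \<longlongrightarrow> 0) (at_right 0)"
      by (rule filterlim_compose) (rule filterlim_inverse_at_top_right)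
    then show ?thesis
      by (simp add: exp_minus field_simps power_divide)
  qed
  then have "((\<lambda>t. flat m t) \<longlongrightarrow> 0) (at_right 0)"
    by (rule Lim_transform_eventually)
       (auto simp: flat_def eventually_at intro!: exI[of _ 1])
  moreover have "((\<lambda>t. flat m t) \<longlongrightarrow> 0) (at_left 0)"
    by (rule Lim_transform_eventually[OF tendsto_const])
       (auto simp: flat_def eventually_at intro!: exI[of _ 1])
  ultimately show ?thesis by (simp add: filterlim_split_at)
qed

lemma flat_has_derivative:
  "(flat m has_real_derivative flat (m + 2) t - real m * flat (m + 1) t) (at t)"
proof -
  consider "t > 0" | "t < 0" | "t = 0" by linarith
  then show ?thesis
  proof cases
    case 1
    have "((\<lambda>t. exp (- 1 / t) / t ^ m) has_real_derivative
       flat (m + 2) t - real m * flat (m + 1) t) (at t)"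
    proof (rule DERIV_cong)
      show "((\<lambda>t. exp (- 1 / t) / t ^ m) has_real_derivative
        ((exp (- 1 / t) * (1 / t\<^sup>2)) * t ^ m - exp (- 1 / t) * (real m * t ^ (m - 1))) / (t ^ m * t ^ m)) (at t)"
        using 1 by (auto intro!: derivative_eq_intros simp: power2_eq_square)
      have e: "real m * t ^ (m - 1) = real m * t ^ m / t"
        using 1 by (cases m) auto
      show "((exp (- 1 / t) * (1 / t\<^sup>2)) * t ^ m - exp (- 1 / t) * (real m * t ^ (m - 1))) / (t ^ m * t ^ m)
         = flat (m + 2) t - real m * flat (m + 1) t"
        unfolding e using 1 by (simp add: flat_def field_simps power2_eq_square)
    qed
    then show ?thesis
      by (rule DERIV_cong_ev[THEN iffD1, rotated 3])
         (use 1 in \<open>auto simp: flat_def eventually_nhds intro!: exI[of _ "{0<..}"]\<close>)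
  next
    case 2
    have "((\<lambda>t. 0) has_real_derivative 0) (at t)" by simp
    then have "(flat m has_real_derivative 0) (at t)"
      by (rule DERIV_cong_ev[THEN iffD1, rotated 3])
         (use 2 in \<open>auto simp: flat_def eventually_nhds intro!: exI[of _ "{..<0}"]\<close>)
    then show ?thesis using 2 by (simp add: flat_def)
  next
    case 3
    have "(\<lambda>h. (flat m (0 + h) - flat m 0) / h) = flat (m + 1)"
      by (auto simp: flat_def fun_eq_iff)
    then have "(\<lambda>h. (flat m (0 + h) - flat m 0) / h) \<midarrow>0\<rightarrow> 0"
      using flat_0_limit[of "m + 1"] by simp
    then have "(flat m has_real_derivative 0) (at 0)" by (simp only: DERIV_def)
    then show ?thesis using 3 by (simp add: flat_def)
  qed
qed

lemma C_k_flat: "C_k k (flat m)"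
proof (induction k arbitrary: m)
  case 0
  show ?case using DERIV_isCont[OF flat_has_derivative]
    by (auto intro!: continuous_at_imp_continuous_on)
next
  case (Suc k)
  have "frechet_derivative (flat m) (at x) 1 = flat (m + 2) x + (- real m) * flat (m + 1) x" for x
    using frechet_derivative_at[OF flat_has_derivative[of m x, unfolded has_field_derivative_def], symmetric]
    by simp
  moreover have "flat m differentiable at x" for x
    using flat_has_derivative by (auto simp: real_differentiable_def)
  moreover have "C_k k (\<lambda>x. flat (m + 2) x + (- real m) * flat (m + 1) x)"
    by (intro C_k_add C_k_mult C_k_const Suc)
  ultimately show ?case by simp
qed

definition box_bump :: "'a::euclidean_space \<Rightarrow> 'a \<Rightarrow> 'a \<Rightarrow> real" where
  "box_bump a c x = (\<Prod>b\<in>Basis. flat 0 (x \<bullet> b - a \<bullet> b) * flat 0 (c \<bullet> b - x \<bullet> b))"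

lemma C_k_box_bump: "C_k k (box_bump a c)"
proof -
  have "C_k k (\<lambda>x. \<Prod>b\<in>Basis. flat 0 (x \<bullet> b + (- (a \<bullet> b))) * flat 0 (x \<bullet> (- b) + c \<bullet> b))"
    by (intro C_k_prod C_k_mult C_k_inner_affine C_k_flat)
  then show ?thesis by (simp add: box_bump_def[abs_def] inner_minus_right algebra_simps)
qed

lemma flat_0_bounds: "0 \<le> flat 0 t" "flat 0 t \<le> 1"
  by (auto simp: flat_def)

lemma box_bump_bounds: "0 \<le> box_bump a c x" "box_bump a c x \<le> 1"
  unfolding box_bump_def
  by (auto intro!: prod_nonneg prod_le_1 mult_le_one mult_nonneg_nonneg simp: flat_0_bounds)

lemma box_bump_pos_iff: "0 < box_bump a c x \<longleftrightarrow> x \<in> box a c"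
proof -
  have "0 < box_bump a c x \<longleftrightarrow> (\<forall>b\<in>Basis. flat 0 (x \<bullet> b - a \<bullet> b) * flat 0 (c \<bullet> b - x \<bullet> b) \<noteq> 0)"
    using box_bump_bounds(1)[of a c x] unfolding box_bump_def by (auto simp: less_le)
  also have "\<dots> \<longleftrightarrow> x \<in> box a c"
    by (auto simp: mem_box flat_def)
  finally show ?thesis .
qed

text \<open>These cutoffs increase to the indicator of the open box as \<open>n\<close> grows: the bump lies in \<open>(0, 1]\<close>
  inside the box and vanishes outside.  They are therefore smooth substitutes for indicators that
  keep their support in a fixed compact box.\<close>

lemma test_function_box:
  assumes "cbox a c \<subseteq> \<Omega>"
  shows "(\<lambda>x. 1 - (1 - box_bump a c x) ^ n) \<in> test_functions \<Omega>"
proof -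
  have "C_k k (\<lambda>x. 1 + (-1) * (1 + (-1) * box_bump a c x) ^ n)" for k
    by (intro C_k_add C_k_mult C_k_const C_k_power C_k_box_bump)
  moreover have "{x. 1 - (1 - box_bump a c x) ^ n \<noteq> 0} \<subseteq> cbox a c"
  proof
    fix x assume "x \<in> {x. 1 - (1 - box_bump a c x) ^ n \<noteq> 0}"
    then have "box_bump a c x \<noteq> 0" by auto
    then have "x \<in> box a c" using box_bump_pos_iff[of a c x] box_bump_bounds(1)[of a c x] by auto
    then show "x \<in> cbox a c" using box_subset_cbox by blast
  qed
  then have "closure {x. 1 - (1 - box_bump a c x) ^ n \<noteq> 0} \<subseteq> cbox a c"
    by (rule closure_minimal) auto
  moreover from this have "compact (closure {x. 1 - (1 - box_bump a c x) ^ n \<noteq> 0})"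
    by (meson bounded_cbox bounded_subset closed_closure compact_eq_bounded_closed)
  ultimately show ?thesis using assms unfolding test_functions_def by auto
qed

lemma box_bump_powers_tendsto: "(\<lambda>n. 1 - (1 - box_bump a c x) ^ n) \<longlonglongrightarrow> indicator (box a c) x"
proof (cases "x \<in> box a c")
  case True
  then have "(\<lambda>n. (1 - box_bump a c x) ^ n) \<longlonglongrightarrow> 0"
    using box_bump_pos_iff[of a c x] box_bump_bounds[of a c x]
    by (intro LIMSEQ_power_zero) (simp only: real_norm_def abs_less_iff, auto)
  from tendsto_diff[OF tendsto_const this, of 1] show ?thesis using True by simp
next
  case False
  then have "box_bump a c x = 0" using box_bump_pos_iff[of a c x] box_bump_bounds[of a c x] by auto
  then show ?thesis using False by simp
qed

section \<open>The fundamental lemma of the calculus of variations\<close>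

lemma test_functionD:
  assumes "\<phi> \<in> test_functions \<Omega>"
  shows "C_k k \<phi>" "continuous_on UNIV \<phi>" "\<phi> differentiable (at x)"
    "b \<in> Basis \<Longrightarrow> C_k k (\<lambda>x. frechet_derivative \<phi> (at x) b)"
    "b \<in> Basis \<Longrightarrow> continuous_on UNIV (\<lambda>x. frechet_derivative \<phi> (at x) b)"
    "compact (closure {x. \<phi> x \<noteq> 0})" "closure {x. \<phi> x \<noteq> 0} \<subseteq> \<Omega>"
proof -
  have *: "C_k k \<phi>" for k using assms by (auto simp: test_functions_def)
  show "C_k k \<phi>" "continuous_on UNIV \<phi>" using * C_k_imp_continuous_on by blast+
  show "\<phi> differentiable (at x)" using *[of "Suc 0"] by simp
  show "b \<in> Basis \<Longrightarrow> C_k k (\<lambda>x. frechet_derivative \<phi> (at x) b)"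
    using *[of "Suc k"] by simp
  show "b \<in> Basis \<Longrightarrow> continuous_on UNIV (\<lambda>x. frechet_derivative \<phi> (at x) b)"
    using *[of "Suc 0"] by simp
  show "compact (closure {x. \<phi> x \<noteq> 0})" "closure {x. \<phi> x \<noteq> 0} \<subseteq> \<Omega>"
    using assms by (auto simp: test_functions_def)
qed

text \<open>A continuous function is bounded on the compact set that carries it, and there the other factor is
  integrable.\<close>

lemma locally_integrable_times_compact_support:
  fixes f :: "'a::euclidean_space \<Rightarrow> 'b::euclidean_space"
  assumes "open \<Omega>" "locally_integrable \<Omega> f" "continuous_on UNIV \<psi>" "compact K" "K \<subseteq> \<Omega>"
    and supp: "\<And>x. x \<notin> K \<Longrightarrow> \<psi> x = (0::real)"
  shows "integrable (lebesgue_on \<Omega>) (\<lambda>x. \<psi> x *\<^sub>R f x)"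
proof -
  have f: "f absolutely_integrable_on K" using assms by (auto simp: locally_integrable_def)
  obtain B where B: "\<And>x. x \<in> K \<Longrightarrow> norm (\<psi> x) \<le> B"
  proof -
    have "bounded (\<psi> ` K)"
      by (intro compact_imp_bounded compact_continuous_image continuous_on_subset[OF assms(3)])
         (use assms in auto)
    then show ?thesis using that by (auto simp: bounded_iff)
  qed
  have K: "K \<in> sets lebesgue" using \<open>compact K\<close> by (simp add: compact_imp_closed)
  have \<Omega>: "\<Omega> \<in> sets lebesgue" using \<open>open \<Omega>\<close> by simp
  have \<psi>: "\<psi> \<in> borel_measurable lebesgue"
    using borel_measurable_continuous_onI[OF assms(3)] by (simp add: measurable_completion)
  have fK: "integrable lebesgue (\<lambda>x. indicator K x *\<^sub>R f x)"
    using f by (simp add: set_integrable_def)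
  have "integrable lebesgue (\<lambda>x. \<psi> x *\<^sub>R (indicator K x *\<^sub>R f x))"
  proof (rule Bochner_Integration.integrable_bound)
    show "integrable lebesgue (\<lambda>x. B *\<^sub>R (indicator K x *\<^sub>R f x))"
      by (rule integrable_scaleR_right) (rule fK)
    show "(\<lambda>x. \<psi> x *\<^sub>R (indicator K x *\<^sub>R f x)) \<in> borel_measurable lebesgue"
      using \<psi> borel_measurable_integrable[OF fK] by measurable
    have "norm (\<psi> x *\<^sub>R (indicator K x *\<^sub>R f x)) \<le> norm (B *\<^sub>R (indicator K x *\<^sub>R f x))" for x
      using B[of x] by (cases "x \<in> K") (auto intro!: mult_right_mono)
    then show "AE x in lebesgue. norm (\<psi> x *\<^sub>R (indicator K x *\<^sub>R f x)) \<le> norm (B *\<^sub>R (indicator K x *\<^sub>R f x))"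
      by simp
  qed
  also have "(\<lambda>x. \<psi> x *\<^sub>R (indicator K x *\<^sub>R f x)) = (\<lambda>x. indicator \<Omega> x *\<^sub>R (\<psi> x *\<^sub>R f x))"
    using supp \<open>K \<subseteq> \<Omega>\<close> by (auto simp: fun_eq_iff indicator_def)
  finally show ?thesis using \<Omega> by (simp add: integrable_restrict_space)
qed

text \<open>Boxes form a generator of the Borel sets that is closed under intersection, so the integrals over
  all Borel sets vanish as well, and these determine the function almost everywhere.\<close>

lemma zero_AE_if_box_integrals_zero:
  fixes f :: "'a::euclidean_space \<Rightarrow> real"
  assumes f: "integrable lebesgue f"
    and zero: "\<And>a c. (LINT x|lebesgue. indicator (box a c) x * f x) = 0"
  shows "AE x in lebesgue. f x = 0"
proof (rule density_unique_real[OF f integrable_zero])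
  have borel: "(LINT x|lebesgue. indicator A x * f x) = 0" if "A \<in> sets borel" for A :: "'a set"
  proof -
    have "Int_stable (range (\<lambda>(a, b). box a b :: 'a set))"
      by (auto simp: Int_stable_def box_Int_box)
    moreover have "range (\<lambda>(a, b). box a b) \<subseteq> Pow (UNIV :: 'a set)" by auto
    moreover have "A \<in> sigma_sets UNIV (range (\<lambda>(a, b). box a b))"
      using that unfolding borel_eq_box by simp
    ultimately show ?thesis
    proof (induction rule: sigma_sets_induct_disjoint)
      case (basic A)
      then show ?case using zero by auto
    next
      case empty
      show ?case by simp
    next
      case (compl A)
      then have "A \<in> sets borel" by (simp add: borel_eq_box)
      then have A: "A \<in> sets lebesgue" by (simp add: sets_completionI_sets)
      have iA: "integrable lebesgue (\<lambda>x. indicator A x * f x)"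
        using integrable_mult_indicator[OF A f] by simp
      \<comment> \<open>The total integral is the limit of the integrals over the cubes of side \<open>2 n\<close>.\<close>
      have "(\<lambda>n. LINT x|lebesgue. indicator (box (- real n *\<^sub>R One) (real n *\<^sub>R One)) x * f x)
          \<longlonglongrightarrow> (LINT x|lebesgue. f x)"
      proof (rule integral_dominated_convergence[where w = "\<lambda>x. norm (f x)"])
        show "AE x in lebesgue. (\<lambda>n. indicator (box (- real n *\<^sub>R One) (real n *\<^sub>R One)) x * f x) \<longlonglongrightarrow> f x"
        proof (rule AE_I2)
          fix x :: 'a
          have "eventually (\<lambda>n. indicator (box (- real n *\<^sub>R One) (real n *\<^sub>R One)) x * f x = f x) sequentially"
          proof -
            obtain N where N: "norm x < real N" using reals_Archimedean2 by blast
            have "x \<in> box (- real n *\<^sub>R One) (real n *\<^sub>R One)" if "n \<ge> N" for n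
            proof -
              have "\<bar>x \<bullet> b\<bar> < real n" if "b \<in> Basis" for b
                using Basis_le_norm[OF that, of x] N \<open>n \<ge> N\<close> by linarith
              then show ?thesis by (auto simp: mem_box abs_less_iff dest: minus_less_iff[THEN iffD1])
            qed
            then show ?thesis by (auto simp: eventually_sequentially intro!: exI[of _ N])
          qed
          then show "(\<lambda>n. indicator (box (- real n *\<^sub>R One) (real n *\<^sub>R One)) x * f x) \<longlonglongrightarrow> f x"
            by (rule tendsto_eventually)
        qed
        show "(\<lambda>x. indicator (box (- real n *\<^sub>R One) (real n *\<^sub>R One)) x * f x) \<in> borel_measurable lebesgue" for n
          by (rule borel_measurable_times[OF borel_measurable_indicator borel_measurable_integrable[OF f]]) simp
      qed (use f in \<open>auto simp: indicator_def\<close>)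
      then have "(LINT x|lebesgue. f x) = 0" by (simp add: zero LIMSEQ_const_iff)
      moreover have "(LINT x|lebesgue. indicator (UNIV - A) x * f x) =
          (LINT x|lebesgue. f x - indicator A x * f x)"
        by (intro Bochner_Integration.integral_cong) (auto simp: indicator_def)
      ultimately show ?case using compl.IH iA f by simp
    next
      case (union F)
      then have "F i \<in> sets borel" for i by (simp add: borel_eq_box image_subset_iff)
      then have F: "F i \<in> sets lebesgue" for i by (simp add: sets_completionI_sets)
      have "set_lebesgue_integral lebesgue (\<Union>i. F i) f = (\<Sum>i. set_lebesgue_integral lebesgue (F i) f)"
      proof (rule lebesgue_integral_countable_add)
        show "set_integrable lebesgue (\<Union>i. F i) f" unfolding set_integrable_def
          by (rule integrable_mult_indicator[OF _ f]) (use F in auto)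
      qed (use F union in \<open>auto simp: disjoint_family_on_def\<close>)
      then show ?case using union by (simp add: set_lebesgue_integral_def)
    qed
  qed
  fix A :: "'a set" assume A: "A \<in> sets lebesgue"
  then obtain B N N' where BN': "A = B \<union> N" "N \<subseteq> N'" "N' \<in> null_sets lborel" "B \<in> sets lborel"
    by (rule sets_completionE)
  then have BN: "B \<in> sets borel" "N \<in> null_sets lebesgue" "A = B \<union> N"
    by (auto simp: null_sets_completion_iff2)
  have "(LINT x|lebesgue. indicator A x * f x) = (LINT x|lebesgue. indicator B x * f x)"
  proof (rule integral_cong_AE)
    show "AE x in lebesgue. indicator A x * f x = indicator B x * f x"
      using AE_not_in[OF BN(2)] by eventually_elim (use BN(3) in \<open>auto simp: indicator_def\<close>)
    show "(\<lambda>x. indicator A x * f x) \<in> borel_measurable lebesgue"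
      "(\<lambda>x. indicator B x * f x) \<in> borel_measurable lebesgue"
      using A BN(1) by (auto intro!: borel_measurable_times[OF borel_measurable_indicator borel_measurable_integrable[OF f]])
  qed
  then show "set_lebesgue_integral lebesgue A f = set_lebesgue_integral lebesgue A (\<lambda>x. 0)"
    using borel[OF BN(1)] by (simp add: set_lebesgue_integral_def)
qed

text \<open>Testing with the box cutoffs and passing to the limit by dominated convergence shows that the
  integral over every box with closure in \<open>\<Omega>\<close> vanishes; countably many such boxes cover \<open>\<Omega>\<close>.
  The lemma is what makes weak gradients unique, and hence the chosen representative \<open>wgrad\<close>
  linear almost everywhere.\<close>

lemma fundamental_lemma:
  fixes g :: "'a::euclidean_space \<Rightarrow> real"
  assumes "open \<Omega>" and g: "locally_integrable \<Omega> g"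
    and zero: "\<And>\<phi>. \<phi> \<in> test_functions \<Omega> \<Longrightarrow> (LINT x|lebesgue_on \<Omega>. g x * \<phi> x) = 0"
  shows "AE x in lebesgue_on \<Omega>. g x = 0"
proof -
  have \<Omega>: "\<Omega> \<in> sets lebesgue" using \<open>open \<Omega>\<close> by simp
  have int: "integrable lebesgue (\<lambda>x. indicator (cbox a c) x * g x)" if "cbox a c \<subseteq> \<Omega>" for a c
    using g that by (auto simp: locally_integrable_def set_integrable_def)
  have box: "(LINT x|lebesgue. indicator (box a c) x * g x) = 0" if "cbox a c \<subseteq> \<Omega>" for a c
  proof -
    let ?\<phi> = "\<lambda>n x. 1 - (1 - box_bump a c x) ^ n"
    have \<phi>: "?\<phi> n \<in> test_functions \<Omega>" for n using test_function_box[OF that] .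
    have z: "?\<phi> n x = 0" if "x \<notin> cbox a c" for n x
    proof -
      have "x \<notin> box a c" using that box_subset_cbox by blast
      then show ?thesis using box_bump_pos_iff[of a c x] box_bump_bounds[of a c x] by auto
    qed
    have "(\<lambda>n. LINT x|lebesgue. ?\<phi> n x * (indicator (cbox a c) x * g x)) \<longlonglongrightarrow>
        (LINT x|lebesgue. indicator (box a c) x * (indicator (cbox a c) x * g x))"
    proof (rule integral_dominated_convergence[where w = "\<lambda>x. norm (indicator (cbox a c) x * g x)"])
      show "integrable lebesgue (\<lambda>x. norm (indicator (cbox a c) x * g x))"
        using int[OF that] by (rule integrable_norm)
      show "AE x in lebesgue. (\<lambda>n. ?\<phi> n x * (indicator (cbox a c) x * g x))
         \<longlonglongrightarrow> indicator (box a c) x * (indicator (cbox a c) x * g x)"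
        by (intro AE_I2 tendsto_mult_right box_bump_powers_tendsto)
      show "AE x in lebesgue. norm (?\<phi> n x * (indicator (cbox a c) x * g x)) \<le> norm (indicator (cbox a c) x * g x)" for n
      proof (rule AE_I2)
        fix x
        have "0 \<le> (1 - box_bump a c x) ^ n" "(1 - box_bump a c x) ^ n \<le> 1"
          using box_bump_bounds[of a c x] by (auto intro: power_le_one)
        then have "\<bar>?\<phi> n x\<bar> \<le> 1" by simp
        then show "norm (?\<phi> n x * (indicator (cbox a c) x * g x)) \<le> norm (indicator (cbox a c) x * g x)"
          by (simp add: abs_mult mult_left_le_one_le)
      qed
      have "?\<phi> n \<in> borel_measurable lebesgue" for n
        using borel_measurable_continuous_onI[OF test_functionD(2)[OF \<phi>]]
        by (simp add: measurable_completion)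
      then show "(\<lambda>x. ?\<phi> n x * (indicator (cbox a c) x * g x)) \<in> borel_measurable lebesgue" for n
        using borel_measurable_integrable[OF int[OF that]] by (rule borel_measurable_times)
      show "(\<lambda>x. indicator (box a c) x * (indicator (cbox a c) x * g x)) \<in> borel_measurable lebesgue"
        by (rule borel_measurable_times[OF borel_measurable_indicator borel_measurable_integrable[OF int[OF that]]]) simp
    qed
    also have "(\<lambda>x. indicator (box a c) x * (indicator (cbox a c) x * g x)) = (\<lambda>x. indicator (box a c) x * g x)"
      using box_subset_cbox[of a c] by (auto simp: indicator_def fun_eq_iff)
    also have "(LINT x|lebesgue. ?\<phi> n x * (indicator (cbox a c) x * g x)) = 0" for n
    proof -
      have "(LINT x|lebesgue. ?\<phi> n x * (indicator (cbox a c) x * g x)) = (LINT x|lebesgue_on \<Omega>. g x * ?\<phi> n x)"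
        unfolding integral_restrict_space[of \<Omega> lebesgue, simplified, OF \<Omega>]
        using z[of _ n] that by (intro Bochner_Integration.integral_cong) (auto simp: indicator_def)
      then show ?thesis using zero[OF \<phi>] by simp
    qed
    ultimately show ?thesis by (simp add: LIMSEQ_const_iff)
  qed
  obtain D where D: "countable D" "\<And>X. X \<in> D \<Longrightarrow> X \<subseteq> \<Omega>" "\<And>X. X \<in> D \<Longrightarrow> \<exists>a b. X = cbox a b" "\<Union>D = \<Omega>"
  proof -
    from open_countable_Union_open_cbox[OF \<open>open \<Omega>\<close>]
    obtain D where "countable D" "D \<subseteq> Pow \<Omega>" "\<And>X. X \<in> D \<Longrightarrow> \<exists>a b. X = cbox a b" "\<Union>D = \<Omega>"
      by blast
    then show ?thesis by (intro that[of D]) auto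
  qed
  have "AE x in lebesgue. x \<in> X \<longrightarrow> g x = 0" if "X \<in> D" for X
  proof -
    obtain a c where X: "X = cbox a c" "cbox a c \<subseteq> \<Omega>" using D(2)[OF \<open>X \<in> D\<close>] D(3)[OF \<open>X \<in> D\<close>] by blast
    have "AE x in lebesgue. indicator (cbox a c) x * g x = 0"
    proof (rule zero_AE_if_box_integrals_zero[OF int[OF X(2)]])
      fix a' c' :: 'a
      obtain r s where rs: "box a' c' \<inter> box a c = box r s" using box_Int_box by blast
      have ae: "AE x in lebesgue. x \<notin> cbox a c - box a c"
      proof (rule AE_not_in)
        show "cbox a c - box a c \<in> null_sets lebesgue"
          using negligible_frontier_interval[of a c] by (simp add: negligible_iff_null_sets)
      qed
      show "(LINT x|lebesgue. indicator (box a' c') x * (indicator (cbox a c) x * g x)) = 0"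
      \<comment> \<open>A nonempty intersection has its closure in \<open>\<Omega>\<close>, while for an empty one the closure identity fails.\<close>
      proof (cases "box r s = {}")
        case True
        have "AE x in lebesgue. indicator (box a' c') x * (indicator (cbox a c) x * g x) = 0"
          using ae by eventually_elim (use rs True in \<open>auto simp: indicator_def\<close>)
        then show ?thesis by (rule integral_eq_zero_AE)
      next
        case False
        have "closure (box r s) \<subseteq> closure (box a c)" using rs by (intro closure_mono) auto
        moreover have "box a c \<noteq> {}" using False rs by auto
        ultimately have "cbox r s \<subseteq> \<Omega>" using X(2) False by (simp add: closure_box)
        have "(LINT x|lebesgue. indicator (box a' c') x * (indicator (cbox a c) x * g x)) =
            (LINT x|lebesgue. indicator (box r s) x * (indicator (cbox r s) x * g x))"
        proof (rule integral_cong_AE)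
          show "AE x in lebesgue. indicator (box a' c') x * (indicator (cbox a c) x * g x)
             = indicator (box r s) x * (indicator (cbox r s) x * g x)"
            using ae by eventually_elim
              (use rs[symmetric] box_subset_cbox[of r s] box_subset_cbox[of a c] in \<open>auto simp: indicator_def\<close>)
        qed (auto intro!: borel_measurable_times[OF borel_measurable_indicator borel_measurable_integrable[OF int[OF X(2)]]]
            borel_measurable_times[OF borel_measurable_indicator borel_measurable_integrable[OF int[OF \<open>cbox r s \<subseteq> \<Omega>\<close>]]])
        also have "(\<lambda>x. indicator (box r s) x * (indicator (cbox r s) x * g x)) = (\<lambda>x. indicator (box r s) x * g x)"
          using box_subset_cbox[of r s] by (auto simp: indicator_def fun_eq_iff)
        finally show ?thesis using box[OF \<open>cbox r s \<subseteq> \<Omega>\<close>] by simp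
      qed
    qed
    then show ?thesis unfolding X by eventually_elim (auto simp: indicator_def)
  qed
  then have "AE x in lebesgue. \<forall>X\<in>D. x \<in> X \<longrightarrow> g x = 0"
    using AE_ball_countable[OF D(1), of "\<lambda>x X. x \<in> X \<longrightarrow> g x = 0" lebesgue] by blast
  then have "AE x in lebesgue. x \<in> \<Omega> \<longrightarrow> g x = 0"
    by eventually_elim (use D(4) in auto)
  then show ?thesis using \<Omega> by (simp add: AE_restrict_space_iff)
qed

section \<open>Square integrable vector fields\<close>

text \<open>The inner product for vector-valued fields; with values in \<open>real \<times> 'a\<close> it applies to a function
  together with its weak gradient, so that the theory of \<open>H1\<close> reduces to that of \<open>L2\<close>.\<close>

definition L2_ip :: "'a::euclidean_space set \<Rightarrow> ('a \<Rightarrow> 'b::euclidean_space) \<Rightarrow> ('a \<Rightarrow> 'b) \<Rightarrow> real" where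
  "L2_ip \<Omega> f g = (LINT x|lebesgue_on \<Omega>. f x \<bullet> g x)"

lemma square_integrable_bound:
  assumes "f \<in> borel_measurable (lebesgue_on \<Omega>)" "integrable (lebesgue_on \<Omega>) h"
    and "\<And>x. (norm (f x))\<^sup>2 \<le> h x"
  shows "square_integrable \<Omega> f"
  unfolding square_integrable_def
proof (intro conjI assms)
  show "integrable (lebesgue_on \<Omega>) (\<lambda>x. (norm (f x))\<^sup>2)"
    by (rule Bochner_Integration.integrable_bound[OF assms(2)])
       (use assms in \<open>auto intro!: order_trans[OF assms(3)] simp: abs_ge_self\<close>)
qed

lemma square_integrable_lincomb:
  assumes "square_integrable \<Omega> f" "square_integrable \<Omega> g"
  shows "square_integrable \<Omega> (\<lambda>x. a *\<^sub>R f x + b *\<^sub>R g x)"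
proof (rule square_integrable_bound)
  show "(\<lambda>x. a *\<^sub>R f x + b *\<^sub>R g x) \<in> borel_measurable (lebesgue_on \<Omega>)"
    using assms by (auto simp: square_integrable_def)
  show "integrable (lebesgue_on \<Omega>) (\<lambda>x. 2 * a\<^sup>2 * (norm (f x))\<^sup>2 + 2 * b\<^sup>2 * (norm (g x))\<^sup>2)"
    using assms by (auto simp: square_integrable_def)
  fix x
  have "(norm (a *\<^sub>R f x + b *\<^sub>R g x))\<^sup>2 \<le> (\<bar>a\<bar> * norm (f x) + \<bar>b\<bar> * norm (g x))\<^sup>2"
    by (rule power_mono) (auto intro: order_trans[OF norm_triangle_ineq])
  also have "\<dots> \<le> 2 * (\<bar>a\<bar> * norm (f x))\<^sup>2 + 2 * (\<bar>b\<bar> * norm (g x))\<^sup>2"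
    using sum_squares_bound[of "\<bar>a\<bar> * norm (f x)" "\<bar>b\<bar> * norm (g x)"]
    by (simp add: power2_sum)
  finally show "(norm (a *\<^sub>R f x + b *\<^sub>R g x))\<^sup>2 \<le> 2 * a\<^sup>2 * (norm (f x))\<^sup>2 + 2 * b\<^sup>2 * (norm (g x))\<^sup>2"
    by (simp add: power_mult_distrib)
qed

lemma square_integrable_diff:
  "square_integrable \<Omega> f \<Longrightarrow> square_integrable \<Omega> g \<Longrightarrow> square_integrable \<Omega> (\<lambda>x. f x - g x)"
  using square_integrable_lincomb[of \<Omega> f g 1 "-1"] by simp

lemma integrable_inner:
  assumes "square_integrable \<Omega> f" "square_integrable \<Omega> g"
  shows "integrable (lebesgue_on \<Omega>) (\<lambda>x. f x \<bullet> g x)"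
proof (rule Bochner_Integration.integrable_bound)
  show "integrable (lebesgue_on \<Omega>) (\<lambda>x. (norm (f x))\<^sup>2 + (norm (g x))\<^sup>2)"
    using assms by (auto simp: square_integrable_def)
  show "(\<lambda>x. f x \<bullet> g x) \<in> borel_measurable (lebesgue_on \<Omega>)"
    using assms by (auto simp: square_integrable_def)
  have "norm (f x \<bullet> g x) \<le> norm ((norm (f x))\<^sup>2 + (norm (g x))\<^sup>2)" for x
    using Cauchy_Schwarz_ineq2[of "f x" "g x"] sum_squares_bound[of "norm (f x)" "norm (g x)"]
      mult_nonneg_nonneg[OF norm_ge_zero norm_ge_zero, of "f x" "g x"]
    by (simp add: abs_of_nonneg)
  then show "AE x in lebesgue_on \<Omega>. norm (f x \<bullet> g x) \<le> norm ((norm (f x))\<^sup>2 + (norm (g x))\<^sup>2)"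
    by simp
qed

lemma L2_ip_commute: "L2_ip \<Omega> f g = L2_ip \<Omega> g f"
  by (simp add: L2_ip_def inner_commute)

lemma L2_ip_lincomb_left:
  assumes "square_integrable \<Omega> f" "square_integrable \<Omega> g" "square_integrable \<Omega> h"
  shows "L2_ip \<Omega> (\<lambda>x. a *\<^sub>R f x + b *\<^sub>R g x) h = a * L2_ip \<Omega> f h + b * L2_ip \<Omega> g h"
  using integrable_inner[OF assms(1,3)] integrable_inner[OF assms(2,3)]
  by (simp add: L2_ip_def inner_add_left)

lemma L2_ip_diff_left:
  assumes "square_integrable \<Omega> f" "square_integrable \<Omega> g" "square_integrable \<Omega> h"
  shows "L2_ip \<Omega> (\<lambda>x. f x - g x) h = L2_ip \<Omega> f h - L2_ip \<Omega> g h"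
  using L2_ip_lincomb_left[OF assms, of 1 "-1"] by simp

lemma L2_ip_self_nonneg: "0 \<le> L2_ip \<Omega> f f"
  by (simp add: L2_ip_def integral_nonneg_AE)

lemma L2_ip_cong_AE:
  assumes "f \<in> borel_measurable (lebesgue_on \<Omega>)" "f' \<in> borel_measurable (lebesgue_on \<Omega>)"
    "g \<in> borel_measurable (lebesgue_on \<Omega>)" "g' \<in> borel_measurable (lebesgue_on \<Omega>)"
    and "AE x in lebesgue_on \<Omega>. f x = f' x" "AE x in lebesgue_on \<Omega>. g x = g' x"
  shows "L2_ip \<Omega> f g = L2_ip \<Omega> f' g'"
  unfolding L2_ip_def
  by (rule integral_cong_AE) (use assms in auto)

text \<open>The common core of the Cauchy-Schwarz inequality and of the first-order condition at a minimum of
  a quadratic functional.\<close>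

lemma quadratic_nonneg_imp_discriminant:
  fixes a b c :: real
  assumes "\<And>t. 0 \<le> a + 2 * t * b + t\<^sup>2 * c" "0 \<le> c"
  shows "b\<^sup>2 \<le> a * c"
proof (cases "c = 0")
  case True
  have "b = 0"
  proof (rule ccontr)
    assume "b \<noteq> 0"
    then show False using assms(1)[of "- (a + 1) / (2 * b)"] True by (simp add: field_simps)
  qed
  then show ?thesis using True by simp
next
  case False
  then have "c > 0" using assms by simp
  have "0 \<le> a + 2 * (- b / c) * b + (- b / c)\<^sup>2 * c" by (rule assms)
  also have "\<dots> = a - b\<^sup>2 / c" using False by (simp add: field_simps power2_eq_square)
  finally show ?thesis using \<open>c > 0\<close> by (simp add: field_simps)
qed

lemma L2_ip_square_lincomb:
  assumes "square_integrable \<Omega> f" "square_integrable \<Omega> g"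
  shows "L2_ip \<Omega> (\<lambda>x. a *\<^sub>R f x + b *\<^sub>R g x) (\<lambda>x. a *\<^sub>R f x + b *\<^sub>R g x) =
    a\<^sup>2 * L2_ip \<Omega> f f + 2 * a * b * L2_ip \<Omega> f g + b\<^sup>2 * L2_ip \<Omega> g g"
  using assms square_integrable_lincomb[OF assms, of a b]
  by (simp add: L2_ip_lincomb_left L2_ip_commute[of \<Omega> f "\<lambda>x. a *\<^sub>R f x + b *\<^sub>R g x"]
      L2_ip_commute[of \<Omega> g "\<lambda>x. a *\<^sub>R f x + b *\<^sub>R g x"] L2_ip_commute[of \<Omega> g f]
      algebra_simps power2_eq_square)

lemma L2_Cauchy_Schwarz:
  assumes "square_integrable \<Omega> f" "square_integrable \<Omega> g"
  shows "(L2_ip \<Omega> f g)\<^sup>2 \<le> L2_ip \<Omega> f f * L2_ip \<Omega> g g"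
proof (rule quadratic_nonneg_imp_discriminant)
  fix t
  show "0 \<le> L2_ip \<Omega> f f + 2 * t * L2_ip \<Omega> f g + t\<^sup>2 * L2_ip \<Omega> g g"
    using L2_ip_self_nonneg[of \<Omega> "\<lambda>x. 1 *\<^sub>R f x + t *\<^sub>R g x"]
    unfolding L2_ip_square_lincomb[OF assms, of 1 t] by simp
qed (rule L2_ip_self_nonneg)

lemma tendsto_zero_if_square_le:
  fixes x y :: "nat \<Rightarrow> real"
  assumes "\<And>n. (x n)\<^sup>2 \<le> y n * c" "y \<longlonglongrightarrow> 0"
  shows "x \<longlonglongrightarrow> 0"
proof -
  have "(\<lambda>n. (x n)\<^sup>2) \<longlonglongrightarrow> 0"
  proof (rule tendsto_sandwich[OF _ _ tendsto_const])
    show "\<forall>\<^sub>F n in sequentially. (x n)\<^sup>2 \<le> y n * c" using assms(1) by simp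
    show "(\<lambda>n. y n * c) \<longlonglongrightarrow> 0" using tendsto_mult_right[OF assms(2), of c] by simp
  qed simp
  from tendsto_real_sqrt[OF this] have "(\<lambda>n. \<bar>x n\<bar>) \<longlonglongrightarrow> 0" by simp
  then show ?thesis by (rule tendsto_rabs_zero_cancel)
qed

lemma L2_ip_tendsto:
  assumes "\<And>n. square_integrable \<Omega> (f n)" "square_integrable \<Omega> g" "square_integrable \<Omega> h"
    and lim: "(\<lambda>n. L2_ip \<Omega> (\<lambda>x. f n x - g x) (\<lambda>x. f n x - g x)) \<longlonglongrightarrow> 0"
  shows "(\<lambda>n. L2_ip \<Omega> (f n) h) \<longlonglongrightarrow> L2_ip \<Omega> g h"
proof -
  have "(\<lambda>n. L2_ip \<Omega> (\<lambda>x. f n x - g x) h) \<longlonglongrightarrow> 0"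
    using assms by (intro tendsto_zero_if_square_le[OF L2_Cauchy_Schwarz lim] square_integrable_diff)
  then have "(\<lambda>n. L2_ip \<Omega> (f n) h - L2_ip \<Omega> g h) \<longlonglongrightarrow> 0"
    using assms by (simp add: L2_ip_diff_left)
  then show ?thesis by (rule LIM_zero_cancel)
qed

lemma integral_le_of_nn_integral_le:
  fixes f :: "'a \<Rightarrow> real"
  assumes f: "f \<in> borel_measurable N" "\<And>x. 0 \<le> f x" and "0 \<le> c"
    and le: "(\<integral>\<^sup>+x. ennreal (f x) \<partial>N) \<le> ennreal c"
  shows "integrable N f" "(LINT x|N. f x) \<le> c"
proof -
  have f0: "AE x in N. 0 \<le> f x" using f(2) by simp
  show int: "integrable N f"
    by (rule integrableI_nonneg[OF f(1) f0 le_less_trans[OF le]]) simp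
  show "(LINT x|N. f x) \<le> c"
    using le \<open>0 \<le> c\<close> by (simp add: nn_integral_eq_integral[OF int f0])
qed

text \<open>Fatou's lemma for real-valued functions with eventually bounded integrals.\<close>

lemma integral_le_of_AE_tendsto:
  fixes h :: "nat \<Rightarrow> 'a \<Rightarrow> real"
  assumes "\<And>n. integrable N (h n)" "\<And>n x. 0 \<le> h n x"
    and k: "k \<in> borel_measurable N" "\<And>x. 0 \<le> k x"
    and lim: "AE x in N. (\<lambda>n. h n x) \<longlonglongrightarrow> k x"
    and bound: "eventually (\<lambda>n. (LINT x|N. h n x) \<le> c) sequentially"
  shows "integrable N k" "(LINT x|N. k x) \<le> c"
proof -
  have [measurable]: "h n \<in> borel_measurable N" for n using assms(1) by auto
  have c: "0 \<le> c"
  proof -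
    obtain n where "(LINT x|N. h n x) \<le> c" using bound by (auto simp: eventually_sequentially)
    moreover have "0 \<le> (LINT x|N. h n x)" using assms(2) by (simp add: integral_nonneg_AE)
    ultimately show ?thesis by linarith
  qed
  have "(\<integral>\<^sup>+x. ennreal (k x) \<partial>N) = (\<integral>\<^sup>+x. liminf (\<lambda>n. ennreal (h n x)) \<partial>N)"
    by (rule nn_integral_cong_AE)
       (use lim in \<open>auto elim!: eventually_mono intro!: lim_imp_Liminf[symmetric] tendsto_ennrealI\<close>)
  also have "\<dots> \<le> liminf (\<lambda>n. \<integral>\<^sup>+x. ennreal (h n x) \<partial>N)"
    by (rule nn_integral_liminf) simp
  also have "\<dots> \<le> ennreal c"
  proof (rule Liminf_le)
    show "\<forall>\<^sub>F n in sequentially. (\<integral>\<^sup>+x. ennreal (h n x) \<partial>N) \<le> ennreal c"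
      using bound by eventually_elim
        (use assms(1,2) in \<open>simp add: nn_integral_eq_integral ennreal_leI\<close>)
  qed simp
  finally have *: "(\<integral>\<^sup>+x. ennreal (k x) \<partial>N) \<le> ennreal c" .
  from integral_le_of_nn_integral_le[OF k c *] show "integrable N k" "(LINT x|N. k x) \<le> c" .
qed

lemma finite_measure_bounded_open:
  assumes "open \<Omega>" "bounded \<Omega>"
  shows "finite_measure (lebesgue_on \<Omega>)"
  using assms by (intro finite_measure_lebesgue_on bounded_set_imp_lmeasurable) auto

lemma square_integrable_const: "open \<Omega> \<Longrightarrow> bounded \<Omega> \<Longrightarrow> square_integrable \<Omega> (\<lambda>x. c)"
  using finite_measure.integrable_const[OF finite_measure_bounded_open]
  by (auto simp: square_integrable_def)

lemma square_integrable_imp_integrable: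
  assumes "open \<Omega>" "bounded \<Omega>" "square_integrable \<Omega> f"
  shows "integrable (lebesgue_on \<Omega>) f"
proof (rule Bochner_Integration.integrable_bound)
  interpret finite_measure "lebesgue_on \<Omega>" by (rule finite_measure_bounded_open) fact+
  show "integrable (lebesgue_on \<Omega>) (\<lambda>x. 1 + (norm (f x))\<^sup>2)"
    using assms(3) by (auto simp: square_integrable_def)
  show "f \<in> borel_measurable (lebesgue_on \<Omega>)" using assms(3) by (auto simp: square_integrable_def)
  have "norm (f x) \<le> norm (1 + (norm (f x))\<^sup>2)" for x
    using sum_squares_bound[of 1 "norm (f x)"] norm_ge_zero[of "f x"]
    by (simp add: abs_of_nonneg del: norm_ge_zero)
  then show "AE x in lebesgue_on \<Omega>. norm (f x) \<le> norm (1 + (norm (f x))\<^sup>2)" by simp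
qed

lemma square_integrable_imp_locally_integrable:
  assumes "open \<Omega>" "bounded \<Omega>" "square_integrable \<Omega> f"
  shows "locally_integrable \<Omega> f"
  unfolding locally_integrable_def
proof safe
  fix K assume K: "compact K" "K \<subseteq> \<Omega>"
  have "set_integrable lebesgue \<Omega> f"
    using square_integrable_imp_integrable[OF assms] \<open>open \<Omega>\<close>
    by (simp add: integrable_restrict_space set_integrable_def)
  then show "f absolutely_integrable_on K"
    by (rule set_integrable_subset) (use K in \<open>auto simp: compact_imp_closed\<close>)
qed

text \<open>On a domain of finite measure an \<open>L2\<close>-Cauchy sequence is \<open>L1\<close>-Cauchy, hence has an almost
  everywhere convergent subsequence.  Its pointwise limit is the \<open>L2\<close>-limit, by Fatou's lemma
  applied to the differences with a fixed member of the sequence.\<close>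

lemma square_integrable_complete:
  fixes f :: "nat \<Rightarrow> 'a::euclidean_space \<Rightarrow> 'b::euclidean_space"
  assumes \<Omega>: "open \<Omega>" "bounded \<Omega>" and f: "\<And>n. square_integrable \<Omega> (f n)"
    and Cauchy: "\<And>e. e > 0 \<Longrightarrow>
      \<exists>N. \<forall>i\<ge>N. \<forall>j\<ge>N. L2_ip \<Omega> (\<lambda>x. f i x - f j x) (\<lambda>x. f i x - f j x) < e"
  obtains g where "square_integrable \<Omega> g"
    "(\<lambda>n. L2_ip \<Omega> (\<lambda>x. f n x - g x) (\<lambda>x. f n x - g x)) \<longlonglongrightarrow> 0"
proof -
  let ?M = "lebesgue_on \<Omega>"
  \<comment> \<open>One more than the volume of \<open>\<Omega>\<close>, so that it can be divided by.\<close>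
  define m where "m = 1 + L2_ip \<Omega> (\<lambda>x. 1::real) (\<lambda>x. 1)"
  have m: "m > 0" using L2_ip_self_nonneg[of \<Omega> "\<lambda>x. 1::real"] by (simp add: m_def)
  have "\<exists>N. \<forall>i\<ge>N. \<forall>j\<ge>N. (LINT x|?M. norm (f i x - f j x)) < e" if "e > 0" for e
  proof -
    from Cauchy[of "e\<^sup>2 / m"] that m obtain N where
      N: "\<forall>i\<ge>N. \<forall>j\<ge>N. L2_ip \<Omega> (\<lambda>x. f i x - f j x) (\<lambda>x. f i x - f j x) < e\<^sup>2 / m" by auto
    have "(LINT x|?M. norm (f i x - f j x)) < e" if "i \<ge> N" "j \<ge> N" for i j
    proof -
      have sq: "square_integrable \<Omega> (\<lambda>x. f i x - f j x)" using f by (intro square_integrable_diff)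
      then have sq': "square_integrable \<Omega> (\<lambda>x. norm (f i x - f j x))"
        by (auto simp: square_integrable_def)
      have "(LINT x|?M. norm (f i x - f j x))\<^sup>2 \<le>
          L2_ip \<Omega> (\<lambda>x. f i x - f j x) (\<lambda>x. f i x - f j x) * L2_ip \<Omega> (\<lambda>x. 1::real) (\<lambda>x. 1)"
        using L2_Cauchy_Schwarz[OF sq' square_integrable_const[OF \<Omega>, of 1]]
        by (simp add: L2_ip_def power2_norm_eq_inner power2_eq_square[symmetric])
      also have "\<dots> \<le> L2_ip \<Omega> (\<lambda>x. f i x - f j x) (\<lambda>x. f i x - f j x) * m"
        by (intro mult_left_mono L2_ip_self_nonneg) (simp add: m_def)
      also have "\<dots> < e\<^sup>2" using N that m by (simp add: field_simps)
      finally show ?thesis using \<open>e > 0\<close> by (simp add: power_less_imp_less_base)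
    qed
    then show ?thesis by blast
  qed
  then obtain r where r: "strict_mono r" "AE x in ?M. Cauchy (\<lambda>i. f (r i) x)"
    using cauchy_L1_AE_cauchy_subseq[of ?M f] square_integrable_imp_integrable[OF \<Omega> f] by blast
  define g where "g x = lim (\<lambda>i. f (r i) x)" for x
  have fm: "f n \<in> borel_measurable ?M" for n using f by (auto simp: square_integrable_def)
  have gm: "g \<in> borel_measurable ?M"
    unfolding g_def[abs_def] by (rule borel_measurable_lim_metric) (rule fm)
  have lim: "AE x in ?M. (\<lambda>i. f (r i) x) \<longlonglongrightarrow> g x"
    using r(2) by eventually_elim (simp add: g_def Cauchy_convergent_iff convergent_LIMSEQ_iff)
  have *: "integrable ?M (\<lambda>x. (norm (f n x - g x))\<^sup>2)" "(LINT x|?M. (norm (f n x - g x))\<^sup>2) \<le> e"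
    if N: "\<forall>i\<ge>N. \<forall>j\<ge>N. L2_ip \<Omega> (\<lambda>x. f i x - f j x) (\<lambda>x. f i x - f j x) < e" and "n \<ge> N" for n N e
  proof -
    have 1: "integrable ?M (\<lambda>x. (norm (f n x - f (r i) x))\<^sup>2)" for i
      using square_integrable_diff[OF f f] by (auto simp: square_integrable_def)
    have 2: "(\<lambda>x. (norm (f n x - g x))\<^sup>2) \<in> borel_measurable ?M" using fm gm by simp
    have 3: "AE x in ?M. (\<lambda>i. (norm (f n x - f (r i) x))\<^sup>2) \<longlonglongrightarrow> (norm (f n x - g x))\<^sup>2"
      using lim by eventually_elim (auto intro!: tendsto_intros)
    have 4: "eventually (\<lambda>i. (LINT x|?M. (norm (f n x - f (r i) x))\<^sup>2) \<le> e) sequentially"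
    proof -
      have "(LINT x|?M. (norm (f n x - f (r i) x))\<^sup>2) \<le> e" if "i \<ge> N" for i
      proof -
        have "r i \<ge> N" using seq_suble[OF r(1), of i] that by linarith
        then have "L2_ip \<Omega> (\<lambda>x. f n x - f (r i) x) (\<lambda>x. f n x - f (r i) x) < e"
          using N \<open>n \<ge> N\<close> by blast
        then show ?thesis by (simp add: L2_ip_def power2_norm_eq_inner)
      qed
      then show ?thesis by (auto simp: eventually_sequentially)
    qed
    show "integrable ?M (\<lambda>x. (norm (f n x - g x))\<^sup>2)" "(LINT x|?M. (norm (f n x - g x))\<^sup>2) \<le> e"
      using integral_le_of_AE_tendsto[OF 1 _ 2 _ 3 4] by auto
  qed
  show ?thesis
  proof (rule that)
    obtain N where N: "\<forall>i\<ge>N. \<forall>j\<ge>N. L2_ip \<Omega> (\<lambda>x. f i x - f j x) (\<lambda>x. f i x - f j x) < 1"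
      using Cauchy[of 1] by auto
    have "square_integrable \<Omega> (\<lambda>x. f N x - g x)"
      using *(1)[OF N order_refl] fm gm by (auto simp: square_integrable_def)
    from square_integrable_diff[OF f[of N] this] show "square_integrable \<Omega> g" by simp
    show "(\<lambda>n. L2_ip \<Omega> (\<lambda>x. f n x - g x) (\<lambda>x. f n x - g x)) \<longlonglongrightarrow> 0"
    proof (rule LIMSEQ_I)
      fix e :: real assume "e > 0"
      then obtain N where N: "\<forall>i\<ge>N. \<forall>j\<ge>N. L2_ip \<Omega> (\<lambda>x. f i x - f j x) (\<lambda>x. f i x - f j x) < e / 2"
        using Cauchy[of "e / 2"] by auto
      have "norm (L2_ip \<Omega> (\<lambda>x. f n x - g x) (\<lambda>x. f n x - g x) - 0) < e" if "n \<ge> N" for n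
        using *(2)[OF N that] \<open>e > 0\<close> L2_ip_self_nonneg[of \<Omega> "\<lambda>x. f n x - g x"]
        by (simp add: L2_ip_def power2_norm_eq_inner)
      then show "\<exists>N. \<forall>n\<ge>N. norm (L2_ip \<Omega> (\<lambda>x. f n x - g x) (\<lambda>x. f n x - g x) - 0) < e" by blast
    qed
  qed
qed

section \<open>Weak gradients\<close>

lemma bounded_if_compact_support:
  fixes f :: "'a::euclidean_space \<Rightarrow> real"
  assumes "continuous_on UNIV f" "compact K" "\<And>x. x \<notin> K \<Longrightarrow> f x = 0"
  obtains B where "B > 0" "\<And>x. \<bar>f x\<bar> \<le> B"
proof -
  have "bounded (f ` K)"
    by (intro compact_imp_bounded compact_continuous_image continuous_on_subset[OF assms(1)] assms) auto
  then obtain B where B: "\<forall>x\<in>K. \<bar>f x\<bar> \<le> B" by (auto simp: bounded_iff)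
  have "\<bar>f x\<bar> \<le> max B 1" for x using B assms(3)[of x] by (cases "x \<in> K") auto
  then show ?thesis by (intro that[of "max B 1"]) auto
qed

lemma frechet_derivative_outside_support:
  fixes \<phi> :: "'a::euclidean_space \<Rightarrow> real"
  assumes "x \<notin> closure {x. \<phi> x \<noteq> 0}"
  shows "frechet_derivative \<phi> (at x) b = 0"
proof -
  have "(\<phi> has_derivative (\<lambda>_. 0)) (at x)"
  proof (rule has_derivative_transform_within_open[of "\<lambda>_. 0" _ _ _ "- closure {x. \<phi> x \<noteq> 0}"])
    show "0 = \<phi> y" if "y \<in> - closure {x. \<phi> x \<noteq> 0}" for y
      using that closure_subset[of "{x. \<phi> x \<noteq> 0}"] by auto
  qed (use assms in auto)
  then show ?thesis by (simp add: frechet_derivative_at[symmetric])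
qed

lemma test_function_outside:
  assumes "\<phi> \<in> test_functions \<Omega>"
  shows "x \<notin> closure {x. \<phi> x \<noteq> 0} \<Longrightarrow> \<phi> x = 0" "x \<notin> \<Omega> \<Longrightarrow> \<phi> x = 0"
    "x \<notin> \<Omega> \<Longrightarrow> frechet_derivative \<phi> (at x) b = 0"
proof -
  show 1: "\<phi> x = 0" if "x \<notin> closure {x. \<phi> x \<noteq> 0}" for x
    using that closure_subset[of "{x. \<phi> x \<noteq> 0}"] by blast
  show "x \<notin> \<Omega> \<Longrightarrow> \<phi> x = 0" using 1 test_functionD(7)[OF assms] by blast
  show "x \<notin> \<Omega> \<Longrightarrow> frechet_derivative \<phi> (at x) b = 0"
    using frechet_derivative_outside_support test_functionD(7)[OF assms] by blast
qed

lemma closed_subset_compact: "compact K \<Longrightarrow> closure S \<subseteq> K \<Longrightarrow> compact (closure S)"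
  using compact_Int_closed[of K "closure S"] by (simp add: Int_absorb1)

lemma test_functions_lincomb:
  assumes "\<phi> \<in> test_functions \<Omega>" "\<psi> \<in> test_functions \<Omega>"
  shows "(\<lambda>x. a * \<phi> x + b * \<psi> x) \<in> test_functions \<Omega>"
proof -
  have "C_k k (\<lambda>x. a * \<phi> x + b * \<psi> x)" for k
    by (intro C_k_add C_k_mult C_k_const test_functionD(1)[OF assms(1)] test_functionD(1)[OF assms(2)])
  moreover have "closure {x. a * \<phi> x + b * \<psi> x \<noteq> 0} \<subseteq> closure {x. \<phi> x \<noteq> 0} \<union> closure {x. \<psi> x \<noteq> 0}"
    unfolding closure_Un[symmetric] by (rule closure_mono) auto
  moreover from this have "compact (closure {x. a * \<phi> x + b * \<psi> x \<noteq> 0})"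
    by (rule closed_subset_compact[OF compact_Un[OF test_functionD(6)[OF assms(1)] test_functionD(6)[OF assms(2)]]])
  ultimately show ?thesis
    using test_functionD(7)[OF assms(1)] test_functionD(7)[OF assms(2)]
    unfolding test_functions_def by blast
qed

lemma test_functions_mult:
  assumes "\<phi> \<in> test_functions \<Omega>" "\<psi> \<in> test_functions \<Omega>"
  shows "(\<lambda>x. \<phi> x * \<psi> x) \<in> test_functions \<Omega>"
proof -
  have "C_k k (\<lambda>x. \<phi> x * \<psi> x)" for k
    by (intro C_k_mult test_functionD(1)[OF assms(1)] test_functionD(1)[OF assms(2)])
  moreover have "closure {x. \<phi> x * \<psi> x \<noteq> 0} \<subseteq> closure {x. \<phi> x \<noteq> 0}"
    by (rule closure_mono) auto
  moreover from this have "compact (closure {x. \<phi> x * \<psi> x \<noteq> 0})"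
    by (rule closed_subset_compact[OF test_functionD(6)[OF assms(1)]])
  ultimately show ?thesis
    using test_functionD(7)[OF assms(1)]
    unfolding test_functions_def by blast
qed

lemma zero_test_function: "(\<lambda>x. 0) \<in> test_functions \<Omega>"
  by (simp add: test_functions_def C_k_const)

text \<open>The difference quotients have integral zero by translation invariance of the Lebesgue measure, and
  they converge boundedly to the partial derivative.  Applied to a product of two test functions
  this is integration by parts.\<close>

lemma integral_partial_test_function:
  fixes F :: "'a::euclidean_space \<Rightarrow> real"
  assumes F: "F \<in> test_functions \<Omega>" and "open \<Omega>" "b \<in> Basis"
  shows "(LINT x|lebesgue_on \<Omega>. frechet_derivative F (at x) b) = 0"
proof -
  let ?K = "closure {x. F x \<noteq> 0}"
  let ?F' = "\<lambda>x. frechet_derivative F (at x) b"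
  have cF: "continuous_on UNIV F" and cF': "continuous_on UNIV ?F'"
    using test_functionD[OF F] \<open>b \<in> Basis\<close> by auto
  have mF [measurable]: "F \<in> borel_measurable borel" and mF' [measurable]: "?F' \<in> borel_measurable borel"
    using cF cF' by (auto intro: borel_measurable_continuous_onI)
  obtain B where B: "B > 0" "\<And>x. \<bar>?F' x\<bar> \<le> B"
    using bounded_if_compact_support[OF cF' test_functionD(6)[OF F] frechet_derivative_outside_support] by blast
  obtain B0 where B0: "B0 > 0" "\<And>x. \<bar>F x\<bar> \<le> B0"
    using bounded_if_compact_support[OF cF test_functionD(6)[OF F] test_function_outside(1)[OF F]] by blast
  obtain R where R: "\<And>x. x \<in> ?K \<Longrightarrow> norm x \<le> R"
    using compact_imp_bounded[OF test_functionD(6)[OF F]] by (auto simp: bounded_iff)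
  have deriv: "((\<lambda>s. F (x + s *\<^sub>R b)) has_real_derivative ?F' (x + s *\<^sub>R b)) (at s)" for x s
  proof -
    have "(F has_derivative frechet_derivative F (at (x + s *\<^sub>R b))) (at (x + s *\<^sub>R b))"
      using test_functionD(3)[OF F] by (simp add: frechet_derivative_works)
    note d = this
    have "((\<lambda>s. F (x + s *\<^sub>R b)) has_derivative (\<lambda>h. frechet_derivative F (at (x + s *\<^sub>R b)) (h *\<^sub>R b))) (at s)"
      by (rule has_derivative_compose[where g = F and f = "\<lambda>s. x + s *\<^sub>R b", OF _ d])
         (auto intro!: derivative_eq_intros)
    then show ?thesis unfolding has_field_derivative_def
    proof (rule has_derivative_eq_rhs)
      show "(\<lambda>h. frechet_derivative F (at (x + s *\<^sub>R b)) (h *\<^sub>R b)) = (*) (?F' (x + s *\<^sub>R b))"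
      proof
        fix h
        show "frechet_derivative F (at (x + s *\<^sub>R b)) (h *\<^sub>R b) = ?F' (x + s *\<^sub>R b) * h"
          using linear_scale[OF has_derivative_linear[OF d], of h b] by (simp only: real_scaleR_def mult.commute)
      qed
    qed
  qed
  define q where "q n x = (F (x + (1 / real (Suc n)) *\<^sub>R b) - F x) / (1 / real (Suc n))" for n x
  have iF: "integrable lborel F"
  proof (rule Bochner_Integration.integrable_bound)
    show "integrable lborel (\<lambda>x::'a. B0 * indicator (cball 0 R) x :: real)"
      using emeasure_bounded_finite[OF bounded_cball, of "0::'a"]
      by (intro integrable_mult_right integrable_real_indicator) auto
    show "AE x in lborel. norm (F x) \<le> norm (B0 * indicator (cball 0 R) x :: real)"
    proof (rule AE_I2)
      fix x
      show "norm (F x) \<le> norm (B0 * indicator (cball 0 R) x :: real)"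
      proof (cases "x \<in> ?K")
        case True
        then show ?thesis using R[of x] B0(2)[of x] by simp
      next
        case False
        then have "F x = 0" by (rule test_function_outside(1)[OF F])
        then show ?thesis by simp
      qed
    qed
  qed simp
  have q0: "(LINT x|lborel. q n x) = 0" for n
  proof -
    let ?t = "(1 / real (Suc n)) *\<^sub>R b"
    have t: "(+) ?t \<in> measurable lborel borel" by measurable
    have "integrable (distr lborel borel ((+) ?t)) F" "(LINT x|distr lborel borel ((+) ?t). F x) = (LINT x|lborel. F x)"
      unfolding lborel_distr_plus using iF by auto
    then have "integrable lborel (\<lambda>x. F (?t + x))" "(LINT x|lborel. F (?t + x)) = (LINT x|lborel. F x)"
      unfolding integrable_distr_eq[OF t mF] integral_distr[OF t mF] .
    then have "integrable lborel (\<lambda>x. F (x + ?t))" "(LINT x|lborel. F (x + ?t)) = (LINT x|lborel. F x)"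
      unfolding add.commute[of ?t] .
    then show ?thesis using iF unfolding q_def by simp
  qed
  have "(\<lambda>n. LINT x|lborel. q n x) \<longlonglongrightarrow> (LINT x|lborel. ?F' x)"
  proof (rule integral_dominated_convergence[where w = "\<lambda>x. B * indicator (cball 0 (R + 1)) x"])
    show "integrable lborel (\<lambda>x::'a. B * indicator (cball 0 (R + 1)) x :: real)"
      using emeasure_bounded_finite[OF bounded_cball, of "0::'a"]
      by (intro integrable_mult_right integrable_real_indicator) auto
    show "AE x in lborel. (\<lambda>n. q n x) \<longlonglongrightarrow> ?F' x"
    proof (rule AE_I2)
      fix x
      have "(\<lambda>h. (F (x + (0 + h) *\<^sub>R b) - F (x + 0 *\<^sub>R b)) / h) \<midarrow>0\<rightarrow> ?F' (x + 0 *\<^sub>R b)"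
        using deriv[of x 0] by (simp only: DERIV_def)
      then have "(\<lambda>h. (F (x + h *\<^sub>R b) - F x) / h) \<midarrow>0\<rightarrow> ?F' x" by simp
      then have "filterlim (\<lambda>n. 1 / real (Suc n)) (at 0) sequentially \<Longrightarrow> (\<lambda>n. q n x) \<longlonglongrightarrow> ?F' x"
        unfolding q_def by (rule filterlim_compose)
      moreover have "filterlim (\<lambda>n. 1 / real (Suc n)) (at 0) sequentially"
        unfolding filterlim_at using LIMSEQ_Suc[OF lim_1_over_n] by auto
      ultimately show "(\<lambda>n. q n x) \<longlonglongrightarrow> ?F' x" by blast
    qed
    show "AE x in lborel. norm (q n x) \<le> B * indicator (cball 0 (R + 1)) x" for n
    proof (rule AE_I2)
      fix x
      let ?t = "1 / real (Suc n)"
      show "norm (q n x) \<le> B * indicator (cball 0 (R + 1)) x"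
      proof (cases "x \<in> cball 0 (R + 1)")
        case True
        have "\<exists>z::real. z > 0 \<and> z < ?t \<and> F (x + ?t *\<^sub>R b) - F (x + 0 *\<^sub>R b) = (?t - 0) * ?F' (x + z *\<^sub>R b)"
          by (rule MVT2) (auto intro: deriv)
        then obtain z where "F (x + ?t *\<^sub>R b) - F x = ?t * ?F' (x + z *\<^sub>R b)" by auto
        then have "q n x = ?F' (x + z *\<^sub>R b)" by (simp add: q_def)
        then show ?thesis using True B by simp
      next
        case False
        then have nx: "norm x > R + 1" by simp
        have "norm x \<le> norm (x + ?t *\<^sub>R b) + norm (?t *\<^sub>R b)"
          using norm_triangle_ineq4[of "x + ?t *\<^sub>R b" "?t *\<^sub>R b"] by simp
        moreover have "norm (?t *\<^sub>R b) \<le> 1" using \<open>b \<in> Basis\<close> by (simp add: field_simps)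
        ultimately have "x \<notin> ?K" "x + ?t *\<^sub>R b \<notin> ?K" using R[of x] R[of "x + ?t *\<^sub>R b"] nx by linarith+
        then have "F x = 0" "F (x + ?t *\<^sub>R b) = 0" using test_function_outside(1)[OF F] by blast+
        then show ?thesis using False by (simp add: q_def)
      qed
    qed
    show "q n \<in> borel_measurable lborel" for n unfolding q_def[abs_def] by measurable
  qed simp
  then have "(LINT x|lborel. ?F' x) = 0" by (simp add: q0 LIMSEQ_const_iff)
  moreover have "(LINT x|lebesgue_on \<Omega>. ?F' x) = (LINT x|lebesgue. ?F' x)"
    using \<open>open \<Omega>\<close> test_function_outside(3)[OF F]
    by (subst integral_restrict_space) (auto intro!: Bochner_Integration.integral_cong simp: indicator_def)
  moreover have "(LINT x|lebesgue. ?F' x) = (LINT x|lborel. ?F' x)"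
    by (rule integral_completion) simp
  ultimately show ?thesis by simp
qed

lemma borel_measurable_lebesgue_on_cong_AE:
  fixes f g :: "'a::euclidean_space \<Rightarrow> 'b::euclidean_space"
  assumes "open \<Omega>" "f \<in> borel_measurable (lebesgue_on \<Omega>)" "AE x in lebesgue_on \<Omega>. f x = g x"
  shows "g \<in> borel_measurable (lebesgue_on \<Omega>)"
proof -
  have \<Omega>: "\<Omega> \<in> sets lebesgue" using assms(1) by simp
  have "(\<lambda>x. if x \<in> \<Omega> then f x else 0) \<in> borel_measurable lebesgue"
    using assms(2) by (simp add: borel_measurable_if \<Omega>)
  moreover have "AE x in lebesgue. (if x \<in> \<Omega> then f x else 0) = (if x \<in> \<Omega> then g x else 0)"
    using assms(3) \<Omega> by (auto simp: AE_restrict_space_iff elim: eventually_mono)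
  ultimately have "(\<lambda>x. if x \<in> \<Omega> then g x else 0) \<in> borel_measurable lebesgue"
    by (rule borel_measurable_AE)
  then show ?thesis by (simp add: borel_measurable_if \<Omega>)
qed

lemma square_integrable_cong_AE:
  fixes f g :: "'a::euclidean_space \<Rightarrow> 'b::euclidean_space"
  assumes "open \<Omega>" "square_integrable \<Omega> f" "AE x in lebesgue_on \<Omega>. f x = g x"
  shows "square_integrable \<Omega> g"
proof -
  have f: "f \<in> borel_measurable (lebesgue_on \<Omega>)" "integrable (lebesgue_on \<Omega>) (\<lambda>x. (norm (f x))\<^sup>2)"
    using assms(2) by (auto simp: square_integrable_def)
  have g: "g \<in> borel_measurable (lebesgue_on \<Omega>)"
    by (rule borel_measurable_lebesgue_on_cong_AE[OF assms(1) f(1) assms(3)])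
  have "integrable (lebesgue_on \<Omega>) (\<lambda>x. (norm (g x))\<^sup>2)"
    by (rule integrable_cong_AE_imp[OF f(2)]) (use g assms(3) in auto)
  with g show ?thesis by (simp add: square_integrable_def)
qed

lemma square_integrable_continuous:
  fixes f :: "'a::euclidean_space \<Rightarrow> 'b::euclidean_space"
  assumes "open \<Omega>" "bounded \<Omega>" "continuous_on UNIV f" "\<And>x. norm (f x) \<le> B"
  shows "square_integrable \<Omega> f"
proof (rule square_integrable_bound)
  have "f \<in> borel_measurable borel" using assms(3) by (rule borel_measurable_continuous_onI)
  then show "f \<in> borel_measurable (lebesgue_on \<Omega>)"
    by (simp add: measurable_completion measurable_restrict_space1)
  show "integrable (lebesgue_on \<Omega>) (\<lambda>x. B\<^sup>2)"
    by (rule finite_measure.integrable_const[OF finite_measure_bounded_open]) fact+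
  show "(norm (f x))\<^sup>2 \<le> B\<^sup>2" for x using assms(4) by (intro power_mono) auto
qed

definition gradient :: "('a::euclidean_space \<Rightarrow> real) \<Rightarrow> 'a \<Rightarrow> 'a" where
  "gradient \<phi> x = (\<Sum>b\<in>Basis. frechet_derivative \<phi> (at x) b *\<^sub>R b)"

text \<open>Pairing a function with its weak gradient turns the \<open>H1\<close> inner product into an \<open>L2\<close> inner
  product of vector fields.\<close>

definition jet :: "'a::euclidean_space set \<Rightarrow> ('a \<Rightarrow> real) \<Rightarrow> 'a \<Rightarrow> real \<times> 'a" where
  "jet \<Omega> u x = (u x, wgrad \<Omega> u x)"

lemma gradient_inner_Basis: "b \<in> Basis \<Longrightarrow> gradient \<phi> x \<bullet> b = frechet_derivative \<phi> (at x) b"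
  by (simp add: gradient_def inner_sum_left inner_Basis if_distrib cong: if_cong)

lemma H1_inner_eq: "H1_inner \<Omega> f g = L2_ip \<Omega> (jet \<Omega> f) (jet \<Omega> g)"
  by (simp add: H1_inner_def L2_ip_def jet_def)

locale bounded_open =
  fixes \<Omega> :: "'a::euclidean_space set"
  assumes open_\<Omega>: "open \<Omega>" and bounded_\<Omega>: "bounded \<Omega>"
begin

abbreviation L where "L \<equiv> lebesgue_on \<Omega>"

lemma square_integrable_test:
  assumes "\<phi> \<in> test_functions \<Omega>"
  shows "square_integrable \<Omega> \<phi>"
proof -
  obtain B where "B > 0" and B: "\<And>x. \<bar>\<phi> x\<bar> \<le> B"
    by (rule bounded_if_compact_support[OF test_functionD(2)[OF assms] test_functionD(6)[OF assms]
        test_function_outside(1)[OF assms]]) blast+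
  have "norm (\<phi> x) \<le> B" for x using B[of x] by simp
  then show ?thesis
    by (rule square_integrable_continuous[OF open_\<Omega> bounded_\<Omega> test_functionD(2)[OF assms]])
qed

lemma square_integrable_partial:
  assumes "\<phi> \<in> test_functions \<Omega>" "b \<in> Basis"
  shows "square_integrable \<Omega> (\<lambda>x. frechet_derivative \<phi> (at x) b)"
proof -
  obtain B where "B > 0" and B: "\<And>x. \<bar>frechet_derivative \<phi> (at x) b\<bar> \<le> B"
    by (rule bounded_if_compact_support[OF test_functionD(5)[OF assms] test_functionD(6)[OF assms(1)]
        frechet_derivative_outside_support]) blast+
  have "norm (frechet_derivative \<phi> (at x) b) \<le> B" for x using B[of x] by simp
  then show ?thesis
    by (rule square_integrable_continuous[OF open_\<Omega> bounded_\<Omega> test_functionD(5)[OF assms]])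
qed

lemma square_integrable_Pair:
  assumes "square_integrable \<Omega> f" "square_integrable \<Omega> g"
  shows "square_integrable \<Omega> (\<lambda>x. (f x, g x))"
proof (rule square_integrable_bound)
  show "(\<lambda>x. (f x, g x)) \<in> borel_measurable L"
    using assms unfolding square_integrable_def by (intro borel_measurable_Pair) auto
  show "integrable L (\<lambda>x. (norm (f x))\<^sup>2 + (norm (g x))\<^sup>2)"
    using assms unfolding square_integrable_def by auto
qed (simp add: norm_Pair)

lemma square_integrable_fst:
    "square_integrable \<Omega> (f :: 'a \<Rightarrow> 'b::euclidean_space \<times> 'c::euclidean_space) \<Longrightarrow>
      square_integrable \<Omega> (\<lambda>x. fst (f x))"
  and square_integrable_snd: "square_integrable \<Omega> f \<Longrightarrow> square_integrable \<Omega> (\<lambda>x. snd (f x))"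
proof -
  assume f: "square_integrable \<Omega> f"
  have m: "fst \<in> borel_measurable borel" "snd \<in> borel_measurable borel"
    by (intro borel_measurable_continuous_onI continuous_intros)+
  have i: "integrable L (\<lambda>x. (norm (f x))\<^sup>2)" and fm: "f \<in> borel_measurable L"
    using f by (auto simp: square_integrable_def)
  have n: "norm (fst z) \<le> norm z" "norm (snd z) \<le> norm z" for z :: "'b \<times> 'c"
    using norm_fst_le[of "fst z" "snd z"] norm_snd_le[of "snd z" "fst z"] by simp_all
  show "square_integrable \<Omega> (\<lambda>x. fst (f x))" "square_integrable \<Omega> (\<lambda>x. snd (f x))"
    by (rule square_integrable_bound[OF measurable_compose[OF fm m(1)] i]
          square_integrable_bound[OF measurable_compose[OF fm m(2)] i];
        simp add: n power_mono)+
qed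

lemma square_integrable_scale_vec:
  assumes "square_integrable \<Omega> (f :: 'a \<Rightarrow> real)"
  shows "square_integrable \<Omega> (\<lambda>x. f x *\<^sub>R (b::'a))"
proof (rule square_integrable_bound)
  show "integrable L (\<lambda>x. (norm (f x))\<^sup>2 * (norm b)\<^sup>2)"
    using assms by (auto simp: square_integrable_def)
qed (use assms in \<open>auto simp: square_integrable_def power_mult_distrib\<close>)

text \<open>The defining identity of weak gradients is a family of orthogonality relations for the pair
  \<open>(u, g)\<close>.  In this form it is visibly preserved under linear combinations and \<open>L2\<close>-limits.\<close>

lemma weak_gradient_iff:
  assumes u: "square_integrable \<Omega> u" and g: "square_integrable \<Omega> g"
  shows "weak_gradient \<Omega> u g \<longleftrightarrow> (\<forall>\<phi>\<in>test_functions \<Omega>. \<forall>b\<in>Basis.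
    L2_ip \<Omega> (\<lambda>x. (u x, g x)) (\<lambda>x. (frechet_derivative \<phi> (at x) b, \<phi> x *\<^sub>R b)) = 0)"
proof -
  have "(LINT x|L. u x * frechet_derivative \<phi> (at x) b) = - (LINT x|L. (g x \<bullet> b) * \<phi> x) \<longleftrightarrow>
    L2_ip \<Omega> (\<lambda>x. (u x, g x)) (\<lambda>x. (frechet_derivative \<phi> (at x) b, \<phi> x *\<^sub>R b)) = 0"
    if "\<phi> \<in> test_functions \<Omega>" "b \<in> Basis" for \<phi> b
  proof -
    have 1: "integrable L (\<lambda>x. u x * frechet_derivative \<phi> (at x) b)"
      using integrable_inner[OF u square_integrable_partial[OF that]] by simp
    have 2: "integrable L (\<lambda>x. (g x \<bullet> b) * \<phi> x)"
      using integrable_inner[OF g square_integrable_scale_vec[OF square_integrable_test[OF that(1)]], of b]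
      by (simp add: mult.commute)
    have "L2_ip \<Omega> (\<lambda>x. (u x, g x)) (\<lambda>x. (frechet_derivative \<phi> (at x) b, \<phi> x *\<^sub>R b)) =
      (LINT x|L. u x * frechet_derivative \<phi> (at x) b + (g x \<bullet> b) * \<phi> x)"
      unfolding L2_ip_def by (simp add: mult.commute)
    also have "\<dots> = (LINT x|L. u x * frechet_derivative \<phi> (at x) b) + (LINT x|L. (g x \<bullet> b) * \<phi> x)"
      by (rule Bochner_Integration.integral_add[OF 1 2])
    finally show ?thesis by linarith
  qed
  then show ?thesis
    unfolding weak_gradient_def
    using square_integrable_imp_locally_integrable[OF open_\<Omega> bounded_\<Omega> u]
      square_integrable_imp_locally_integrable[OF open_\<Omega> bounded_\<Omega> g] by auto
qed

lemma weak_gradient_unique: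
  assumes "weak_gradient \<Omega> u g" "weak_gradient \<Omega> u h"
  shows "AE x in L. g x = h x"
proof -
  have g: "locally_integrable \<Omega> g" and h: "locally_integrable \<Omega> h"
    using assms by (auto simp: weak_gradient_def)
  have "AE x in L. (g x - h x) \<bullet> b = 0" if b: "b \<in> Basis" for b
  proof (rule fundamental_lemma[OF open_\<Omega>])
    show "locally_integrable \<Omega> (\<lambda>x. (g x - h x) \<bullet> b)"
      unfolding locally_integrable_def
    proof safe
      fix K assume "compact K" "K \<subseteq> \<Omega>"
      then have "g absolutely_integrable_on K" "h absolutely_integrable_on K"
        using g h by (auto simp: locally_integrable_def)
      then have "(\<lambda>x. g x - h x) absolutely_integrable_on K"
        by (rule set_integral_diff)
      then have "integrable lebesgue (\<lambda>x. (indicator K x *\<^sub>R (g x - h x)) \<bullet> b)"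
        unfolding set_integrable_def by (rule integrable_inner_left)
      then show "(\<lambda>x. (g x - h x) \<bullet> b) absolutely_integrable_on K"
        by (simp add: set_integrable_def)
    qed
    fix \<phi> assume \<phi>: "\<phi> \<in> test_functions \<Omega>"
    have int: "integrable L (\<lambda>x. (\<phi> x *\<^sub>R f x) \<bullet> b)" if "locally_integrable \<Omega> f" for f
      by (intro integrable_inner_left locally_integrable_times_compact_support[OF open_\<Omega> that
            test_functionD(2)[OF \<phi>] test_functionD(6)[OF \<phi>] test_functionD(7)[OF \<phi>] test_function_outside(1)[OF \<phi>]])
    have "(LINT x|L. ((g x - h x) \<bullet> b) * \<phi> x) = (LINT x|L. (\<phi> x *\<^sub>R g x) \<bullet> b - (\<phi> x *\<^sub>R h x) \<bullet> b)"
      by (simp add: inner_diff_left algebra_simps)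
    also have "\<dots> = (LINT x|L. (\<phi> x *\<^sub>R g x) \<bullet> b) - (LINT x|L. (\<phi> x *\<^sub>R h x) \<bullet> b)"
      by (rule Bochner_Integration.integral_diff[OF int[OF g] int[OF h]])
    also have "\<dots> = (LINT x|L. (g x \<bullet> b) * \<phi> x) - (LINT x|L. (h x \<bullet> b) * \<phi> x)"
      by (simp add: mult.commute)
    also have "\<dots> = 0"
    proof -
      have "(LINT x|L. u x * frechet_derivative \<phi> (at x) b) = - (LINT x|L. (g x \<bullet> b) * \<phi> x)"
        "(LINT x|L. u x * frechet_derivative \<phi> (at x) b) = - (LINT x|L. (h x \<bullet> b) * \<phi> x)"
        using assms \<phi> b unfolding weak_gradient_def by blast+
      then show ?thesis by linarith
    qed
    finally show "(LINT x|L. ((g x - h x) \<bullet> b) * \<phi> x) = 0" .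
  qed
  then have "AE x in L. \<forall>b\<in>Basis. (g x - h x) \<bullet> b = 0"
    by (simp add: AE_finite_all)
  then show ?thesis by eventually_elim (simp add: euclidean_eq_iff[where 'a = 'a] inner_diff_left)
qed

lemma H1D:
  assumes "u \<in> H1 \<Omega>"
  shows "square_integrable \<Omega> u" "weak_gradient \<Omega> u (wgrad \<Omega> u)" "square_integrable \<Omega> (wgrad \<Omega> u)"
    "square_integrable \<Omega> (jet \<Omega> u)"
proof -
  from assms obtain g where g: "square_integrable \<Omega> u" "weak_gradient \<Omega> u g" "square_integrable \<Omega> g"
    by (auto simp: H1_def)
  show u: "square_integrable \<Omega> u" by fact
  show w: "weak_gradient \<Omega> u (wgrad \<Omega> u)" unfolding wgrad_def by (rule someI[of _ g]) fact
  show wg: "square_integrable \<Omega> (wgrad \<Omega> u)"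
    by (rule square_integrable_cong_AE[OF open_\<Omega> g(3) weak_gradient_unique[OF g(2) w]])
  show "square_integrable \<Omega> (jet \<Omega> u)"
    unfolding jet_def[abs_def] by (rule square_integrable_Pair[OF u wg])
qed

lemma H1I:
  assumes "square_integrable \<Omega> u" "square_integrable \<Omega> g" "weak_gradient \<Omega> u g"
  shows "u \<in> H1 \<Omega>" "AE x in L. jet \<Omega> u x = (u x, g x)"
proof -
  show u: "u \<in> H1 \<Omega>" using assms by (auto simp: H1_def)
  show "AE x in L. jet \<Omega> u x = (u x, g x)"
    using weak_gradient_unique[OF H1D(2)[OF u] assms(3)] by eventually_elim (simp add: jet_def)
qed

lemma test_pair_square_integrable:
  "\<phi> \<in> test_functions \<Omega> \<Longrightarrow> b \<in> Basis \<Longrightarrow>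
    square_integrable \<Omega> (\<lambda>x. (frechet_derivative \<phi> (at x) b, \<phi> x *\<^sub>R b))"
  by (intro square_integrable_Pair square_integrable_partial square_integrable_scale_vec square_integrable_test)

lemma jet_orthogonal:
  assumes "u \<in> H1 \<Omega>" "\<phi> \<in> test_functions \<Omega>" "b \<in> Basis"
  shows "L2_ip \<Omega> (jet \<Omega> u) (\<lambda>x. (frechet_derivative \<phi> (at x) b, \<phi> x *\<^sub>R b)) = 0"
  using weak_gradient_iff[OF H1D(1,3)[OF assms(1)]] H1D(2)[OF assms(1)] assms(2,3)
  by (simp add: jet_def[abs_def])

lemma H1_lincomb:
  assumes "u \<in> H1 \<Omega>" "v \<in> H1 \<Omega>"
  shows "(\<lambda>x. a * u x + b * v x) \<in> H1 \<Omega>"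
    "AE x in L. jet \<Omega> (\<lambda>x. a * u x + b * v x) x = a *\<^sub>R jet \<Omega> u x + b *\<^sub>R jet \<Omega> v x"
proof -
  let ?w = "\<lambda>x. a * u x + b * v x" and ?g = "\<lambda>x. a *\<^sub>R wgrad \<Omega> u x + b *\<^sub>R wgrad \<Omega> v x"
  have 1: "square_integrable \<Omega> ?w" "square_integrable \<Omega> ?g"
    using square_integrable_lincomb[OF H1D(1)[OF assms(1)] H1D(1)[OF assms(2)], of a b]
      square_integrable_lincomb[OF H1D(3)[OF assms(1)] H1D(3)[OF assms(2)], of a b] by auto
  have eq: "(\<lambda>x. (?w x, ?g x)) = (\<lambda>x. a *\<^sub>R jet \<Omega> u x + b *\<^sub>R jet \<Omega> v x)"
    by (simp add: jet_def)
  have 2: "weak_gradient \<Omega> ?w ?g"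
    unfolding weak_gradient_iff[OF 1] eq
    using L2_ip_lincomb_left[OF H1D(4)[OF assms(1)] H1D(4)[OF assms(2)] test_pair_square_integrable]
    by (simp add: jet_orthogonal assms)
  show "?w \<in> H1 \<Omega>" "AE x in L. jet \<Omega> ?w x = a *\<^sub>R jet \<Omega> u x + b *\<^sub>R jet \<Omega> v x"
    using H1I[OF 1 2] eq by (auto simp: fun_eq_iff)
qed

lemma H1_cong_AE:
  assumes "u \<in> H1 \<Omega>" "AE x in L. u x = v x"
  shows "v \<in> H1 \<Omega>" "AE x in L. jet \<Omega> u x = jet \<Omega> v x"
proof -
  have v: "square_integrable \<Omega> v" by (rule square_integrable_cong_AE[OF open_\<Omega> H1D(1)[OF assms(1)] assms(2)])
  have "L2_ip \<Omega> (\<lambda>x. (v x, wgrad \<Omega> u x)) h = L2_ip \<Omega> (jet \<Omega> u) h" if "square_integrable \<Omega> h" for h :: "'a \<Rightarrow> real \<times> 'a"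
    using that square_integrable_Pair[OF v H1D(3)[OF assms(1)]] H1D(4)[OF assms(1)]
    by (intro L2_ip_cong_AE) (use assms(2) in \<open>auto simp: square_integrable_def jet_def elim: eventually_mono\<close>)
  then have w: "weak_gradient \<Omega> v (wgrad \<Omega> u)"
    unfolding weak_gradient_iff[OF v H1D(3)[OF assms(1)]]
    by (simp add: test_pair_square_integrable jet_orthogonal assms)
  show "v \<in> H1 \<Omega>" by (rule H1I[OF v H1D(3)[OF assms(1)] w])
  from H1I(2)[OF v H1D(3)[OF assms(1)] w] assms(2) show "AE x in L. jet \<Omega> u x = jet \<Omega> v x"
    by eventually_elim (simp add: jet_def)
qed

text \<open>The induction runs over subsets of the basis, because the gradient is a sum over all of it.\<close>

lemma square_integrable_gradient:
  assumes "\<phi> \<in> test_functions \<Omega>" shows "square_integrable \<Omega> (gradient \<phi>)"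
proof -
  have "square_integrable \<Omega> (\<lambda>x. \<Sum>b\<in>B. frechet_derivative \<phi> (at x) b *\<^sub>R b)"
    if "finite B" "B \<subseteq> Basis" for B :: "'a set"
    using that
  proof (induction B rule: finite_induct)
    case empty
    show ?case using square_integrable_const[OF open_\<Omega> bounded_\<Omega>] by simp
  next
    case (insert b B)
    then show ?case
      using square_integrable_lincomb[OF square_integrable_scale_vec[OF square_integrable_partial[OF assms], of b b] insert.IH, of 1 1]
      by simp
  qed
  then show ?thesis unfolding gradient_def[abs_def] by simp
qed

text \<open>By integration by parts the classical gradient of a test function is its weak gradient.\<close>

lemma test_function_H1:
  assumes \<phi>: "\<phi> \<in> test_functions \<Omega>"
  shows "\<phi> \<in> H1 \<Omega>" "AE x in L. jet \<Omega> \<phi> x = (\<phi> x, gradient \<phi> x)"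
proof -
  have "weak_gradient \<Omega> \<phi> (gradient \<phi>)"
    unfolding weak_gradient_iff[OF square_integrable_test[OF \<phi>] square_integrable_gradient[OF \<phi>]]
  proof safe
    fix \<psi> and b :: 'a assume \<psi>: "\<psi> \<in> test_functions \<Omega>" and b: "b \<in> Basis"
    have "L2_ip \<Omega> (\<lambda>x. (\<phi> x, gradient \<phi> x)) (\<lambda>x. (frechet_derivative \<psi> (at x) b, \<psi> x *\<^sub>R b)) =
      (LINT x|L. frechet_derivative (\<lambda>x. \<phi> x * \<psi> x) (at x) b)"
      unfolding L2_ip_def
      by (simp add: frechet_derivative_mult test_functionD(3)[OF \<phi>] test_functionD(3)[OF \<psi>]
          gradient_inner_Basis b mult.commute)
    also have "\<dots> = 0"
      by (rule integral_partial_test_function[OF test_functions_mult[OF \<phi> \<psi>] open_\<Omega> b])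
    finally show "L2_ip \<Omega> (\<lambda>x. (\<phi> x, gradient \<phi> x)) (\<lambda>x. (frechet_derivative \<psi> (at x) b, \<psi> x *\<^sub>R b)) = 0" .
  qed
  from H1I[OF square_integrable_test[OF \<phi>] square_integrable_gradient[OF \<phi>] this]
  show "\<phi> \<in> H1 \<Omega>" "AE x in L. jet \<Omega> \<phi> x = (\<phi> x, gradient \<phi> x)" .
qed

lemma jet_measurable: "u \<in> H1 \<Omega> \<Longrightarrow> jet \<Omega> u \<in> borel_measurable L"
  using H1D(4) by (auto simp: square_integrable_def)

abbreviation ip where "ip \<equiv> H1_inner \<Omega>"

lemma ip_commute: "ip u v = ip v u"
  by (simp add: H1_inner_eq L2_ip_commute)

lemma ip_self_nonneg: "0 \<le> ip u u"
  by (simp add: H1_inner_eq L2_ip_self_nonneg)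

lemma ip_cong_AE:
  assumes "u \<in> H1 \<Omega>" "AE x in L. u x = u' x" "v \<in> H1 \<Omega>" "AE x in L. v x = v' x"
  shows "ip u v = ip u' v'"
  unfolding H1_inner_eq
  by (rule L2_ip_cong_AE[OF jet_measurable[OF assms(1)] jet_measurable[OF H1_cong_AE(1)[OF assms(1,2)]]
      jet_measurable[OF assms(3)] jet_measurable[OF H1_cong_AE(1)[OF assms(3,4)]]
      H1_cong_AE(2)[OF assms(1,2)] H1_cong_AE(2)[OF assms(3,4)]])

lemma ip_lincomb_left:
  assumes "u \<in> H1 \<Omega>" "v \<in> H1 \<Omega>" "w \<in> H1 \<Omega>"
  shows "ip (\<lambda>x. a * u x + b * v x) w = a * ip u w + b * ip v w"
proof -
  have "ip (\<lambda>x. a * u x + b * v x) w = L2_ip \<Omega> (\<lambda>x. a *\<^sub>R jet \<Omega> u x + b *\<^sub>R jet \<Omega> v x) (jet \<Omega> w)"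
    unfolding H1_inner_eq
    by (rule L2_ip_cong_AE[OF jet_measurable[OF H1_lincomb(1)[OF assms(1,2)]] _
        jet_measurable[OF assms(3)] jet_measurable[OF assms(3)] H1_lincomb(2)[OF assms(1,2)]])
       (use jet_measurable[OF assms(1)] jet_measurable[OF assms(2)] in auto)
  then show ?thesis
    using L2_ip_lincomb_left[OF H1D(4)[OF assms(1)] H1D(4)[OF assms(2)] H1D(4)[OF assms(3)]]
    by (simp add: H1_inner_eq)
qed

lemma ip_diff_left:
  assumes "u \<in> H1 \<Omega>" "v \<in> H1 \<Omega>" "w \<in> H1 \<Omega>"
  shows "ip (\<lambda>x. u x - v x) w = ip u w - ip v w"
  using ip_lincomb_left[OF assms, of 1 "-1"] by simp

lemma H1_diff: "u \<in> H1 \<Omega> \<Longrightarrow> v \<in> H1 \<Omega> \<Longrightarrow> (\<lambda>x. u x - v x) \<in> H1 \<Omega>"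
  using H1_lincomb(1)[of u v 1 "-1"] by simp

lemma ip_square_lincomb:
  assumes "u \<in> H1 \<Omega>" "v \<in> H1 \<Omega>"
  shows "ip (\<lambda>x. a * u x + b * v x) (\<lambda>x. a * u x + b * v x) =
    a\<^sup>2 * ip u u + 2 * a * b * ip u v + b\<^sup>2 * ip v v"
  using assms H1_lincomb(1)[OF assms, of a b]
  by (simp add: ip_lincomb_left ip_commute[of u "\<lambda>x. a * u x + b * v x"]
      ip_commute[of v "\<lambda>x. a * u x + b * v x"] ip_commute[of v u]
      algebra_simps power2_eq_square)

text \<open>Expanding the nonnegative square of \<open>a u - b v\<close> bounds the mixed term.\<close>

lemma ip_square_lincomb_le:
  assumes "u \<in> H1 \<Omega>" "v \<in> H1 \<Omega>"
  shows "ip (\<lambda>x. a * u x + b * v x) (\<lambda>x. a * u x + b * v x) \<le> 2 * (a\<^sup>2 * ip u u) + 2 * (b\<^sup>2 * ip v v)"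
  using ip_self_nonneg[of "\<lambda>x. a * u x + (- b) * v x"]
  unfolding ip_square_lincomb[OF assms] by (simp add: algebra_simps)

lemma ip_Cauchy_Schwarz:
  assumes "u \<in> H1 \<Omega>" "v \<in> H1 \<Omega>"
  shows "(ip u v)\<^sup>2 \<le> ip u u * ip v v"
  unfolding H1_inner_eq by (intro L2_Cauchy_Schwarz H1D assms)

lemma H1_norm_square: "(H1_norm \<Omega> u)\<^sup>2 = ip u u"
  by (simp add: H1_norm_def ip_self_nonneg)

end

section \<open>The Hilbert space of functions with zero boundary values\<close>

context bounded_open begin

text \<open>Sequences of test functions that witness membership in \<open>H10\<close>; squared norms replace norms, since
  they are what the inner product computes.\<close>

definition approximates :: "(nat \<Rightarrow> 'a \<Rightarrow> real) \<Rightarrow> ('a \<Rightarrow> real) \<Rightarrow> bool" where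
  "approximates \<phi> u \<longleftrightarrow> (\<forall>n. \<phi> n \<in> test_functions \<Omega>) \<and> u \<in> H1 \<Omega> \<and>
     (\<lambda>n. ip (\<lambda>x. \<phi> n x - u x) (\<lambda>x. \<phi> n x - u x)) \<longlonglongrightarrow> 0"

lemma tendsto_H1_norm_iff:
  "(\<lambda>n. H1_norm \<Omega> (f n)) \<longlonglongrightarrow> 0 \<longleftrightarrow> (\<lambda>n. ip (f n) (f n)) \<longlonglongrightarrow> 0"
proof
  assume "(\<lambda>n. H1_norm \<Omega> (f n)) \<longlonglongrightarrow> 0"
  from tendsto_power[OF this, of 2] show "(\<lambda>n. ip (f n) (f n)) \<longlonglongrightarrow> 0"
    by (simp add: H1_norm_square)
next
  assume "(\<lambda>n. ip (f n) (f n)) \<longlonglongrightarrow> 0"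
  from tendsto_real_sqrt[OF this] show "(\<lambda>n. H1_norm \<Omega> (f n)) \<longlonglongrightarrow> 0"
    by (simp add: H1_norm_def)
qed

lemma H10_iff: "u \<in> H10 \<Omega> \<longleftrightarrow> (\<exists>\<phi>. approximates \<phi> u)"
  by (auto simp: H10_def approximates_def tendsto_H1_norm_iff)

lemma H10_H1: "u \<in> H10 \<Omega> \<Longrightarrow> u \<in> H1 \<Omega>"
  by (simp add: H10_def)

lemma approximatesD:
  assumes "approximates \<phi> u"
  shows "\<phi> n \<in> test_functions \<Omega>" "\<phi> n \<in> H1 \<Omega>" "u \<in> H1 \<Omega>" "u \<in> H10 \<Omega>"
    "(\<lambda>n. ip (\<lambda>x. \<phi> n x - u x) (\<lambda>x. \<phi> n x - u x)) \<longlonglongrightarrow> 0"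
  using assms test_function_H1(1) by (auto simp: approximates_def H10_iff)

lemma test_function_H10: "\<phi> \<in> test_functions \<Omega> \<Longrightarrow> \<phi> \<in> H10 \<Omega>"
  unfolding H10_iff approximates_def
proof (intro exI[of _ "\<lambda>n. \<phi>"] conjI)
  assume \<phi>: "\<phi> \<in> test_functions \<Omega>"
  have "ip (\<lambda>x. 0) (\<lambda>x. 0) = 0"
    using ip_lincomb_left[OF test_function_H1(1)[OF zero_test_function] test_function_H1(1)[OF zero_test_function]
        test_function_H1(1)[OF zero_test_function], of 0 0] by simp
  then show "(\<lambda>n. ip (\<lambda>x. \<phi> x - \<phi> x) (\<lambda>x. \<phi> x - \<phi> x)) \<longlonglongrightarrow> 0" by simp
qed (auto intro: test_function_H1)

lemma H10_lincomb:
  assumes "u \<in> H10 \<Omega>" "v \<in> H10 \<Omega>"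
  shows "(\<lambda>x. a * u x + b * v x) \<in> H10 \<Omega>"
proof -
  from assms obtain \<phi> \<psi> where \<phi>: "approximates \<phi> u" and \<psi>: "approximates \<psi> v" by (auto simp: H10_iff)
  let ?d = "\<lambda>n x. (a * \<phi> n x + b * \<psi> n x) - (a * u x + b * v x)"
  have "(\<lambda>n. ip (?d n) (?d n)) \<longlonglongrightarrow> 0"
  proof (rule tendsto_sandwich[OF _ _ tendsto_const])
    show "\<forall>\<^sub>F n in sequentially. 0 \<le> ip (?d n) (?d n)" by (simp add: ip_self_nonneg)
    show "\<forall>\<^sub>F n in sequentially. ip (?d n) (?d n) \<le>
       2 * (a\<^sup>2 * ip (\<lambda>x. \<phi> n x - u x) (\<lambda>x. \<phi> n x - u x)) + 2 * (b\<^sup>2 * ip (\<lambda>x. \<psi> n x - v x) (\<lambda>x. \<psi> n x - v x))"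
    proof (rule always_eventually, rule allI)
      fix n
      have "?d n = (\<lambda>x. a * (\<phi> n x - u x) + b * (\<psi> n x - v x))" by (simp add: algebra_simps)
      then show "ip (?d n) (?d n) \<le> 2 * (a\<^sup>2 * ip (\<lambda>x. \<phi> n x - u x) (\<lambda>x. \<phi> n x - u x))
          + 2 * (b\<^sup>2 * ip (\<lambda>x. \<psi> n x - v x) (\<lambda>x. \<psi> n x - v x))"
        using ip_square_lincomb_le[OF H1_diff[OF approximatesD(2,3)[OF \<phi>]] H1_diff[OF approximatesD(2,3)[OF \<psi>]]]
        by simp
    qed
    show "(\<lambda>n. 2 * (a\<^sup>2 * ip (\<lambda>x. \<phi> n x - u x) (\<lambda>x. \<phi> n x - u x)) +
        2 * (b\<^sup>2 * ip (\<lambda>x. \<psi> n x - v x) (\<lambda>x. \<psi> n x - v x))) \<longlonglongrightarrow> 0"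
      using tendsto_add[OF tendsto_mult_right_zero[OF tendsto_mult_right_zero[OF approximatesD(5)[OF \<phi>]]]
          tendsto_mult_right_zero[OF tendsto_mult_right_zero[OF approximatesD(5)[OF \<psi>]]]] by simp
  qed
  then have "approximates (\<lambda>n x. a * \<phi> n x + b * \<psi> n x) (\<lambda>x. a * u x + b * v x)"
    using approximatesD[OF \<phi>] approximatesD[OF \<psi>]
    by (auto simp: approximates_def intro!: test_functions_lincomb H1_lincomb(1))
  then show ?thesis by (auto simp: H10_iff)
qed

lemma H10_scale: "u \<in> H10 \<Omega> \<Longrightarrow> (\<lambda>x. a * u x) \<in> H10 \<Omega>"
  using H10_lincomb[of u u a 0] by simp

lemma H10_cong_AE:
  assumes "u \<in> H10 \<Omega>" "AE x in L. u x = v x"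
  shows "v \<in> H10 \<Omega>"
proof -
  from assms obtain \<phi> where \<phi>: "approximates \<phi> u" by (auto simp: H10_iff)
  have "ip (\<lambda>x. \<phi> n x - u x) (\<lambda>x. \<phi> n x - u x) = ip (\<lambda>x. \<phi> n x - v x) (\<lambda>x. \<phi> n x - v x)" for n
  proof -
    have "AE x in L. \<phi> n x - u x = \<phi> n x - v x" using assms(2) by eventually_elim simp
    note * = H1_diff[OF approximatesD(2,3)[OF \<phi>]] this
    show ?thesis by (rule ip_cong_AE[OF * *])
  qed
  then have "approximates \<phi> v"
    using approximatesD[OF \<phi>] H1_cong_AE(1)[OF _ assms(2)] by (simp add: approximates_def)
  then show ?thesis by (auto simp: H10_iff)
qed

lemma ip_tendsto:
  assumes "\<And>n. f n \<in> H1 \<Omega>" "u \<in> H1 \<Omega>" "w \<in> H1 \<Omega>"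
    and lim: "(\<lambda>n. ip (\<lambda>x. f n x - u x) (\<lambda>x. f n x - u x)) \<longlonglongrightarrow> 0"
  shows "(\<lambda>n. ip (f n) w) \<longlonglongrightarrow> ip u w"
proof -
  have "(\<lambda>n. ip (\<lambda>x. f n x - u x) w) \<longlonglongrightarrow> 0"
    by (intro tendsto_zero_if_square_le[OF ip_Cauchy_Schwarz lim] H1_diff assms)
  then have "(\<lambda>n. ip (f n) w - ip u w) \<longlonglongrightarrow> 0"
    using assms by (simp add: ip_diff_left)
  then show ?thesis by (rule LIM_zero_cancel)
qed

lemma ip_self_tendsto:
  assumes "approximates \<phi> u"
  shows "(\<lambda>n. ip (\<phi> n) (\<phi> n)) \<longlonglongrightarrow> ip u u"
proof -
  note a = approximatesD[OF assms]
  have "ip (\<phi> n) (\<phi> n) = 2 * ip (\<phi> n) u - ip u u + ip (\<lambda>x. \<phi> n x - u x) (\<lambda>x. \<phi> n x - u x)" for n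
    using ip_square_lincomb[where a = 1 and b = "-1", OF a(2) a(3)] by simp
  moreover have "(\<lambda>n. 2 * ip (\<phi> n) u - ip u u + ip (\<lambda>x. \<phi> n x - u x) (\<lambda>x. \<phi> n x - u x)) \<longlonglongrightarrow> 2 * ip u u - ip u u + 0"
    by (intro tendsto_intros a ip_tendsto[OF a(2) a(3) a(3)])
  ultimately show ?thesis by simp
qed

text \<open>The completeness of \<open>H10\<close>, in the form in which it is used.  The jets converge in \<open>L2\<close>; the limit
  is again a jet because the orthogonality relations for weak gradients survive the limit.\<close>

lemma test_functions_Cauchy_limit:
  assumes \<phi>: "\<And>n. \<phi> n \<in> test_functions \<Omega>"
    and Cauchy: "\<And>e. e > 0 \<Longrightarrow> \<exists>N. \<forall>i\<ge>N. \<forall>j\<ge>N. ip (\<lambda>x. \<phi> i x - \<phi> j x) (\<lambda>x. \<phi> i x - \<phi> j x) < e"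
  obtains v where "approximates \<phi> v"
proof -
  have H1: "\<phi> n \<in> H1 \<Omega>" for n using test_function_H1(1)[OF \<phi>] .
  have diff: "AE x in L. jet \<Omega> (\<lambda>x. u x - v x) x = jet \<Omega> u x - jet \<Omega> v x" if "u \<in> H1 \<Omega>" "v \<in> H1 \<Omega>" for u v
    using H1_lincomb(2)[OF that, of 1 "-1"] by simp
  have diff_ip: "ip (\<lambda>x. u x - v x) (\<lambda>x. u x - v x) =
      L2_ip \<Omega> (\<lambda>x. jet \<Omega> u x - jet \<Omega> v x) (\<lambda>x. jet \<Omega> u x - jet \<Omega> v x)" if uv: "u \<in> H1 \<Omega>" "v \<in> H1 \<Omega>" for u v
  proof -
    have m: "(\<lambda>x. jet \<Omega> u x - jet \<Omega> v x) \<in> borel_measurable L"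
      using jet_measurable[OF uv(1)] jet_measurable[OF uv(2)] by simp
    show ?thesis unfolding H1_inner_eq
      by (rule L2_ip_cong_AE[OF jet_measurable[OF H1_diff[OF uv]] m jet_measurable[OF H1_diff[OF uv]] m diff[OF uv] diff[OF uv]])
  qed
  obtain G where G: "square_integrable \<Omega> G"
    and lim: "(\<lambda>n. L2_ip \<Omega> (\<lambda>x. jet \<Omega> (\<phi> n) x - G x) (\<lambda>x. jet \<Omega> (\<phi> n) x - G x)) \<longlonglongrightarrow> 0"
  proof (rule square_integrable_complete[OF open_\<Omega> bounded_\<Omega> H1D(4)[OF H1]])
    show "\<exists>N. \<forall>i\<ge>N. \<forall>j\<ge>N. L2_ip \<Omega> (\<lambda>x. jet \<Omega> (\<phi> i) x - jet \<Omega> (\<phi> j) x) (\<lambda>x. jet \<Omega> (\<phi> i) x - jet \<Omega> (\<phi> j) x) < e"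
      if "e > 0" for e using Cauchy[OF that] unfolding diff_ip[OF H1 H1] .
  qed
  define v where "v = (\<lambda>x. fst (G x))"
  define g where "g = (\<lambda>x. snd (G x))"
  have v: "square_integrable \<Omega> v" and g: "square_integrable \<Omega> g"
    using square_integrable_fst[OF G] square_integrable_snd[OF G] by (auto simp: v_def g_def)
  have vg: "(\<lambda>x. (v x, g x)) = G" by (simp add: v_def g_def)
  have w: "weak_gradient \<Omega> v g"
    unfolding weak_gradient_iff[OF v g] vg
  proof safe
    fix \<psi> and b :: 'a assume \<psi>: "\<psi> \<in> test_functions \<Omega>" and b: "b \<in> Basis"
    have "(\<lambda>n. L2_ip \<Omega> (jet \<Omega> (\<phi> n)) (\<lambda>x. (frechet_derivative \<psi> (at x) b, \<psi> x *\<^sub>R b))) \<longlonglongrightarrow>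
        L2_ip \<Omega> G (\<lambda>x. (frechet_derivative \<psi> (at x) b, \<psi> x *\<^sub>R b))"
      by (rule L2_ip_tendsto[OF H1D(4)[OF H1] G test_pair_square_integrable[OF \<psi> b] lim])
    then show "L2_ip \<Omega> G (\<lambda>x. (frechet_derivative \<psi> (at x) b, \<psi> x *\<^sub>R b)) = 0"
      by (simp add: jet_orthogonal[OF H1 \<psi> b] LIMSEQ_const_iff)
  qed
  have vH: "v \<in> H1 \<Omega>" and vj: "AE x in L. jet \<Omega> v x = G x"
    using H1I[OF v g w] vg by (auto simp: fun_eq_iff)
  have "ip (\<lambda>x. \<phi> n x - v x) (\<lambda>x. \<phi> n x - v x) = L2_ip \<Omega> (\<lambda>x. jet \<Omega> (\<phi> n) x - G x) (\<lambda>x. jet \<Omega> (\<phi> n) x - G x)" for n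
  proof -
    have m: "(\<lambda>x. jet \<Omega> (\<phi> n) x - jet \<Omega> v x) \<in> borel_measurable L" "(\<lambda>x. jet \<Omega> (\<phi> n) x - G x) \<in> borel_measurable L"
      using jet_measurable[OF H1[of n]] jet_measurable[OF vH] G by (auto simp: square_integrable_def)
    have "AE x in L. jet \<Omega> (\<phi> n) x - jet \<Omega> v x = jet \<Omega> (\<phi> n) x - G x" using vj by eventually_elim simp
    then show ?thesis unfolding diff_ip[OF H1 vH]
      by (intro L2_ip_cong_AE[OF m m])
  qed
  then have "approximates \<phi> v" using lim \<phi> vH by (simp add: approximates_def)
  then show ?thesis by (rule that)
qed

text \<open>A minimizing sequence of the functional \<open>\<parallel>w\<parallel>\<^sup>2 - 2 l w\<close> over the test functions converges, and the
  first variation at its limit \<open>v\<close> is the equation \<open>\<langle>v, w\<rangle> = l w\<close> for test functions \<open>w\<close>, which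
  extends to all of \<open>H10\<close> by density.\<close>

lemma Riesz_representation:
  assumes lin: "\<And>u v a b. u \<in> H10 \<Omega> \<Longrightarrow> v \<in> H10 \<Omega> \<Longrightarrow> l (\<lambda>x. a * u x + b * v x) = a * l u + b * l v"
    and bd: "\<And>u. u \<in> H10 \<Omega> \<Longrightarrow> \<bar>l u\<bar> \<le> C * H1_norm \<Omega> u"
  obtains v where "v \<in> H10 \<Omega>" "\<And>w. w \<in> H10 \<Omega> \<Longrightarrow> ip v w = l w"
proof -
  let ?T = "test_functions \<Omega>"
  define J where "J w = ip w w - 2 * l w" for w
  define m where "m = (INF w\<in>?T. J w)"
  have bdd: "- C\<^sup>2 \<le> J w" if "w \<in> ?T" for w
  proof -
    have "l w \<le> C * H1_norm \<Omega> w" using bd[OF test_function_H10[OF that]] by linarith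
    moreover have "0 \<le> (H1_norm \<Omega> w - C)\<^sup>2" by simp
    ultimately show ?thesis unfolding J_def H1_norm_square[symmetric]
      by (simp add: power2_diff algebra_simps)
  qed
  have "bdd_below (J ` ?T)" using bdd by (auto simp: bdd_below_def)
  then have m_le: "m \<le> J w" if "w \<in> ?T" for w
    unfolding m_def using that by (rule cINF_lower)
  have "\<exists>w\<in>?T. J w < m + 1 / real (Suc n)" for n
  proof -
    have "Inf (J ` ?T) < m + 1 / real (Suc n)" by (simp add: m_def)
    then show ?thesis using cInf_lessD[of "J ` ?T"] zero_test_function by blast
  qed
  then obtain \<phi> where \<phi>: "\<And>n. \<phi> n \<in> ?T" and J\<phi>: "\<And>n. J (\<phi> n) < m + 1 / real (Suc n)" by metis
  have H1: "\<phi> n \<in> H1 \<Omega>" and H10: "\<phi> n \<in> H10 \<Omega>" for n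
    using test_function_H1(1)[OF \<phi>] test_function_H10[OF \<phi>] by auto
  \<comment> \<open>The parallelogram law makes every minimizing sequence a Cauchy sequence.\<close>
  have par: "ip (\<lambda>x. \<phi> i x - \<phi> j x) (\<lambda>x. \<phi> i x - \<phi> j x) < 2 / real (Suc i) + 2 / real (Suc j)" for i j
  proof -
    have "m \<le> J (\<lambda>x. (1/2) * \<phi> i x + (1/2) * \<phi> j x)"
      by (intro m_le test_functions_lincomb \<phi>)
    also have "\<dots> = (1/4) * ip (\<phi> i) (\<phi> i) + (1/2) * ip (\<phi> i) (\<phi> j) + (1/4) * ip (\<phi> j) (\<phi> j) - l (\<phi> i) - l (\<phi> j)"
      unfolding J_def ip_square_lincomb[OF H1 H1] lin[OF H10 H10] by (simp add: power2_eq_square)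
    finally have "4 * m \<le> ip (\<phi> i) (\<phi> i) + 2 * ip (\<phi> i) (\<phi> j) + ip (\<phi> j) (\<phi> j) - 4 * l (\<phi> i) - 4 * l (\<phi> j)"
      by simp
    moreover have "ip (\<lambda>x. \<phi> i x - \<phi> j x) (\<lambda>x. \<phi> i x - \<phi> j x) =
        ip (\<phi> i) (\<phi> i) - 2 * ip (\<phi> i) (\<phi> j) + ip (\<phi> j) (\<phi> j)"
      using ip_square_lincomb[where a = 1 and b = "-1", OF H1 H1] by simp
    moreover have "2 / real (Suc i) = 2 * (1 / real (Suc i))" "2 / real (Suc j) = 2 * (1 / real (Suc j))"
      by simp_all
    ultimately show ?thesis using J\<phi>[of i] J\<phi>[of j] unfolding J_def by linarith
  qed
  obtain v where v: "approximates \<phi> v"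
  proof (rule test_functions_Cauchy_limit[OF \<phi>])
    fix e :: real assume "e > 0"
    then obtain N where N: "inverse (real (Suc N)) < e / 4" using reals_Archimedean[of "e / 4"] by auto
    have "ip (\<lambda>x. \<phi> i x - \<phi> j x) (\<lambda>x. \<phi> i x - \<phi> j x) < e" if "i \<ge> N" "j \<ge> N" for i j
    proof -
      have "1 / real (Suc i) \<le> 1 / real (Suc N)" "1 / real (Suc j) \<le> 1 / real (Suc N)"
        using that by (auto simp: frac_le)
      then show ?thesis using par[of i j] N by (simp add: inverse_eq_divide)
    qed
    then show "\<exists>N. \<forall>i\<ge>N. \<forall>j\<ge>N. ip (\<lambda>x. \<phi> i x - \<phi> j x) (\<lambda>x. \<phi> i x - \<phi> j x) < e" by blast
  qed
  note vD = approximatesD[OF v]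
  \<comment> \<open>The quadratic polynomial \<open>t \<mapsto> J (v + t \<psi>) - m\<close> is nonnegative and vanishes at zero.\<close>
  have test: "ip v \<psi> = l \<psi>" if \<psi>: "\<psi> \<in> ?T" for \<psi>
  proof -
    have "0 \<le> 0 + 2 * t * (ip v \<psi> - l \<psi>) + t\<^sup>2 * ip \<psi> \<psi>" for t
    proof (rule LIMSEQ_le)
      show "(\<lambda>n. - (1 / real (Suc n))) \<longlonglongrightarrow> 0"
        using tendsto_minus[OF LIMSEQ_Suc[OF lim_1_over_n]] by simp
      show "(\<lambda>n. 0 + 2 * t * (ip (\<phi> n) \<psi> - l \<psi>) + t\<^sup>2 * ip \<psi> \<psi>) \<longlonglongrightarrow> 0 + 2 * t * (ip v \<psi> - l \<psi>) + t\<^sup>2 * ip \<psi> \<psi>"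
        by (intro tendsto_intros ip_tendsto vD test_function_H1(1)[OF \<psi>])
      have "- (1 / real (Suc n)) \<le> 0 + 2 * t * (ip (\<phi> n) \<psi> - l \<psi>) + t\<^sup>2 * ip \<psi> \<psi>" for n
      proof -
        have "m \<le> J (\<lambda>x. 1 * \<phi> n x + t * \<psi> x)" by (intro m_le test_functions_lincomb \<phi> \<psi>)
        also have "\<dots> = J (\<phi> n) + 2 * t * (ip (\<phi> n) \<psi> - l \<psi>) + t\<^sup>2 * ip \<psi> \<psi>"
          unfolding J_def ip_square_lincomb[OF H1 test_function_H1(1)[OF \<psi>]] lin[OF H10 test_function_H10[OF \<psi>]]
          by (simp add: algebra_simps)
        finally show ?thesis using J\<phi>[of n] by simp
      qed
      then show "\<exists>N. \<forall>n\<ge>N. - (1 / real (Suc n)) \<le> 0 + 2 * t * (ip (\<phi> n) \<psi> - l \<psi>) + t\<^sup>2 * ip \<psi> \<psi>" by blast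
    qed
    from quadratic_nonneg_imp_discriminant[OF this ip_self_nonneg] show ?thesis by simp
  qed
  show ?thesis
  proof (rule that)
    show "v \<in> H10 \<Omega>" by (rule vD)
    fix w assume w: "w \<in> H10 \<Omega>"
    then obtain \<psi> where \<psi>: "approximates \<psi> w" by (auto simp: H10_iff)
    note \<psi>D = approximatesD[OF \<psi>]
    have "(\<lambda>n. ip (\<psi> n) v) \<longlonglongrightarrow> ip w v" by (rule ip_tendsto[OF \<psi>D(2) \<psi>D(3) vD(3) \<psi>D(5)])
    moreover have "(\<lambda>n. ip (\<psi> n) v) \<longlonglongrightarrow> l w"
    proof -
      have *: "(\<lambda>n. C * H1_norm \<Omega> (\<lambda>x. \<psi> n x - w x)) \<longlonglongrightarrow> 0"
        using \<psi>D(5) by (intro tendsto_mult_right_zero) (simp add: tendsto_H1_norm_iff)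
      have "l (\<psi> n) - l w = l (\<lambda>x. \<psi> n x - w x)" "(\<lambda>x. \<psi> n x - w x) \<in> H10 \<Omega>" for n
        using lin[where a = 1 and b = "-1", OF test_function_H10[OF \<psi>D(1)] w]
          H10_lincomb[where a = 1 and b = "-1", OF test_function_H10[OF \<psi>D(1)] w] by simp_all
      then have "\<bar>l (\<psi> n) - l w\<bar> \<le> C * H1_norm \<Omega> (\<lambda>x. \<psi> n x - w x)" for n
        using bd by metis
      then have "(\<lambda>n. l (\<psi> n) - l w) \<longlonglongrightarrow> 0"
        by (intro Lim_null_comparison[OF _ *]) simp
      then have "(\<lambda>n. l (\<psi> n)) \<longlonglongrightarrow> l w" by (rule LIM_zero_cancel)
      then show ?thesis using test[OF \<psi>D(1)] by (simp add: ip_commute)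
    qed
    ultimately show "ip v w = l w" using LIMSEQ_unique by (simp add: ip_commute)
  qed
qed

end

section \<open>The subcritical Sobolev inequality\<close>

text \<open>Hoelder's inequality with the two powers as data.  Dividing by the bounds \<open>A\<close> and \<open>B\<close> reduces it
  to the weighted inequality between geometric and arithmetic means; having bounds instead of
  the integrals themselves avoids the degenerate cases.\<close>

lemma nn_integral_Hoelder:
  fixes a b :: "'x \<Rightarrow> real"
  assumes [measurable]: "a \<in> borel_measurable N" "b \<in> borel_measurable N"
    and nn: "\<And>x. 0 \<le> a x" "\<And>x. 0 \<le> b x" and AB: "0 < A" "0 < B" and \<theta>: "0 < \<theta>" "\<theta> < 1"
    and A: "(\<integral>\<^sup>+x. ennreal (a x) \<partial>N) \<le> ennreal A" and B: "(\<integral>\<^sup>+x. ennreal (b x) \<partial>N) \<le> ennreal B"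
  shows "(\<integral>\<^sup>+x. ennreal (a x powr \<theta> * b x powr (1 - \<theta>)) \<partial>N) \<le> ennreal (A powr \<theta> * B powr (1 - \<theta>))"
proof -
  define K where "K = A powr \<theta> * B powr (1 - \<theta>)"
  have K: "K > 0" using AB by (simp add: K_def)
  have pt: "a x powr \<theta> * b x powr (1 - \<theta>) \<le> (K * \<theta> / A) * a x + (K * (1 - \<theta>) / B) * b x" for x
  proof (cases "a x = 0 \<or> b x = 0")
    case True
    then show ?thesis using nn[of x] K AB \<theta> by (auto intro!: add_nonneg_nonneg mult_nonneg_nonneg)
  next
    case False
    then have pos: "a x > 0" "b x > 0" using nn[of x] by auto
    have "(a x / A) powr \<theta> * (b x / B) powr (1 - \<theta>) \<le> \<theta> * (a x / A) + (1 - \<theta>) * (b x / B)"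
      by (rule Youngs_inequality_0) (use pos AB \<theta> in auto)
    then have "K * ((a x / A) powr \<theta> * (b x / B) powr (1 - \<theta>)) \<le> K * (\<theta> * (a x / A) + (1 - \<theta>) * (b x / B))"
      using K by (intro mult_left_mono) auto
    moreover have "K * ((a x / A) powr \<theta> * (b x / B) powr (1 - \<theta>)) = a x powr \<theta> * b x powr (1 - \<theta>)"
      using pos AB by (simp add: K_def powr_divide)
    ultimately show ?thesis by (simp add: algebra_simps)
  qed
  have "(\<integral>\<^sup>+x. ennreal (a x powr \<theta> * b x powr (1 - \<theta>)) \<partial>N) \<le>
      (\<integral>\<^sup>+x. ennreal (K * \<theta> / A) * ennreal (a x) + ennreal (K * (1 - \<theta>) / B) * ennreal (b x) \<partial>N)"
    using pt nn K AB \<theta> by (intro nn_integral_mono) (simp add: ennreal_mult[symmetric] ennreal_plus[symmetric] ennreal_leI del: ennreal_plus)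
  also have "\<dots> = ennreal (K * \<theta> / A) * (\<integral>\<^sup>+x. ennreal (a x) \<partial>N) + ennreal (K * (1 - \<theta>) / B) * (\<integral>\<^sup>+x. ennreal (b x) \<partial>N)"
    by (simp add: nn_integral_add nn_integral_cmult)
  also have "\<dots> \<le> ennreal (K * \<theta> / A) * ennreal A + ennreal (K * (1 - \<theta>) / B) * ennreal B"
    by (intro add_mono mult_left_mono A B) auto
  also have "\<dots> = ennreal K"
    using K AB \<theta> by (simp add: ennreal_mult[symmetric] ennreal_plus[symmetric] field_simps del: ennreal_plus)
  finally show ?thesis by (simp add: K_def)
qed

lemma nn_integral_translation:
  fixes f :: "'a::euclidean_space \<Rightarrow> ennreal"
  assumes [measurable]: "f \<in> borel_measurable borel"
  shows "(\<integral>\<^sup>+x. f (x + c) \<partial>lborel) = (\<integral>\<^sup>+x. f x \<partial>lborel)"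
proof -
  have "(\<integral>\<^sup>+x. f x \<partial>lborel) = (\<integral>\<^sup>+x. f x \<partial>distr lborel borel ((+) c))" by (simp add: lborel_distr_plus)
  also have "\<dots> = (\<integral>\<^sup>+x. f (c + x) \<partial>lborel)" by (subst nn_integral_distr) auto
  finally show ?thesis by (simp add: add.commute)
qed

lemma nn_integral_dilation_le:
  fixes f :: "'a::euclidean_space \<Rightarrow> ennreal"
  assumes [measurable]: "f \<in> borel_measurable borel" and "t > 0" and le: "(\<integral>\<^sup>+x. f x \<partial>lborel) \<le> 1"
  shows "(\<integral>\<^sup>+z. f (x + t *\<^sub>R z) \<partial>lborel) \<le> ennreal (t powr (- real DIM('a)))"
proof -
  have "(\<integral>\<^sup>+x. f x \<partial>lborel) = (\<integral>\<^sup>+x. f x \<partial>density (distr lborel borel (\<lambda>z. x + t *\<^sub>R z)) (\<lambda>_. ennreal (\<bar>t\<bar> ^ DIM('a))))"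
    using lborel_affine[of t x] \<open>t > 0\<close> by simp
  also have "\<dots> = ennreal (t ^ DIM('a)) * (\<integral>\<^sup>+z. f (x + t *\<^sub>R z) \<partial>lborel)"
    using \<open>t > 0\<close> by (simp add: nn_integral_density nn_integral_distr nn_integral_cmult)
  finally have *: "ennreal (t ^ DIM('a)) * (\<integral>\<^sup>+z. f (x + t *\<^sub>R z) \<partial>lborel) \<le> 1" using le by simp
  have "(\<integral>\<^sup>+z. f (x + t *\<^sub>R z) \<partial>lborel) =
      ennreal (t powr (- real DIM('a))) * (ennreal (t ^ DIM('a)) * (\<integral>\<^sup>+z. f (x + t *\<^sub>R z) \<partial>lborel))"
    using \<open>t > 0\<close>
    by (simp add: mult.assoc[symmetric] ennreal_mult[symmetric] powr_realpow[symmetric] powr_add[symmetric])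
  also have "\<dots> \<le> ennreal (t powr (- real DIM('a))) * 1" by (intro mult_left_mono *) auto
  finally show ?thesis by simp
qed

lemma nn_integral_powr:
  fixes e T :: real
  assumes "e > -1" "T > 0"
  shows "(\<integral>\<^sup>+t. ennreal (indicator {0<..T} t * t powr e) \<partial>lborel) = ennreal (T powr (e + 1) / (e + 1))"
proof -
  have "(\<integral>\<^sup>+t. ennreal (indicator {0<..T} t * t powr e) \<partial>lborel) = (\<integral>\<^sup>+t. ennreal (indicator {0..T} t * t powr e) \<partial>lborel)"
    by (intro nn_integral_cong) (auto simp: indicator_def)
  also have "\<dots> = ennreal (T powr (e + 1) / (e + 1))"
    by (rule nn_integral_has_integral_lebesgue[OF _ has_integral_powr_from_0]) (use assms in auto)
  finally show ?thesis .
qed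

lemma gradient_has_derivative:
  assumes "\<phi> \<in> test_functions \<Omega>"
  shows "(\<phi> has_derivative (\<lambda>h. gradient \<phi> x \<bullet> h)) (at x)"
proof -
  have d: "(\<phi> has_derivative frechet_derivative \<phi> (at x)) (at x)"
    using test_functionD(3)[OF assms] by (simp add: frechet_derivative_works)
  have "frechet_derivative \<phi> (at x) h = gradient \<phi> x \<bullet> h" for h
  proof -
    have "frechet_derivative \<phi> (at x) h = frechet_derivative \<phi> (at x) (\<Sum>b\<in>Basis. (h \<bullet> b) *\<^sub>R b)"
      by (simp add: euclidean_representation)
    also have "\<dots> = (\<Sum>b\<in>Basis. (h \<bullet> b) * frechet_derivative \<phi> (at x) b)"
      using has_derivative_linear[OF d] by (simp add: linear_sum linear_scale)
    also have "\<dots> = gradient \<phi> x \<bullet> h"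
      by (simp add: gradient_def inner_commute[of _ h] inner_sum_right mult.commute)
    finally show ?thesis .
  qed
  then have "frechet_derivative \<phi> (at x) = (\<lambda>h. gradient \<phi> x \<bullet> h)" by (rule ext)
  with d show ?thesis by (simp only:)
qed

lemma continuous_gradient:
  assumes "\<phi> \<in> test_functions \<Omega>"
  shows "continuous_on UNIV (gradient \<phi>)"
  unfolding gradient_def[abs_def]
  by (intro continuous_intros test_functionD(5)[OF assms])

text \<open>Every ray with a direction in the cube \<open>[1,2]\<^sup>d\<close> leaves \<open>\<Omega>\<close> before time \<open>T\<close>, since each of its
  coordinates grows at least at unit speed.  The fundamental theorem of calculus along the ray
  then bounds \<open>\<phi> x\<close>, and the constant \<open>2 d\<close> bounds the norm of the direction.\<close>

lemma test_function_le_ray_integral: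
  fixes \<phi> :: "'a::euclidean_space \<Rightarrow> real"
  assumes \<phi>: "\<phi> \<in> test_functions \<Omega>" and R: "\<And>x. x \<in> \<Omega> \<Longrightarrow> norm x < R" and z: "z \<in> cbox One (2 *\<^sub>R One)"
    and T: "T = 2 * R" "R > 0"
  shows "ennreal \<bar>\<phi> x\<bar> \<le> ennreal (2 * real DIM('a)) *
    (\<integral>\<^sup>+t. ennreal (indicator {0<..T} t * norm (gradient \<phi> (x + t *\<^sub>R z))) \<partial>lborel)"
proof (cases "x \<in> \<Omega>")
  case False
  then have "\<phi> x = 0" using test_function_outside(2)[OF \<phi>] by blast
  then show ?thesis by simp
next
  case True
  let ?K = "2 * real DIM('a)" and ?g = "\<lambda>t. norm (gradient \<phi> (x + t *\<^sub>R z))"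
  have zb: "1 \<le> z \<bullet> b" "z \<bullet> b \<le> 2" if "b \<in> Basis" for b
    using z that by (auto simp: mem_box)
  have "norm z \<le> (\<Sum>b\<in>Basis. \<bar>z \<bullet> b\<bar>)" by (rule norm_le_l1)
  also have "\<dots> \<le> (\<Sum>b\<in>(Basis::'a set). 2)" using zb by (intro sum_mono) fastforce
  finally have nz: "norm z \<le> ?K" by simp
  have "x + T *\<^sub>R z \<notin> \<Omega>"
  proof
    assume "x + T *\<^sub>R z \<in> \<Omega>"
    then have "norm (x + T *\<^sub>R z) < R" by (rule R)
    moreover obtain b :: 'a where b: "b \<in> Basis" using nonempty_Basis by blast
    ultimately have "(x + T *\<^sub>R z) \<bullet> b < R" using Basis_le_norm[OF b, of "x + T *\<^sub>R z"] by linarith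
    moreover have "x \<bullet> b > - R" using R[OF True] Basis_le_norm[OF b, of x] by linarith
    moreover have "T * (z \<bullet> b) \<ge> T * 1" using zb[OF b] T by (intro mult_left_mono) auto
    ultimately show False unfolding inner_add_left inner_scaleR_left using T by linarith
  qed
  then have end0: "\<phi> (x + T *\<^sub>R z) = 0" using test_function_outside(2)[OF \<phi>] by blast
  have d: "((\<lambda>t. \<phi> (x + t *\<^sub>R z)) has_vector_derivative (gradient \<phi> (x + t *\<^sub>R z) \<bullet> z)) (at t within {0..T})" for t
  proof -
    have "((\<lambda>t. \<phi> (x + t *\<^sub>R z)) has_derivative (\<lambda>h. gradient \<phi> (x + t *\<^sub>R z) \<bullet> (h *\<^sub>R z))) (at t)"
      by (rule has_derivative_compose[where g = \<phi> and f = "\<lambda>t. x + t *\<^sub>R z", OF _ gradient_has_derivative[OF \<phi>]])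
         (auto intro!: derivative_eq_intros)
    then have "((\<lambda>t. \<phi> (x + t *\<^sub>R z)) has_vector_derivative (gradient \<phi> (x + t *\<^sub>R z) \<bullet> z)) (at t)"
      by (simp add: has_vector_derivative_def)
    then show ?thesis by (rule has_vector_derivative_at_within)
  qed
  have "((\<lambda>t. gradient \<phi> (x + t *\<^sub>R z) \<bullet> z) has_integral (\<phi> (x + T *\<^sub>R z) - \<phi> (x + 0 *\<^sub>R z))) {0..T}"
    by (rule fundamental_theorem_of_calculus[OF _ d]) (use T in simp)
  then have 1: "((\<lambda>t. gradient \<phi> (x + t *\<^sub>R z) \<bullet> z) has_integral (- \<phi> x)) {0..T}" by (simp add: end0)
  have cg: "continuous_on UNIV (\<lambda>t. gradient \<phi> (x + t *\<^sub>R z))"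
    by (intro continuous_on_compose2[OF continuous_gradient[OF \<phi>]] continuous_intros) auto
  have "continuous_on {0..T} ?g"
    by (intro continuous_intros continuous_on_subset[OF cg]) auto
  then have gi: "?g integrable_on {0..T}" by (rule integrable_continuous_real)
  have "norm (integral {0..T} (\<lambda>t. gradient \<phi> (x + t *\<^sub>R z) \<bullet> z)) \<le> integral {0..T} (\<lambda>t. ?K * ?g t)"
  proof (rule integral_norm_bound_integral)
    show "(\<lambda>t. gradient \<phi> (x + t *\<^sub>R z) \<bullet> z) integrable_on {0..T}" using 1 by blast
    show "(\<lambda>t. ?K * ?g t) integrable_on {0..T}"
      using integrable_cmul[OF gi, of ?K] by simp
    show "norm (gradient \<phi> (x + t *\<^sub>R z) \<bullet> z) \<le> ?K * ?g t" for t
      using Cauchy_Schwarz_ineq2[of "gradient \<phi> (x + t *\<^sub>R z)" z] mult_left_mono[OF nz norm_ge_zero, of "gradient \<phi> (x + t *\<^sub>R z)"]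
      by (simp add: mult.commute)
  qed
  then have "\<bar>\<phi> x\<bar> \<le> ?K * integral {0..T} ?g" using integral_unique[OF 1] by simp
  then have "ennreal \<bar>\<phi> x\<bar> \<le> ennreal ?K * ennreal (integral {0..T} ?g)"
    by (simp add: ennreal_mult'[symmetric] ennreal_leI)
  also have "ennreal (integral {0..T} ?g) = (\<integral>\<^sup>+t. ennreal (indicator {0..T} t * ?g t) \<partial>lborel)"
    by (rule nn_integral_has_integral_lebesgue[OF _ integrable_integral[OF gi], symmetric]) simp
  also have "\<dots> = (\<integral>\<^sup>+t. ennreal (indicator {0<..T} t * ?g t) \<partial>lborel)"
  proof (rule nn_integral_cong_AE)
    show "AE t in lborel. ennreal (indicator {0..T} t * ?g t) = ennreal (indicator {0<..T} t * ?g t)"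
      using AE_lborel_singleton[of 0] by eventually_elim (auto simp: indicator_def)
  qed
  finally show ?thesis .
qed

lemma powr_le_one_plus_square:
  fixes y s :: real
  assumes "0 \<le> y" "0 \<le> s" "s \<le> 2"
  shows "y powr s \<le> 1 + y\<^sup>2"
proof (cases "y \<le> 1")
  case True
  then have "y powr s \<le> 1" using assms by (intro powr_le1) auto
  then show ?thesis using zero_le_power2[of y] by linarith
next
  case False
  then have "y powr s \<le> y powr 2" using assms by (intro powr_mono) auto
  moreover have "y powr 2 = y\<^sup>2" using assms by (intro powr_numeral)
  ultimately show ?thesis by linarith
qed

text \<open>Let \<open>g\<close> be the norm of the gradient.  Averaging the bound along rays over all directions \<open>z\<close> in the
  cube \<open>B = [1,2]\<^sup>d\<close>, which has volume one, gives
  \<open>\<bar>\<phi> x\<bar> \<le> K \<integral>\<integral> g (x + t z) dz dt\<close> over \<open>0 < t \<le> T\<close> and \<open>z \<in> B\<close>.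
  The integrand is split as \<open>a powr (1/q) * b powr (1 - 1/q)\<close> with \<open>a = t powr \<beta> * g\<^sup>2\<close> and
  \<open>b = t powr (- \<beta> / (q - 1)) * g powr s\<close>, where \<open>s = (q - 2) / (q - 1)\<close> balances the powers of \<open>g\<close>.
  The integral of \<open>b\<close> is bounded uniformly in \<open>x\<close>, because the substitution \<open>y = x + t z\<close> costs only a
  factor \<open>t powr (- d)\<close>; the integral of \<open>a\<close> over \<open>(t, z)\<close> and over \<open>x\<close> is computed by Tonelli's
  theorem and translation invariance.  So Hoelder's inequality bounds the \<open>q\<close>-th power of \<open>\<phi>\<close> by
  something integrable.  The exponent \<open>\<beta>\<close> has to satisfy \<open>-1 < \<beta> < q - 1 - d (q - 2) / 2\<close> for the
  two integrals in \<open>t\<close> to converge at zero, and such a \<open>\<beta>\<close> exists exactly if \<open>q\<close> is subcritical.\<close>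

lemma Sobolev_unit_gradient:
  fixes \<Omega> :: "'a::euclidean_space set" and q R :: real
  assumes R: "\<And>x. x \<in> \<Omega> \<Longrightarrow> norm x < R" "R > 0"
    and q: "q > 2" "q * (real DIM('a) - 2) < 2 * real DIM('a)"
  obtains C where "C > 0" "\<And>\<phi>. \<phi> \<in> test_functions \<Omega> \<Longrightarrow>
      (\<integral>\<^sup>+x. ennreal ((norm (gradient \<phi> x))\<^sup>2) \<partial>lborel) \<le> 1 \<Longrightarrow>
      (\<integral>\<^sup>+x. ennreal (\<bar>\<phi> x\<bar> powr q) \<partial>lborel) \<le> ennreal C"
proof -
  define d where "d = real DIM('a)"
  define T where "T = 2 * R"
  define K where "K = 2 * d"
  define B where "B = cbox (One::'a) (2 *\<^sub>R One)"
  define D where "D = d * (q - 2) / 2"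
  \<comment> \<open>The midpoint of the admissible interval from \<open>-1\<close> to \<open>q - 1 - D\<close>.\<close>
  define \<beta> where "\<beta> = (q - 2 - D) / 2"
  define s where "s = (q - 2) / (q - 1)"
  define \<kappa> where "\<kappa> = - \<beta> / (q - 1) - d * s / 2"
  define \<theta> where "\<theta> = 1 / q"
  define Y where "Y = 2 * (T powr (\<kappa> + 1) / (\<kappa> + 1))"
  define X where "X = T powr (\<beta> + 1) / (\<beta> + 1)"
  define c where "c = K powr q * Y powr (q - 1)"
  have d: "d \<ge> 1" using DIM_positive[where 'a='a] by (simp add: d_def)
  have T: "T > 0" and K: "K > 0" using R d by (auto simp: T_def K_def)
  have D: "D < q" using q by (simp add: D_def d_def[symmetric] field_simps)
  have \<beta>: "\<beta> > -1" using D by (simp add: \<beta>_def field_simps)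
  have s: "0 \<le> s" "s \<le> 2" using q by (auto simp: s_def field_simps)
  have \<kappa>: "\<kappa> > -1"
  proof -
    have "d * s / 2 = D / (q - 1)" by (simp add: s_def D_def)
    then have "\<kappa> = (- \<beta> - D) / (q - 1)" unfolding \<kappa>_def by (simp only: diff_divide_distrib)
    moreover have "- (q - 1) / (q - 1) < (- \<beta> - D) / (q - 1)"
      using q D by (intro divide_strict_right_mono) (simp_all add: \<beta>_def field_simps)
    moreover have "- (q - 1) / (q - 1) = -1" using q by (simp add: divide_eq_minus_1_iff)
    ultimately show ?thesis by linarith
  qed
  have \<theta>: "0 < \<theta>" "\<theta> < 1" using q by (auto simp: \<theta>_def)
  have Y: "Y > 0" and X: "X > 0" using \<kappa> \<beta> T by (auto simp: Y_def X_def)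
  have c: "c > 0" using K Y by (simp add: c_def)
  have B1: "emeasure lborel B = 1"
  proof -
    have one: "(One::'a) \<bullet> b = 1" if "b \<in> Basis" for b
      using that by (simp add: inner_sum_left inner_Basis)
    have "emeasure lborel B = ennreal (\<Prod>b\<in>Basis. (2 *\<^sub>R One - One) \<bullet> (b::'a))"
      unfolding B_def by (rule emeasure_lborel_cbox) (simp add: one)
    also have "(\<Prod>b\<in>Basis. (2 *\<^sub>R One - One) \<bullet> (b::'a)) = 1"
      by (rule prod.neutral) (simp add: inner_diff_left one)
    finally show ?thesis by simp
  qed
  have [measurable]: "B \<in> sets borel" by (simp add: B_def)
  let ?N = "(lborel :: real measure) \<Otimes>\<^sub>M (lborel :: 'a measure)"
  have sigma: "sigma_finite_measure ?N" by (simp add: lborel_prod sigma_finite_lborel)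
  interpret pair_sigma_finite "lborel :: 'a measure" ?N
    by (intro pair_sigma_finite.intro sigma_finite_lborel sigma)
  show ?thesis
  proof (rule that[of "c * X"])
    show "c * X > 0" using c X by simp
    fix \<phi> assume \<phi>: "\<phi> \<in> test_functions \<Omega>"
      and unit: "(\<integral>\<^sup>+x. ennreal ((norm (gradient \<phi> x))\<^sup>2) \<partial>lborel) \<le> 1"
    define g where "g x = norm (gradient \<phi> x)" for x
    have g0: "0 \<le> g x" for x by (simp add: g_def)
    have [measurable]: "g \<in> borel_measurable borel"
      unfolding g_def[abs_def]
      by (intro borel_measurable_continuous_onI continuous_on_norm continuous_gradient[OF \<phi>])
    have [measurable]: "\<phi> \<in> borel_measurable borel"
      by (intro borel_measurable_continuous_onI test_functionD(2)[OF \<phi>])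
    have gi: "(\<integral>\<^sup>+x. ennreal ((g x)\<^sup>2) \<partial>lborel) \<le> 1" using unit by (simp add: g_def)
    define a where "a x p = indicator {0<..T} (fst p) * indicator B (snd p) *
        (fst p powr \<beta> * (g (x + fst p *\<^sub>R snd p))\<^sup>2)" for x :: 'a and p :: "real \<times> 'a"
    define b where "b x p = indicator {0<..T} (fst p) * indicator B (snd p) *
        (fst p powr (- \<beta> / (q - 1)) * g (x + fst p *\<^sub>R snd p) powr s)" for x :: 'a and p :: "real \<times> 'a"
    have a_meas [measurable]: "(\<lambda>(x, p). a x p) \<in> borel_measurable (lborel \<Otimes>\<^sub>M ?N)"
      unfolding a_def by measurable
    have a_meas1 [measurable]: "a x \<in> borel_measurable ?N" for x
      unfolding a_def[abs_def] by measurable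
    have b_meas [measurable]: "b x \<in> borel_measurable ?N" for x
      unfolding b_def[abs_def] by measurable
    have ab0: "0 \<le> a x p" "0 \<le> b x p" for x p by (auto simp: a_def b_def)
    have ab: "a x p powr \<theta> * b x p powr (1 - \<theta>) =
        indicator {0<..T} (fst p) * indicator B (snd p) * g (x + fst p *\<^sub>R snd p)" for x p
    proof (cases "fst p \<in> {0<..T} \<and> snd p \<in> B \<and> g (x + fst p *\<^sub>R snd p) \<noteq> 0")
      case False
      then show ?thesis by (auto simp: a_def b_def)
    next
      case True
      define t y where "t = fst p" and "y = g (x + fst p *\<^sub>R snd p)"
      have ty: "t > 0" "y > 0" using True g0[of "x + fst p *\<^sub>R snd p"] by (auto simp: t_def y_def)
      have "a x p powr \<theta> * b x p powr (1 - \<theta>) =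
          (t powr \<beta> * y powr 2) powr \<theta> * (t powr (- \<beta> / (q - 1)) * y powr s) powr (1 - \<theta>)"
        using True g0 by (simp add: a_def b_def t_def y_def)
      also have "\<dots> = t powr (\<beta> * \<theta> + (- \<beta> / (q - 1)) * (1 - \<theta>)) * y powr (2 * \<theta> + s * (1 - \<theta>))"
      proof -
        have "(t powr \<beta> * y powr 2) powr \<theta> = t powr (\<beta> * \<theta>) * y powr (2 * \<theta>)"
          using ty by (simp add: powr_mult powr_powr del: powr_numeral)
        moreover have "(t powr (- \<beta> / (q - 1)) * y powr s) powr (1 - \<theta>) =
            t powr ((- \<beta> / (q - 1)) * (1 - \<theta>)) * y powr (s * (1 - \<theta>))"
          using ty by (simp add: powr_mult powr_powr)
        ultimately show ?thesis by (simp only: powr_add mult_ac)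
      qed
      also have "\<beta> * \<theta> + (- \<beta> / (q - 1)) * (1 - \<theta>) = 0"
        using q by (simp add: \<theta>_def field_simps)
      also have "2 * \<theta> + s * (1 - \<theta>) = 1"
        using q by (simp add: \<theta>_def s_def field_simps)
      finally show ?thesis using True ty by (simp add: t_def y_def)
    qed
    have b_int: "(\<integral>\<^sup>+p. ennreal (b x p) \<partial>?N) \<le> ennreal Y" for x
    proof -
      have inner: "(\<integral>\<^sup>+z. ennreal (b x (t, z)) \<partial>lborel) \<le> ennreal (2 * (indicator {0<..T} t * t powr \<kappa>))" for t
      proof (cases "t \<in> {0<..T}")
        case False
        then show ?thesis by (simp add: b_def)
      next
        case True
        \<comment> \<open>The size of \<open>g\<close> at which both terms of \<open>g powr s \<le> l powr s * (1 + (g / l)\<^sup>2)\<close> contribute equally after integration.\<close>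
        define l where "l = t powr (- d / 2)"
        have t: "t > 0" using True by simp
        have l: "l > 0" using t by (simp add: l_def)
        define e where "e = t powr (- \<beta> / (q - 1)) * l powr s"
        have e: "e > 0" using l t by (simp add: e_def)
        have e_eq: "e = t powr \<kappa>"
          using t by (simp add: e_def l_def \<kappa>_def powr_powr powr_add[symmetric])
        have l2: "l\<^sup>2 = t powr (- d)" using t by (simp add: l_def powr_power)
        have pt: "b x (t, z) \<le> e * indicator B z + e / l\<^sup>2 * (g (x + t *\<^sub>R z))\<^sup>2" for z
        proof -
          define y where "y = g (x + t *\<^sub>R z)"
          have y: "y \<ge> 0" using g0 by (simp add: y_def)
          have "(y / l) powr s \<le> 1 + (y / l)\<^sup>2" using y l s by (intro powr_le_one_plus_square) auto
          then have "e * (y / l) powr s \<le> e * (1 + (y / l)\<^sup>2)" using e by (intro mult_left_mono) auto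
          moreover have "e * (y / l) powr s = t powr (- \<beta> / (q - 1)) * y powr s"
            using y l by (simp add: e_def powr_divide)
          ultimately have "t powr (- \<beta> / (q - 1)) * y powr s \<le> e + e / l\<^sup>2 * y\<^sup>2"
            by (simp add: power_divide algebra_simps)
          moreover have "0 \<le> e / l\<^sup>2 * y\<^sup>2" using e by simp
          ultimately show ?thesis using True by (simp add: b_def y_def[symmetric] indicator_def)
        qed
        have "(\<integral>\<^sup>+z. ennreal (b x (t, z)) \<partial>lborel) \<le>
            (\<integral>\<^sup>+z. ennreal e * indicator B z + ennreal (e / l\<^sup>2) * ennreal ((g (x + t *\<^sub>R z))\<^sup>2) \<partial>lborel)"
        proof (rule nn_integral_mono)
          fix z
          have "ennreal (b x (t, z)) \<le> ennreal (e * indicator B z + e / l\<^sup>2 * (g (x + t *\<^sub>R z))\<^sup>2)"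
            using pt by (rule ennreal_leI)
          also have "\<dots> = ennreal e * indicator B z + ennreal (e / l\<^sup>2) * ennreal ((g (x + t *\<^sub>R z))\<^sup>2)"
          proof -
            have "ennreal (e * indicator B z) = ennreal e * indicator B z" by (cases "z \<in> B") auto
            moreover have "ennreal (e / l\<^sup>2 * (g (x + t *\<^sub>R z))\<^sup>2) = ennreal (e / l\<^sup>2) * ennreal ((g (x + t *\<^sub>R z))\<^sup>2)"
              by (rule ennreal_mult) (use e in auto)
            moreover have "0 \<le> e * indicator B z" "0 \<le> e / l\<^sup>2 * (g (x + t *\<^sub>R z))\<^sup>2" using e by auto
            ultimately show ?thesis by (simp only: ennreal_plus)
          qed
          finally show "ennreal (b x (t, z)) \<le> \<dots>" .
        qed
        also have "\<dots> = ennreal e * emeasure lborel B + ennreal (e / l\<^sup>2) * (\<integral>\<^sup>+z. ennreal ((g (x + t *\<^sub>R z))\<^sup>2) \<partial>lborel)"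
          by (simp add: nn_integral_add nn_integral_cmult)
        also have "\<dots> \<le> ennreal e * 1 + ennreal (e / l\<^sup>2) * ennreal (t powr (- d))"
          unfolding B1 d_def
          by (intro add_mono mult_left_mono nn_integral_dilation_le[where f = "\<lambda>x. ennreal ((g x)\<^sup>2)"] gi t) auto
        also have "\<dots> = ennreal (2 * e)"
          unfolding l2[symmetric] using e l
          by (simp add: ennreal_mult[symmetric] ennreal_plus[symmetric] del: ennreal_plus)
        finally show ?thesis using True by (simp add: e_eq)
      qed
      have "(\<integral>\<^sup>+p. ennreal (b x p) \<partial>?N) = (\<integral>\<^sup>+t. \<integral>\<^sup>+z. ennreal (b x (t, z)) \<partial>lborel \<partial>lborel)"
        by (subst lborel.nn_integral_fst[symmetric]) auto
      also have "\<dots> \<le> (\<integral>\<^sup>+t. ennreal (2 * (indicator {0<..T} t * t powr \<kappa>)) \<partial>lborel)"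
        by (intro nn_integral_mono inner)
      also have "\<dots> = 2 * (\<integral>\<^sup>+t. ennreal (indicator {0<..T} t * t powr \<kappa>) \<partial>lborel)"
        by (subst nn_integral_cmult[symmetric]) (auto simp: ennreal_mult)
      also have "\<dots> = ennreal Y"
        unfolding nn_integral_powr[OF \<kappa> T] Y_def by (subst ennreal_mult) (use \<kappa> T in auto)
      finally show ?thesis .
    qed
    have ray: "ennreal \<bar>\<phi> x\<bar> \<le> ennreal K * (\<integral>\<^sup>+p. ennreal (a x p powr \<theta> * b x p powr (1 - \<theta>)) \<partial>?N)" for x
    proof -
      have "ennreal \<bar>\<phi> x\<bar> = (\<integral>\<^sup>+z. ennreal \<bar>\<phi> x\<bar> * indicator B z \<partial>lborel)"
        by (simp add: nn_integral_cmult B1)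
      also have "\<dots> \<le> (\<integral>\<^sup>+z. ennreal K * (\<integral>\<^sup>+t. ennreal (a x (t, z) powr \<theta> * b x (t, z) powr (1 - \<theta>)) \<partial>lborel) \<partial>lborel)"
      proof (rule nn_integral_mono)
        fix z
        show "ennreal \<bar>\<phi> x\<bar> * indicator B z \<le> ennreal K * (\<integral>\<^sup>+t. ennreal (a x (t, z) powr \<theta> * b x (t, z) powr (1 - \<theta>)) \<partial>lborel)"
        proof (cases "z \<in> B")
          case True
          then show ?thesis
            using test_function_le_ray_integral[OF \<phi> R(1) _ T_def R(2), of z x]
            unfolding ab by (simp add: B_def K_def d_def g_def)
        qed simp
      qed
      also have "\<dots> = ennreal K * (\<integral>\<^sup>+z. \<integral>\<^sup>+t. ennreal (a x (t, z) powr \<theta> * b x (t, z) powr (1 - \<theta>)) \<partial>lborel \<partial>lborel)"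
        by (rule nn_integral_cmult) measurable
      also have "(\<integral>\<^sup>+z. \<integral>\<^sup>+t. ennreal (a x (t, z) powr \<theta> * b x (t, z) powr (1 - \<theta>)) \<partial>lborel \<partial>lborel)
          = (\<integral>\<^sup>+p. ennreal (a x p powr \<theta> * b x p powr (1 - \<theta>)) \<partial>?N)"
        by (rule lborel_pair.nn_integral_snd) measurable
      finally show ?thesis .
    qed
    have bound: "\<bar>\<phi> x\<bar> powr q \<le> c * A" if A: "A > 0" "(\<integral>\<^sup>+p. ennreal (a x p) \<partial>?N) \<le> ennreal A" for A x
    proof -
      note ray[of x]
      also have "ennreal K * (\<integral>\<^sup>+p. ennreal (a x p powr \<theta> * b x p powr (1 - \<theta>)) \<partial>?N) \<le> ennreal K * ennreal (A powr \<theta> * Y powr (1 - \<theta>))"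
        by (intro mult_left_mono nn_integral_Hoelder a_meas1 b_meas ab0 A Y \<theta> b_int) auto
      also have "\<dots> = ennreal (K * (A powr \<theta> * Y powr (1 - \<theta>)))" using K by (simp add: ennreal_mult)
      finally have "\<bar>\<phi> x\<bar> \<le> K * (A powr \<theta> * Y powr (1 - \<theta>))" using K by (subst (asm) ennreal_le_iff) auto
      then have "\<bar>\<phi> x\<bar> powr q \<le> (K * (A powr \<theta> * Y powr (1 - \<theta>))) powr q"
        using q by (intro powr_mono2) auto
      also have "\<dots> = K powr q * (A powr (\<theta> * q) * Y powr ((1 - \<theta>) * q))"
        using K A Y by (simp add: powr_mult powr_powr)
      also have "\<theta> * q = 1" using q by (simp add: \<theta>_def)
      also have "(1 - \<theta>) * q = q - 1" using q by (simp add: \<theta>_def field_simps)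
      finally show ?thesis using A by (simp add: c_def mult_ac)
    qed
    have pw: "ennreal (\<bar>\<phi> x\<bar> powr q) \<le> ennreal c * (\<integral>\<^sup>+p. ennreal (a x p) \<partial>?N)" for x
    proof (cases "(\<integral>\<^sup>+p. ennreal (a x p) \<partial>?N)")
      case (real r)
      have "\<bar>\<phi> x\<bar> powr q \<le> c * r"
      proof (rule field_le_epsilon)
        fix e :: real assume e: "e > 0"
        have "\<bar>\<phi> x\<bar> powr q \<le> c * (r + e / c)"
          by (rule bound) (use real e c in \<open>auto intro!: ennreal_leI add_nonneg_pos\<close>)
        moreover have "c * (r + e / c) = c * r + e" using c by (simp add: distrib_left)
        ultimately show "\<bar>\<phi> x\<bar> powr q \<le> c * r + e" by linarith
      qed
      then show ?thesis using real c by (simp add: ennreal_mult[symmetric] ennreal_leI)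
    next
      case top
      then show ?thesis using c by (simp add: ennreal_mult_top)
    qed
    have a_int: "(\<integral>\<^sup>+x. \<integral>\<^sup>+p. ennreal (a x p) \<partial>?N \<partial>lborel) \<le> ennreal X"
    proof -
      have "(\<integral>\<^sup>+x. \<integral>\<^sup>+p. ennreal (a x p) \<partial>?N \<partial>lborel) = (\<integral>\<^sup>+p. \<integral>\<^sup>+x. ennreal (a x p) \<partial>lborel \<partial>?N)"
        by (rule Fubini'[symmetric]) measurable
      also have "\<dots> \<le> (\<integral>\<^sup>+p. ennreal (indicator {0<..T} (fst p) * fst p powr \<beta>) * indicator B (snd p) \<partial>?N)"
      proof (rule nn_integral_mono)
        fix p :: "real \<times> 'a"
        let ?w = "ennreal (indicator {0<..T} (fst p) * fst p powr \<beta>) * indicator B (snd p)"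
        have "(\<integral>\<^sup>+x. ennreal (a x p) \<partial>lborel) = (\<integral>\<^sup>+x. ?w * ennreal ((g (x + fst p *\<^sub>R snd p))\<^sup>2) \<partial>lborel)"
          by (intro nn_integral_cong) (auto simp: a_def ennreal_mult indicator_def)
        also have "\<dots> = ?w * (\<integral>\<^sup>+x. ennreal ((g (x + fst p *\<^sub>R snd p))\<^sup>2) \<partial>lborel)"
          by (rule nn_integral_cmult) measurable
        also have "\<dots> = ?w * (\<integral>\<^sup>+x. ennreal ((g x)\<^sup>2) \<partial>lborel)"
          by (subst nn_integral_translation[where f = "\<lambda>x. ennreal ((g x)\<^sup>2)"]) auto
        also have "\<dots> \<le> ?w * 1" by (intro mult_left_mono gi) auto
        finally show "(\<integral>\<^sup>+x. ennreal (a x p) \<partial>lborel) \<le> ?w" by simp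
      qed
      also have "\<dots> = (\<integral>\<^sup>+t. \<integral>\<^sup>+z. ennreal (indicator {0<..T} t * t powr \<beta>) * indicator B z \<partial>lborel \<partial>lborel)"
        by (subst lborel.nn_integral_fst[symmetric]) auto
      also have "\<dots> = (\<integral>\<^sup>+t. ennreal (indicator {0<..T} t * t powr \<beta>) \<partial>lborel)"
        by (simp add: nn_integral_cmult B1)
      also have "\<dots> = ennreal X" unfolding nn_integral_powr[OF \<beta> T] X_def ..
      finally show ?thesis .
    qed
    have "(\<integral>\<^sup>+x. ennreal (\<bar>\<phi> x\<bar> powr q) \<partial>lborel) \<le> (\<integral>\<^sup>+x. ennreal c * (\<integral>\<^sup>+p. ennreal (a x p) \<partial>?N) \<partial>lborel)"
      by (intro nn_integral_mono pw)
    also have "\<dots> = ennreal c * (\<integral>\<^sup>+x. \<integral>\<^sup>+p. ennreal (a x p) \<partial>?N \<partial>lborel)"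
      by (rule nn_integral_cmult) measurable
    also have "\<dots> \<le> ennreal c * ennreal X" by (intro mult_left_mono a_int) auto
    also have "\<dots> = ennreal (c * X)" using c X by (simp add: ennreal_mult)
    finally show "(\<integral>\<^sup>+x. ennreal (\<bar>\<phi> x\<bar> powr q) \<partial>lborel) \<le> ennreal (c * X)" .
  qed
qed

lemma gradient_scale:
  assumes "\<phi> \<in> test_functions \<Omega>"
  shows "gradient (\<lambda>x. c * \<phi> x) x = c *\<^sub>R gradient \<phi> x"
proof -
  have "((\<lambda>x. c * \<phi> x) has_derivative (\<lambda>h. c * frechet_derivative \<phi> (at x) h)) (at x)"
    by (intro has_derivative_mult_right frechet_derivative_works[THEN iffD1] test_functionD(3)[OF assms])
  then have "frechet_derivative (\<lambda>x. c * \<phi> x) (at x) = (\<lambda>h. c * frechet_derivative \<phi> (at x) h)"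
    by (rule frechet_derivative_at[symmetric])
  then show ?thesis by (simp add: gradient_def scaleR_sum_right)
qed

lemma integral_Hoelder:
  fixes a b :: "'x \<Rightarrow> real"
  assumes a: "integrable N a" and b: "integrable N b"
    and nn: "\<And>x. 0 \<le> a x" "\<And>x. 0 \<le> b x" and \<theta>: "0 < \<theta>" "\<theta> < 1"
  shows "integrable N (\<lambda>x. a x powr \<theta> * b x powr (1 - \<theta>))"
    "(LINT x|N. a x powr \<theta> * b x powr (1 - \<theta>)) \<le> (LINT x|N. a x) powr \<theta> * (LINT x|N. b x) powr (1 - \<theta>)"
proof -
  have [measurable]: "a \<in> borel_measurable N" "b \<in> borel_measurable N" using a b by auto
  let ?f = "\<lambda>x. a x powr \<theta> * b x powr (1 - \<theta>)"
  let ?A = "LINT x|N. a x" and ?B = "LINT x|N. b x"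
  have AB0: "0 \<le> ?A" "0 \<le> ?B" using nn by (auto intro: integral_nonneg_AE)
  have "integrable N ?f \<and> integral\<^sup>L N ?f \<le> ?A powr \<theta> * ?B powr (1 - \<theta>)"
  proof (cases "?A = 0 \<or> ?B = 0")
    case True
    then have "(AE x in N. a x = 0) \<or> (AE x in N. b x = 0)"
      using integral_nonneg_eq_0_iff_AE[OF a] integral_nonneg_eq_0_iff_AE[OF b] nn by auto
    then have z: "AE x in N. ?f x = 0" by (auto elim: eventually_mono)
    have "integrable N ?f"
      by (rule integrable_cong_AE_imp[OF integrable_zero]) (use z in \<open>auto elim: eventually_mono\<close>)
    moreover have "integral\<^sup>L N ?f = 0" using z by (rule integral_eq_zero_AE)
    moreover have "0 \<le> ?A powr \<theta> * ?B powr (1 - \<theta>)" by simp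
    ultimately show ?thesis by (simp only: conj_absorb simp_thms)
  next
    case False
    then have AB: "0 < ?A" "0 < ?B" using AB0 by auto
    have le: "(\<integral>\<^sup>+x. ennreal (?f x) \<partial>N) \<le> ennreal (?A powr \<theta> * ?B powr (1 - \<theta>))"
      by (rule nn_integral_Hoelder) (use nn AB \<theta> a b in \<open>simp_all add: nn_integral_eq_integral\<close>)
    have fm: "?f \<in> borel_measurable N" by measurable
    from integral_le_of_nn_integral_le[OF fm _ _ le] show ?thesis by simp
  qed
  then show "integrable N ?f" "integral\<^sup>L N ?f \<le> ?A powr \<theta> * ?B powr (1 - \<theta>)" by auto
qed

context bounded_open begin

lemma nn_integral_lborel_eq_L:
  fixes f :: "'a \<Rightarrow> real"
  assumes "f \<in> borel_measurable borel" "\<And>x. x \<notin> \<Omega> \<Longrightarrow> f x = 0"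
  shows "(\<integral>\<^sup>+x. ennreal (f x) \<partial>lborel) = (\<integral>\<^sup>+x. ennreal (f x) \<partial>L)"
proof -
  have "(\<integral>\<^sup>+x. ennreal (f x) \<partial>L) = (\<integral>\<^sup>+x. ennreal (f x) * indicator \<Omega> x \<partial>lebesgue)"
    by (rule nn_integral_restrict_space) (use open_\<Omega> in simp)
  also have "(\<lambda>x. ennreal (f x) * indicator \<Omega> x) = (\<lambda>x. ennreal (f x))"
    using assms(2) by (auto simp: fun_eq_iff indicator_def)
  also have "(\<integral>\<^sup>+x. ennreal (f x) \<partial>lebesgue) = (\<integral>\<^sup>+x. ennreal (f x) \<partial>lborel)"
    using assms(1) by (simp add: nn_integral_completion)
  finally show ?thesis by simp
qed

lemma ip_self_eq:
  assumes "u \<in> H1 \<Omega>"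
  shows "ip u u = (LINT x|L. (u x)\<^sup>2) + (LINT x|L. (norm (wgrad \<Omega> u x))\<^sup>2)"
proof -
  have "ip u u = (LINT x|L. (u x)\<^sup>2 + (norm (wgrad \<Omega> u x))\<^sup>2)"
    by (simp only: H1_inner_def power2_norm_eq_inner power2_eq_square[of "u _"])
  also have "\<dots> = (LINT x|L. (u x)\<^sup>2) + (LINT x|L. (norm (wgrad \<Omega> u x))\<^sup>2)"
    using H1D(1,3)[OF assms] by (intro Bochner_Integration.integral_add) (auto simp: square_integrable_def)
  finally show ?thesis .
qed

lemma integral_square_le_ip:
  assumes "u \<in> H1 \<Omega>"
  shows "integrable L (\<lambda>x. (u x)\<^sup>2)" "(LINT x|L. (u x)\<^sup>2) \<le> ip u u"
  using ip_self_eq[OF assms] H1D(1)[OF assms] by (auto simp: square_integrable_def integral_nonneg_AE)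

lemma ip_self_zero:
  assumes "u \<in> H1 \<Omega>" "ip u u = 0"
  shows "AE x in L. u x = 0"
proof -
  have "(LINT x|L. (u x)\<^sup>2) = 0"
  proof (rule antisym)
    show "(LINT x|L. (u x)\<^sup>2) \<le> 0" using integral_square_le_ip(2)[OF assms(1)] assms(2) by simp
    show "0 \<le> (LINT x|L. (u x)\<^sup>2)" by (intro integral_nonneg_AE) simp
  qed
  then have "AE x in L. (u x)\<^sup>2 = 0"
    using integral_nonneg_eq_0_iff_AE[OF integral_square_le_ip(1)[OF assms(1)]] by simp
  then show ?thesis by eventually_elim simp
qed

lemma gradient_integral_le_ip:
  assumes \<phi>: "\<phi> \<in> test_functions \<Omega>"
  shows "(\<integral>\<^sup>+x. ennreal ((norm (gradient \<phi> x))\<^sup>2) \<partial>lborel) \<le> ennreal (ip \<phi> \<phi>)"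
proof -
  note H = test_function_H1[OF \<phi>]
  have gs: "integrable L (\<lambda>x. (norm (gradient \<phi> x))\<^sup>2)"
    using square_integrable_gradient[OF \<phi>] by (auto simp: square_integrable_def)
  have cg: "gradient \<phi> \<in> borel_measurable borel"
    by (intro borel_measurable_continuous_onI continuous_gradient[OF \<phi>])
  have "(\<integral>\<^sup>+x. ennreal ((norm (gradient \<phi> x))\<^sup>2) \<partial>lborel) = (\<integral>\<^sup>+x. ennreal ((norm (gradient \<phi> x))\<^sup>2) \<partial>L)"
  proof (rule nn_integral_lborel_eq_L)
    show "(norm (gradient \<phi> x))\<^sup>2 = 0" if "x \<notin> \<Omega>" for x
      using test_function_outside(3)[OF \<phi> that] by (simp add: gradient_def)
  qed (use cg in measurable)
  also have "\<dots> = ennreal (LINT x|L. (norm (gradient \<phi> x))\<^sup>2)"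
    by (rule nn_integral_eq_integral[OF gs]) simp
  also have "(LINT x|L. (norm (gradient \<phi> x))\<^sup>2) = (LINT x|L. (norm (wgrad \<Omega> \<phi> x))\<^sup>2)"
  proof (rule integral_cong_AE)
    show "AE x in L. (norm (gradient \<phi> x))\<^sup>2 = (norm (wgrad \<Omega> \<phi> x))\<^sup>2"
      using H(2) by eventually_elim (simp add: jet_def)
  qed (use gs H1D(3)[OF H(1)] in \<open>auto simp: square_integrable_def\<close>)
  also have "ennreal \<dots> \<le> ennreal (ip \<phi> \<phi>)"
    by (intro ennreal_leI) (simp add: ip_self_eq[OF H(1)] integral_nonneg_AE)
  finally show ?thesis .
qed

text \<open>The bound for gradients of norm at most one, applied to \<open>\<phi> / m\<close>.\<close>

lemma Sobolev_test_functions: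
  assumes q: "q > 2" "q * (real DIM('a) - 2) < 2 * real DIM('a)"
  obtains C where "C > 0" "\<And>\<phi> m. \<phi> \<in> test_functions \<Omega> \<Longrightarrow> m > 0 \<Longrightarrow> ip \<phi> \<phi> \<le> m\<^sup>2 \<Longrightarrow>
     integrable L (\<lambda>x. \<bar>\<phi> x\<bar> powr q) \<and> (LINT x|L. \<bar>\<phi> x\<bar> powr q) \<le> C * m powr q"
proof -
  obtain R0 where R0: "\<And>x. x \<in> \<Omega> \<Longrightarrow> norm x \<le> R0" using bounded_\<Omega> by (auto simp: bounded_iff)
  define R where "R = max R0 0 + 1"
  have R: "norm x < R" if "x \<in> \<Omega>" for x using R0[OF that] by (simp add: R_def)
  have "R > 0" by (simp add: R_def)
  obtain C where C: "C > 0" and S: "\<And>\<phi>. \<phi> \<in> test_functions \<Omega> \<Longrightarrow>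
      (\<integral>\<^sup>+x. ennreal ((norm (gradient \<phi> x))\<^sup>2) \<partial>lborel) \<le> 1 \<Longrightarrow>
      (\<integral>\<^sup>+x. ennreal (\<bar>\<phi> x\<bar> powr q) \<partial>lborel) \<le> ennreal C"
    by (rule Sobolev_unit_gradient[OF R \<open>R > 0\<close> q]) blast+
  show ?thesis
  proof (rule that[OF C])
    fix \<phi> and m :: real assume \<phi>: "\<phi> \<in> test_functions \<Omega>" and m: "m > 0" and le: "ip \<phi> \<phi> \<le> m\<^sup>2"
    have \<phi>m: "\<phi> \<in> borel_measurable borel" by (intro borel_measurable_continuous_onI test_functionD(2)[OF \<phi>])
    have gm: "gradient \<phi> \<in> borel_measurable borel"
      by (intro borel_measurable_continuous_onI continuous_gradient[OF \<phi>])
    let ?\<psi> = "\<lambda>x. (1 / m) * \<phi> x"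
    have \<psi>: "?\<psi> \<in> test_functions \<Omega>"
      using test_functions_lincomb[OF \<phi> \<phi>, of "1 / m" 0] by simp
    have "(\<integral>\<^sup>+x. ennreal ((norm (gradient ?\<psi> x))\<^sup>2) \<partial>lborel) =
        (\<integral>\<^sup>+x. ennreal (1 / m\<^sup>2) * ennreal ((norm (gradient \<phi> x))\<^sup>2) \<partial>lborel)"
    proof (rule nn_integral_cong)
      fix x
      have "(norm (gradient ?\<psi> x))\<^sup>2 = 1 / m\<^sup>2 * (norm (gradient \<phi> x))\<^sup>2"
        unfolding gradient_scale[OF \<phi>] by (simp add: power_mult_distrib power_divide)
      then show "ennreal ((norm (gradient ?\<psi> x))\<^sup>2) = ennreal (1 / m\<^sup>2) * ennreal ((norm (gradient \<phi> x))\<^sup>2)"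
        by (simp only: ennreal_mult[symmetric] zero_le_power2 zero_le_divide_1_iff)
    qed
    also have "\<dots> = ennreal (1 / m\<^sup>2) * (\<integral>\<^sup>+x. ennreal ((norm (gradient \<phi> x))\<^sup>2) \<partial>lborel)"
      by (rule nn_integral_cmult) (use gm in measurable)
    also have "\<dots> \<le> ennreal (1 / m\<^sup>2) * ennreal (m\<^sup>2)"
      by (intro mult_left_mono order_trans[OF gradient_integral_le_ip[OF \<phi>]] ennreal_leI le) auto
    also have "\<dots> = 1" using m by (simp add: ennreal_mult[symmetric])
    finally have "(\<integral>\<^sup>+x. ennreal (\<bar>?\<psi> x\<bar> powr q) \<partial>lborel) \<le> ennreal C" by (rule S[OF \<psi>])
    moreover have "(\<integral>\<^sup>+x. ennreal (\<bar>\<phi> x\<bar> powr q) \<partial>lborel) = ennreal (m powr q) * (\<integral>\<^sup>+x. ennreal (\<bar>?\<psi> x\<bar> powr q) \<partial>lborel)"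
    proof -
      have "(\<integral>\<^sup>+x. ennreal (\<bar>\<phi> x\<bar> powr q) \<partial>lborel) = (\<integral>\<^sup>+x. ennreal (m powr q) * ennreal (\<bar>?\<psi> x\<bar> powr q) \<partial>lborel)"
      proof (rule nn_integral_cong)
        fix x
        have "\<bar>\<phi> x\<bar> = m * \<bar>?\<psi> x\<bar>" using m by (simp add: abs_mult)
        then have "\<bar>\<phi> x\<bar> powr q = m powr q * \<bar>?\<psi> x\<bar> powr q" using m by (simp only: powr_mult)
        then show "ennreal (\<bar>\<phi> x\<bar> powr q) = ennreal (m powr q) * ennreal (\<bar>?\<psi> x\<bar> powr q)"
          by (simp only: ennreal_mult[symmetric] powr_ge_zero)
      qed
      also have "\<dots> = ennreal (m powr q) * (\<integral>\<^sup>+x. ennreal (\<bar>?\<psi> x\<bar> powr q) \<partial>lborel)"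
        by (rule nn_integral_cmult) (use \<phi>m in measurable)
      finally show ?thesis .
    qed
    ultimately have "(\<integral>\<^sup>+x. ennreal (\<bar>\<phi> x\<bar> powr q) \<partial>lborel) \<le> ennreal (m powr q) * ennreal C"
      by (simp only: mult_left_mono zero_le)
    also have "\<dots> = ennreal (C * m powr q)" using C by (simp add: ennreal_mult[symmetric] mult.commute)
    also have "(\<integral>\<^sup>+x. ennreal (\<bar>\<phi> x\<bar> powr q) \<partial>lborel) = (\<integral>\<^sup>+x. ennreal (\<bar>\<phi> x\<bar> powr q) \<partial>L)"
    proof (rule nn_integral_lborel_eq_L)
      show "\<bar>\<phi> x\<bar> powr q = 0" if "x \<notin> \<Omega>" for x using test_function_outside(2)[OF \<phi> that] by simp
    qed (use \<phi>m in measurable)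
    finally have le: "(\<integral>\<^sup>+x. ennreal (\<bar>\<phi> x\<bar> powr q) \<partial>L) \<le> ennreal (C * m powr q)" .
    have "\<phi> \<in> borel_measurable L" using square_integrable_test[OF \<phi>] by (simp add: square_integrable_def)
    then have fm: "(\<lambda>x. \<bar>\<phi> x\<bar> powr q) \<in> borel_measurable L" by measurable
    from integral_le_of_nn_integral_le[OF fm _ _ le]
    show "integrable L (\<lambda>x. \<bar>\<phi> x\<bar> powr q) \<and> (LINT x|L. \<bar>\<phi> x\<bar> powr q) \<le> C * m powr q"
      using C by simp
  qed
qed

text \<open>Fatou's lemma carries the bound from approximating test functions to their limit.  The factor two
  leaves room for the norms of the approximants to exceed that of the limit.\<close>

lemma Sobolev_H10:
  assumes q: "q > 2" "q * (real DIM('a) - 2) < 2 * real DIM('a)"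
  obtains C where "C > 0" "\<And>u. u \<in> H10 \<Omega> \<Longrightarrow> integrable L (\<lambda>x. \<bar>u x\<bar> powr q)"
    "\<And>u. u \<in> H10 \<Omega> \<Longrightarrow> (LINT x|L. \<bar>u x\<bar> powr q) \<le> C * (2 * H1_norm \<Omega> u) powr q"
proof -
  obtain C where C: "C > 0" and S: "\<And>\<phi> m. \<phi> \<in> test_functions \<Omega> \<Longrightarrow> m > 0 \<Longrightarrow> ip \<phi> \<phi> \<le> m\<^sup>2 \<Longrightarrow>
     integrable L (\<lambda>x. \<bar>\<phi> x\<bar> powr q) \<and> (LINT x|L. \<bar>\<phi> x\<bar> powr q) \<le> C * m powr q"
    by (rule Sobolev_test_functions[OF q]) blast+
  have main: "integrable L (\<lambda>x. \<bar>u x\<bar> powr q) \<and> (LINT x|L. \<bar>u x\<bar> powr q) \<le> C * m powr q"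
    if u: "u \<in> H10 \<Omega>" and m: "m > 0" "ip u u < m\<^sup>2" for u m
  proof -
    obtain \<phi> where \<phi>: "approximates \<phi> u" using u by (auto simp: H10_iff)
    note D = approximatesD[OF \<phi>]
    have um: "u \<in> borel_measurable L" using H1D(1)[OF D(3)] by (simp add: square_integrable_def)
    have "(\<lambda>n. LINT x|L. norm ((\<phi> n x - u x)\<^sup>2)) \<longlonglongrightarrow> 0"
    proof (rule tendsto_sandwich[OF _ _ tendsto_const D(5)])
      show "\<forall>\<^sub>F n in sequentially. 0 \<le> (LINT x|L. norm ((\<phi> n x - u x)\<^sup>2))"
        by (simp add: integral_nonneg_AE)
      show "\<forall>\<^sub>F n in sequentially. (LINT x|L. norm ((\<phi> n x - u x)\<^sup>2)) \<le> ip (\<lambda>x. \<phi> n x - u x) (\<lambda>x. \<phi> n x - u x)"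
        using integral_square_le_ip(2)[OF H1_diff[OF D(2,3)]] by simp
    qed
    from tendsto_L1_AE_subseq[OF integral_square_le_ip(1)[OF H1_diff[OF D(2,3)]] this]
    obtain r where r: "strict_mono r" "AE x in L. (\<lambda>n. (\<phi> (r n) x - u x)\<^sup>2) \<longlonglongrightarrow> 0" by blast
    have lim: "AE x in L. (\<lambda>n. \<bar>\<phi> (r n) x\<bar> powr q) \<longlonglongrightarrow> \<bar>u x\<bar> powr q"
      using r(2)
    proof eventually_elim
      case (elim x)
      from tendsto_real_sqrt[OF elim] have "(\<lambda>n. \<bar>\<phi> (r n) x - u x\<bar>) \<longlonglongrightarrow> 0" by simp
      then have "(\<lambda>n. \<phi> (r n) x - u x) \<longlonglongrightarrow> 0" by (rule tendsto_rabs_zero_cancel)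
      then have "(\<lambda>n. \<phi> (r n) x) \<longlonglongrightarrow> u x" by (rule LIM_zero_cancel)
      then have "(\<lambda>n. \<bar>\<phi> (r n) x\<bar>) \<longlonglongrightarrow> \<bar>u x\<bar>" by (rule tendsto_rabs)
      then show ?case using q by (intro tendsto_powr2) auto
    qed
    have "eventually (\<lambda>n. ip (\<phi> n) (\<phi> n) < m\<^sup>2) sequentially"
      by (rule order_tendstoD(2)[OF ip_self_tendsto[OF \<phi>] m(2)])
    then have "eventually (\<lambda>n. ip (\<phi> (r n)) (\<phi> (r n)) < m\<^sup>2) sequentially"
      using eventually_subseq[OF r(1)] by blast
    then have ev: "eventually (\<lambda>n. (LINT x|L. \<bar>\<phi> (r n) x\<bar> powr q) \<le> C * m powr q) sequentially"
      by eventually_elim (use S[OF D(1) m(1)] in auto)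
    have int: "integrable L (\<lambda>x. \<bar>\<phi> (r n) x\<bar> powr q)" for n
    proof -
      have "ip (\<phi> (r n)) (\<phi> (r n)) \<le> (1 + ip (\<phi> (r n)) (\<phi> (r n)))\<^sup>2"
        using ip_self_nonneg[of "\<phi> (r n)"] by (simp add: power2_sum)
      then show ?thesis using S[OF D(1), of "1 + ip (\<phi> (r n)) (\<phi> (r n))"] ip_self_nonneg[of "\<phi> (r n)"] by simp
    qed
    have km: "(\<lambda>x. \<bar>u x\<bar> powr q) \<in> borel_measurable L" using um by measurable
    show ?thesis
      using integral_le_of_AE_tendsto[OF int _ km _ lim ev] by simp
  qed
  show ?thesis
  proof (rule that[OF C])
    fix u assume u: "u \<in> H10 \<Omega>"
    show "integrable L (\<lambda>x. \<bar>u x\<bar> powr q)"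
    proof -
      have "ip u u < (1 + ip u u)\<^sup>2"
      proof -
        have "(1 + ip u u)\<^sup>2 = 1 + 2 * ip u u + (ip u u)\<^sup>2" by (simp add: power2_sum)
        then show ?thesis using ip_self_nonneg[of u] zero_le_power2[of "ip u u"] by linarith
      qed
      then show ?thesis using main[OF u, of "1 + ip u u"] ip_self_nonneg[of u] by simp
    qed
    show "(LINT x|L. \<bar>u x\<bar> powr q) \<le> C * (2 * H1_norm \<Omega> u) powr q"
    proof (cases "ip u u = 0")
      case True
      have "AE x in L. \<bar>u x\<bar> powr q = 0"
        using ip_self_zero[OF H10_H1[OF u] True] by eventually_elim simp
      then have "(LINT x|L. \<bar>u x\<bar> powr q) = 0" by (rule integral_eq_zero_AE)
      then show ?thesis using C by simp
    next
      case False
      then have pos: "ip u u > 0" using ip_self_nonneg[of u] by linarith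
      then have "H1_norm \<Omega> u > 0" by (simp add: H1_norm_def)
      moreover have "ip u u < (2 * H1_norm \<Omega> u)\<^sup>2"
        unfolding power_mult_distrib H1_norm_square using pos by simp
      ultimately show ?thesis using main[OF u, of "2 * H1_norm \<Omega> u"] by simp
    qed
  qed
qed

end

section \<open>One step of the iteration\<close>

text \<open>The numbers stand for \<open>N = \<parallel>u\<parallel>\<^sup>2\<close> and \<open>V = \<parallel>v\<parallel>\<^sup>2\<close> (norms of \<open>H1\<close>), and for the integrals \<open>P\<close> and \<open>Q\<close>
  of \<open>\<bar>u\<bar> powr (p + 1)\<close> and \<open>\<bar>v\<bar> powr (p + 1)\<close>, where \<open>v\<close> solves the linear problem with right-hand
  side \<open>nonlin p u\<close>; primes belong to the next iterate.  In logarithms all hypotheses are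
  linear, and the special value of \<open>\<gamma>\<close> enters through \<open>p \<gamma> = p + \<gamma>\<close>.\<close>

lemma step_inequality:
  fixes N P V Q p \<gamma> :: real
  assumes pos: "N > 0" "P > 0" "V > 0" "Q > 0" and p: "p > 1" and \<gamma>: "\<gamma> = p / (p - 1)"
    and CS: "P\<^sup>2 \<le> V * N" and Hoelder: "V \<le> P powr (p / (p + 1)) * Q powr (1 / (p + 1))"
    and N': "N' = ((N / P) powr \<gamma>)\<^sup>2 * V" and P': "P' = ((N / P) powr \<gamma>) powr (p + 1) * Q"
  shows "N' / P' \<le> 1" "ln N' \<le> ln N + 2 / (p - 1) * ln (N / P) - ln (N' / P') / p"
proof -
  define m where "m = ln (N / P)"
  define x where "x = \<gamma> * m"
  have N'pos: "N' > 0" and P'pos: "P' > 0" using pos by (auto simp: N' P')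
  have m: "m = ln N - ln P" using pos by (simp add: m_def ln_div)
  have pm: "p * m = p * ln N - p * ln P" by (simp add: m right_diff_distrib)
  have x: "p * x = p * m + x" using p by (simp add: x_def \<gamma> field_simps)
  have "ln (P\<^sup>2) \<le> ln (V * N)" using CS pos by simp
  then have 1: "2 * ln P \<le> ln V + ln N" using pos by (simp add: ln_mult ln_realpow)
  have "ln V \<le> ln (P powr (p / (p + 1)) * Q powr (1 / (p + 1)))" using Hoelder pos by simp
  also have "\<dots> = (p * ln P + ln Q) / (p + 1)"
    using pos by (simp add: ln_mult ln_powr add_divide_distrib)
  finally have 2: "(p + 1) * ln V \<le> p * ln P + ln Q" using p by (simp add: field_simps)
  have lN: "ln N' = 2 * x + ln V" using pos by (simp add: N' ln_mult ln_realpow ln_powr x_def m_def)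
  have lP: "ln P' = (p + 1) * x + ln Q" using pos by (simp add: P' ln_mult ln_powr x_def m_def)
  have lM: "ln (N' / P') = ln N' - ln P'" using N'pos P'pos by (simp add: ln_div)
  have lM': "ln (N' / P') = ln V - ln Q - p * m"
    unfolding lM lN lP using x by (simp add: algebra_simps)
  have "p * (2 * ln P) \<le> p * (ln V + ln N)" using 1 p by (intro mult_left_mono) auto
  then have "ln (N' / P') \<le> 0" unfolding lM' m using 2 by (simp add: algebra_simps)
  then show "N' / P' \<le> 1" using N'pos P'pos by simp
  have "p * ln N' + ln (N' / P') \<le> p * ln N + 2 * x"
    unfolding lM' lN using 2 x pm by (simp add: algebra_simps)
  also have "2 * x = p * (2 / (p - 1) * m)" by (simp add: x_def \<gamma>)
  finally have "p * (ln N' + ln (N' / P') / p) \<le> p * (ln N + 2 / (p - 1) * m)"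
    using p by (simp add: algebra_simps)
  then have "ln N' + ln (N' / P') / p \<le> ln N + 2 / (p - 1) * m"
    using p by (simp only: mult_le_cancel_left_pos)
  then show "ln N' \<le> ln N + 2 / (p - 1) * ln (N / P) - ln (N' / P') / p" by (simp add: m_def)
qed

locale subcritical = bounded_open \<Omega> for \<Omega> :: "'a::euclidean_space set" +
  fixes p :: real
  assumes p: "1 < p"
    and subcritical: "DIM('a) \<ge> 3 \<Longrightarrow> p < (real DIM('a) + 2) / (real DIM('a) - 2)"
begin

definition P :: "('a \<Rightarrow> real) \<Rightarrow> real" where
  "P u = (LINT x|L. \<bar>u x\<bar> powr (p + 1))"

lemma P_nonneg: "0 \<le> P u"
  by (simp add: P_def integral_nonneg_AE)

lemma subcritical_exponent: "p + 1 > 2" "(p + 1) * (real DIM('a) - 2) < 2 * real DIM('a)"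
proof -
  show "p + 1 > 2" using p by simp
  consider "DIM('a) = 1" | "DIM('a) = 2" | "DIM('a) \<ge> 3"
    using DIM_positive[where 'a='a] by linarith
  then show "(p + 1) * (real DIM('a) - 2) < 2 * real DIM('a)"
  proof cases
    case 3
    then have d: "real DIM('a) - 2 > 0" by simp
    have "p * (real DIM('a) - 2) < real DIM('a) + 2"
      using subcritical[OF 3] d by (simp add: pos_less_divide_eq)
    then show ?thesis by (simp add: algebra_simps)
  qed (use p in auto)
qed

lemma power_integrable:
  assumes "u \<in> H10 \<Omega>" shows "integrable L (\<lambda>x. \<bar>u x\<bar> powr (p + 1))"
proof (rule Sobolev_H10[OF subcritical_exponent])
  assume *: "\<And>u. u \<in> H10 \<Omega> \<Longrightarrow> integrable L (\<lambda>x. \<bar>u x\<bar> powr (p + 1))"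
  show ?thesis by (rule *[OF assms])
qed

lemma Lp_norm_powr: "Lp_norm \<Omega> (p + 1) u powr (p + 1) = P u"
  using p P_nonneg[of u] by (simp add: Lp_norm_def P_def[symmetric] powr_powr)

lemma nonlin_mult_self: "nonlin p u x * u x = \<bar>u x\<bar> powr (p + 1)"
proof (cases "u x = 0")
  case False
  have "nonlin p u x * u x = \<bar>u x\<bar> powr (p - 1) * \<bar>u x\<bar> powr 2"
    by (simp add: nonlin_def power2_eq_square)
  also have "\<dots> = \<bar>u x\<bar> powr (p + 1)" by (simp only: powr_add[symmetric]) (simp add: add.commute)
  finally show ?thesis .
qed (simp add: nonlin_def)

lemma abs_nonlin_mult:
  "\<bar>nonlin p u x * w x\<bar> =
    (\<bar>u x\<bar> powr (p + 1)) powr (p / (p + 1)) * (\<bar>w x\<bar> powr (p + 1)) powr (1 - p / (p + 1))"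
proof -
  have "\<bar>nonlin p u x\<bar> = \<bar>u x\<bar> powr p"
  proof (cases "u x = 0")
    case False
    have "\<bar>nonlin p u x\<bar> = \<bar>u x\<bar> powr (p - 1) * \<bar>u x\<bar> powr 1"
      by (simp add: nonlin_def abs_mult)
    also have "\<dots> = \<bar>u x\<bar> powr p" by (simp only: powr_add[symmetric]) simp
    finally show ?thesis .
  qed (simp add: nonlin_def)
  moreover have "(\<bar>u x\<bar> powr (p + 1)) powr (p / (p + 1)) = \<bar>u x\<bar> powr p"
    using p by (simp add: powr_powr)
  moreover have "(\<bar>w x\<bar> powr (p + 1)) powr (1 - p / (p + 1)) = \<bar>w x\<bar>"
  proof -
    have "(p + 1) * (1 - p / (p + 1)) = 1" using p by (simp add: field_simps)
    then show ?thesis by (simp only: powr_powr powr_one abs_ge_zero)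
  qed
  ultimately show ?thesis by (simp add: abs_mult)
qed

text \<open>Hoelder's inequality with the conjugate exponents \<open>(p + 1) / p\<close> and \<open>p + 1\<close>.\<close>

lemma nonlin_pairing:
  assumes u: "u \<in> H10 \<Omega>" and w: "w \<in> H10 \<Omega>"
  shows "integrable L (\<lambda>x. nonlin p u x * w x)"
    "\<bar>L2_inner \<Omega> (nonlin p u) w\<bar> \<le> P u powr (p / (p + 1)) * P w powr (1 / (p + 1))"
proof -
  have th: "0 < p / (p + 1)" "p / (p + 1) < 1" using p by auto
  note H = integral_Hoelder[OF power_integrable[OF u] power_integrable[OF w] powr_ge_zero powr_ge_zero th]
  have [measurable]: "u \<in> borel_measurable L" "w \<in> borel_measurable L"
    using H1D(1)[OF H10_H1[OF u]] H1D(1)[OF H10_H1[OF w]] by (auto simp: square_integrable_def)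
  have eq: "(\<lambda>x. \<bar>nonlin p u x * w x\<bar>) =
      (\<lambda>x. (\<bar>u x\<bar> powr (p + 1)) powr (p / (p + 1)) * (\<bar>w x\<bar> powr (p + 1)) powr (1 - p / (p + 1)))"
    by (rule ext) (rule abs_nonlin_mult)
  have abs: "integrable L (\<lambda>x. \<bar>nonlin p u x * w x\<bar>)" unfolding eq by (rule H(1))
  have meas: "(\<lambda>x. nonlin p u x * w x) \<in> borel_measurable L" unfolding nonlin_def by measurable
  show "integrable L (\<lambda>x. nonlin p u x * w x)" by (rule integrable_abs_cancel[OF abs meas])
  have "\<bar>L2_inner \<Omega> (nonlin p u) w\<bar> \<le> (LINT x|L. \<bar>nonlin p u x * w x\<bar>)"
    unfolding L2_inner_def by (rule integral_abs_bound)
  also have "\<dots> \<le> P u powr (p / (p + 1)) * P w powr (1 - p / (p + 1))"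
    unfolding eq P_def by (rule H(2))
  also have "1 - p / (p + 1) = 1 / (p + 1)" using p by (simp add: field_simps)
  finally show "\<bar>L2_inner \<Omega> (nonlin p u) w\<bar> \<le> P u powr (p / (p + 1)) * P w powr (1 / (p + 1))" .
qed

lemma L2_inner_nonlin_self: "L2_inner \<Omega> (nonlin p u) u = P u"
  by (simp add: L2_inner_def nonlin_mult_self P_def)

lemma Helmholtz_eq_ip:
  assumes v: "v \<in> H10 \<Omega>" and w: "w \<in> H10 \<Omega>"
  shows "Helmholtz \<Omega> v w = ip v w"
proof -
  note vD = H1D[OF H10_H1[OF v]] and wD = H1D[OF H10_H1[OF w]]
  have "ip v w = (LINT x|L. v x * w x) + (LINT x|L. wgrad \<Omega> v x \<bullet> wgrad \<Omega> w x)"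
    unfolding H1_inner_def
    using integrable_inner[OF vD(1) wD(1)] integrable_inner[OF vD(3) wD(3)]
    by (intro Bochner_Integration.integral_add) auto
  then show ?thesis using w by (simp add: Helmholtz_def dual_of_def Laplacian_def L2_inner_def)
qed

text \<open>The right-hand side \<open>nonlin p u\<close> acts boundedly on \<open>H10\<close> by the Hoelder and Sobolev inequalities,
  so by the Riesz representation it lies in the range of the Helmholtz operator.  This is what
  gives the chosen preimage its meaning; two functionals are compared as functions, which
  agree outside \<open>H10\<close> by the common default value.\<close>

lemma Helmholtz_inv_nonlin:
  assumes u: "u \<in> H10 \<Omega>"
  defines "v \<equiv> Helmholtz_inv \<Omega> (dual_of \<Omega> (nonlin p u))"
  shows "v \<in> H10 \<Omega>" "\<And>w. w \<in> H10 \<Omega> \<Longrightarrow> ip v w = L2_inner \<Omega> (nonlin p u) w"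
proof -
  let ?l = "L2_inner \<Omega> (nonlin p u)"
  obtain C where C: "C > 0" and S: "\<And>u. u \<in> H10 \<Omega> \<Longrightarrow> (LINT x|L. \<bar>u x\<bar> powr (p + 1)) \<le> C * (2 * H1_norm \<Omega> u) powr (p + 1)"
  proof (rule Sobolev_H10[OF subcritical_exponent])
    fix C :: real
    assume "C > 0" "\<And>u. u \<in> H10 \<Omega> \<Longrightarrow> (LINT x|L. \<bar>u x\<bar> powr (p + 1)) \<le> C * (2 * H1_norm \<Omega> u) powr (p + 1)"
    then show thesis by (rule that)
  qed
  define K where "K = P u powr (p / (p + 1)) * (C powr (1 / (p + 1)) * 2)"
  obtain v0 where v0: "v0 \<in> H10 \<Omega>" "\<And>w. w \<in> H10 \<Omega> \<Longrightarrow> ip v0 w = ?l w"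
  proof (rule Riesz_representation[of ?l K])
    fix f g a b assume fg: "f \<in> H10 \<Omega>" "g \<in> H10 \<Omega>"
    have "?l (\<lambda>x. a * f x + b * g x) = (LINT x|L. a * (nonlin p u x * f x) + b * (nonlin p u x * g x))"
      by (simp add: L2_inner_def algebra_simps)
    also have "\<dots> = a * ?l f + b * ?l g"
      using nonlin_pairing(1)[OF u fg(1)] nonlin_pairing(1)[OF u fg(2)] by (simp add: L2_inner_def)
    finally show "?l (\<lambda>x. a * f x + b * g x) = a * ?l f + b * ?l g" .
  next
    fix w assume w: "w \<in> H10 \<Omega>"
    have h: "0 \<le> H1_norm \<Omega> w" by (simp add: H1_norm_def ip_self_nonneg)
    have "P w powr (1 / (p + 1)) \<le> (C * (2 * H1_norm \<Omega> w) powr (p + 1)) powr (1 / (p + 1))"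
      using S[OF w] P_nonneg[of w] p by (intro powr_mono2) (auto simp: P_def)
    also have "\<dots> = C powr (1 / (p + 1)) * 2 * H1_norm \<Omega> w"
      using C h p by (simp add: powr_mult powr_powr)
    finally have "P u powr (p / (p + 1)) * P w powr (1 / (p + 1)) \<le> K * H1_norm \<Omega> w"
      unfolding K_def by (simp add: mult.assoc mult_left_mono)
    then show "\<bar>?l w\<bar> \<le> K * H1_norm \<Omega> w" using nonlin_pairing(2)[OF u w] by linarith
  qed blast
  have "Helmholtz \<Omega> v0 = dual_of \<Omega> (nonlin p u)"
  proof
    fix w
    show "Helmholtz \<Omega> v0 w = dual_of \<Omega> (nonlin p u) w"
    proof (cases "w \<in> H10 \<Omega>")
      case True
      then show ?thesis using Helmholtz_eq_ip[OF v0(1) True] v0(2) by (simp add: dual_of_def)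
    qed (simp add: Helmholtz_def dual_of_def)
  qed
  then have mem: "dual_of \<Omega> (nonlin p u) \<in> Helmholtz \<Omega> ` H10 \<Omega>" using v0(1) by (metis image_eqI)
  show v: "v \<in> H10 \<Omega>" unfolding v_def Helmholtz_inv_def by (rule inv_into_into[OF mem])
  fix w assume w: "w \<in> H10 \<Omega>"
  have "Helmholtz \<Omega> v = dual_of \<Omega> (nonlin p u)"
    unfolding v_def Helmholtz_inv_def by (rule f_inv_into_f[OF mem])
  then show "ip v w = ?l w" using Helmholtz_eq_ip[OF v w] w by (simp add: dual_of_def)
qed

lemma M_eq: "u \<in> H10 \<Omega> \<Longrightarrow> M \<Omega> p u = ip u u / P u"
  by (simp add: M_def Helmholtz_eq_ip dual_of_def L2_inner_nonlin_self)

lemma nontrivial_pos: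
  assumes u: "u \<in> H10 \<Omega>" and nz: "\<not> (AE x in L. u x = 0)"
  shows "ip u u > 0" "P u > 0"
proof -
  show "ip u u > 0" using ip_self_zero[OF H10_H1[OF u]] nz ip_self_nonneg[of u] by (auto simp: less_le)
  have "P u \<noteq> 0"
  proof
    assume "P u = 0"
    then have "AE x in L. \<bar>u x\<bar> powr (p + 1) = 0"
      using integral_nonneg_eq_0_iff_AE[OF power_integrable[OF u]] by (simp add: P_def)
    then have "AE x in L. u x = 0" by eventually_elim simp
    with nz show False by blast
  qed
  then show "P u > 0" using P_nonneg[of u] by simp
qed

text \<open>Testing the equation for \<open>v\<close> with \<open>u\<close> and with \<open>v\<close> itself gives the Cauchy-Schwarz and Hoelder
  hypotheses of the previous inequality.\<close>

lemma iteration_step: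
  assumes u: "u \<in> H10 \<Omega>" and nz: "\<not> (AE x in L. u x = 0)" and \<gamma>: "\<gamma> = p / (p - 1)"
    and u': "AE x in L. u' x = iter_map \<Omega> p \<gamma> u x"
  shows "u' \<in> H10 \<Omega>" "\<not> (AE x in L. u' x = 0)" "M \<Omega> p u' \<le> 1"
    "ln (ip u' u') \<le> ln (ip u u) + 2 / (p - 1) * ln (M \<Omega> p u) - ln (M \<Omega> p u') / p"
proof -
  define v where "v = Helmholtz_inv \<Omega> (dual_of \<Omega> (nonlin p u))"
  note v = Helmholtz_inv_nonlin[OF u, folded v_def]
  note pos = nontrivial_pos[OF u nz]
  define t where "t = M \<Omega> p u powr \<gamma>"
  have Mu: "M \<Omega> p u = ip u u / P u" by (rule M_eq[OF u])
  have t: "t > 0" using pos by (simp add: t_def Mu)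
  have it: "iter_map \<Omega> p \<gamma> u = (\<lambda>x. t * v x)" by (simp add: iter_map_def t_def v_def)
  have tv: "(\<lambda>x. t * v x) \<in> H10 \<Omega>" by (rule H10_scale[OF v(1)])
  have ae: "AE x in L. t * v x = u' x" using u' unfolding it by eventually_elim simp
  show u'H: "u' \<in> H10 \<Omega>" by (rule H10_cong_AE[OF tv ae])
  have ipvu: "ip v u = P u" using v(2)[OF u] by (simp add: L2_inner_nonlin_self)
  have CS: "(P u)\<^sup>2 \<le> ip v v * ip u u"
    using ip_Cauchy_Schwarz[OF H10_H1[OF v(1)] H10_H1[OF u]] by (simp add: ipvu)
  have "ip v v \<noteq> 0" using CS pos by auto
  then have V: "ip v v > 0" using ip_self_nonneg[of v] by simp
  have Hoelder: "ip v v \<le> P u powr (p / (p + 1)) * P v powr (1 / (p + 1))"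
    using nonlin_pairing(2)[OF u v(1)] v(2)[OF v(1)] by simp
  have "P v \<noteq> 0" using Hoelder V by auto
  then have Q: "P v > 0" using P_nonneg[of v] by simp
  have N': "ip u' u' = t\<^sup>2 * ip v v"
  proof -
    have "ip u' u' = ip (\<lambda>x. t * v x) (\<lambda>x. t * v x)"
      by (rule ip_cong_AE[OF H10_H1[OF tv] ae H10_H1[OF tv] ae, symmetric])
    also have "\<dots> = t\<^sup>2 * ip v v"
      using ip_square_lincomb[OF H10_H1[OF v(1)] H10_H1[OF v(1)], of t 0] by simp
    finally show ?thesis .
  qed
  have P': "P u' = t powr (p + 1) * P v"
  proof -
    have "P u' = (LINT x|L. t powr (p + 1) * \<bar>v x\<bar> powr (p + 1))"
      unfolding P_def
    proof (rule integral_cong_AE)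
      show "(\<lambda>x. \<bar>u' x\<bar> powr (p + 1)) \<in> borel_measurable L" using power_integrable[OF u'H] by simp
      show "(\<lambda>x. t powr (p + 1) * \<bar>v x\<bar> powr (p + 1)) \<in> borel_measurable L"
        using power_integrable[OF v(1)] by simp
      show "AE x in L. \<bar>u' x\<bar> powr (p + 1) = t powr (p + 1) * \<bar>v x\<bar> powr (p + 1)"
        using ae
      proof eventually_elim
        case (elim x)
        then have "\<bar>u' x\<bar> = t * \<bar>v x\<bar>" using t by (metis abs_mult abs_of_pos)
        then show ?case using t by (simp add: powr_mult)
      qed
    qed
    then show ?thesis by (simp add: P_def)
  qed
  have N'pos: "ip u' u' > 0" using N' V t by simp
  show "\<not> (AE x in L. u' x = 0)"
  proof
    assume z: "AE x in L. u' x = 0"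
    have "ip u' u' = ip (\<lambda>x. 0) (\<lambda>x. 0)"
      by (rule ip_cong_AE[OF H10_H1[OF u'H] z H10_H1[OF u'H] z])
    also have "\<dots> = 0"
      using ip_square_lincomb[OF H10_H1[OF u] H10_H1[OF u], of 0 0] by simp
    finally show False using N'pos by simp
  qed
  have Mu': "M \<Omega> p u' = ip u' u' / P u'" by (rule M_eq[OF u'H])
  note step = step_inequality[OF pos V Q p \<gamma> CS Hoelder, folded Mu, folded t_def, OF N' P']
  show "M \<Omega> p u' \<le> 1" using step(1) by (simp add: Mu')
  show "ln (ip u' u') \<le> ln (ip u u) + 2 / (p - 1) * ln (M \<Omega> p u) - ln (M \<Omega> p u') / p"
    using step(2) unfolding Mu' Mu .
qed

text \<open>In \<open>EM\<close> the factor \<open>M\<close> turns the integral of \<open>\<bar>u\<bar> powr (p + 1)\<close> into the squared norm, so on the set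
  \<open>M \<le> 1\<close> this energy is a positive multiple of the squared norm.\<close>

lemma EM_eq:
  assumes "u \<in> H10 \<Omega>" "\<not> (AE x in L. u x = 0)" "M \<Omega> p u \<le> 1"
  shows "EM \<Omega> p u = ereal ((p - 1) / (2 * (p + 1)) * ip u u)"
proof -
  have "M \<Omega> p u * P u = ip u u" using nontrivial_pos[OF assms(1,2)] by (simp add: M_eq[OF assms(1)])
  then have "EM \<Omega> p u = ereal (1 / 2 * ip u u - 1 / (p + 1) * ip u u)"
    using assms(3) by (simp add: EM_def H1_norm_square Lp_norm_powr)
  also have "1 / 2 * ip u u - 1 / (p + 1) * ip u u = (p - 1) / (2 * (p + 1)) * ip u u"
    using p by (simp add: field_simps)
  finally show ?thesis .
qed

lemma E1_eq: "E1 \<Omega> p u = 1 / 2 * ip u u - 1 / (p + 1) * P u"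
  by (simp add: E1_def H1_norm_square Lp_norm_powr)

end

section \<open>Sums of the one-step inequality\<close>

text \<open>Here and below \<open>a n\<close> and \<open>m n\<close> are the logarithms of the squared norm and of the quotient \<open>M\<close>
  of the \<open>n\<close>-th iterate.  Each intermediate \<open>m j\<close> occurs in two consecutive steps, with the
  coefficients \<open>2 / (p - 1)\<close> and \<open>- 1 / p\<close>.\<close>

lemma telescoped_inequality:
  fixes a m :: "nat \<Rightarrow> real"
  assumes step: "\<And>n. a (Suc n) \<le> a n + 2 / (p - 1) * m n - m (Suc n) / p" and "k < n"
  shows "a n \<le> a k + 2 / (p - 1) * m k - m n / p + (2 / (p - 1) - 1 / p) * (\<Sum>j\<in>{Suc k..<n}. m j)"
  using \<open>k < n\<close>
proof (induction n)
  case (Suc n)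
  show ?case
  proof (cases "k = n")
    case True
    then show ?thesis using step[of n] by simp
  next
    case False
    then have "k < n" using Suc.prems by simp
    with Suc.IH step[of n] show ?thesis by (simp add: algebra_simps)
  qed
qed simp

text \<open>Since \<open>m k \<le> 0\<close>, its coefficient may be lowered to \<open>1 / p\<close>, which matches that of \<open>m n\<close>.\<close>

lemma telescoped_ratio_inequality:
  fixes a m :: "nat \<Rightarrow> real"
  assumes step: "\<And>n. a (Suc n) \<le> a n + 2 / (p - 1) * m n - m (Suc n) / p"
    and "p > 1" and k: "k < n" "m k \<le> 0"
  shows "a n \<le> a k + (m k - m n) / p + (2 / (p - 1) - 1 / p) * (\<Sum>j\<in>{Suc k..<n}. m j)"
proof -
  have "1 / p \<le> 2 / (p - 1)" using \<open>p > 1\<close> by (simp add: field_simps)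
  then have "2 / (p - 1) * m k \<le> 1 / p * m k" using k by (intro mult_right_mono_neg)
  then show ?thesis using telescoped_inequality[where a = a and m = m and p = p, OF step k(1)] by (simp add: diff_divide_distrib)
qed

lemma sum_Suc_nonpos:
  fixes m :: "nat \<Rightarrow> real"
  assumes "\<And>n. m (Suc n) \<le> 0"
  shows "(\<Sum>j\<in>{Suc k..<n}. m j) \<le> 0"
proof (rule sum_nonpos)
  fix j assume "j \<in> {Suc k..<n}"
  then show "m j \<le> 0" using assms[of "j - 1"] by simp
qed

text \<open>If \<open>a\<close> stays above \<open>a k\<close> by a fixed amount, the telescoped inequality forces \<open>m\<close> to stay below a fixed
  negative number; then the sum of the \<open>m j\<close> tends to minus infinity and drags \<open>a\<close> below \<open>a k\<close>,
  unless \<open>m\<close> is unbounded below.\<close>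

lemma no_persistent_excess:
  fixes a m :: "nat \<Rightarrow> real"
  assumes step: "\<And>n. a (Suc n) \<le> a n + 2 / (p - 1) * m n - m (Suc n) / p"
    and neg: "\<And>n. m (Suc n) \<le> 0" and p: "p > 1" and k: "m k \<le> 0"
    and \<delta>: "\<delta> > 0" "eventually (\<lambda>n. a n \<ge> a k + \<delta>) sequentially"
    and bdd: "eventually (\<lambda>n. m n \<ge> - K) sequentially"
  shows False
proof -
  let ?c = "2 / (p - 1) - 1 / p"
  have c: "?c > 0" using p by (simp add: field_simps)
  have bound: "a n \<le> a k + (m k - m n) / p + ?c * (\<Sum>j\<in>{Suc k..<n}. m j)" if "k < n" for n
    by (rule telescoped_ratio_inequality[where a = a and m = m and p = p, OF step p that k])
  have k': "m k / p \<le> 0" using k p by (simp add: divide_nonpos_pos)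
  obtain N0 where N0: "\<And>n. n \<ge> N0 \<Longrightarrow> a n \<ge> a k + \<delta>" "\<And>n. n \<ge> N0 \<Longrightarrow> m n \<ge> - K"
    using eventually_conj[OF \<delta>(2) bdd] unfolding eventually_sequentially by blast
  define n0 where "n0 = max N0 (Suc k)"
  have small: "m n \<le> - (p * \<delta>)" if "n \<ge> n0" for n
  proof -
    have "?c * (\<Sum>j\<in>{Suc k..<n}. m j) \<le> 0"
      using c sum_Suc_nonpos[of m k n, OF neg] by (simp add: mult_nonneg_nonpos)
    then have "\<delta> \<le> - m n / p" using bound[of n] N0(1)[of n] that k' by (simp add: n0_def diff_divide_distrib)
    then show ?thesis using p by (simp add: field_simps)
  qed
  have sum: "(\<Sum>j\<in>{Suc k..<n0 + i}. m j) \<le> - (real i * (p * \<delta>))" for i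
  proof (induction i)
    case 0
    show ?case using sum_Suc_nonpos[of m k n0, OF neg] by simp
  next
    case (Suc i)
    have "(\<Sum>j\<in>{Suc k..<n0 + Suc i}. m j) = (\<Sum>j\<in>{Suc k..<n0 + i}. m j) + m (n0 + i)"
      by (simp add: n0_def)
    then show ?case using Suc small[of "n0 + i"] by (simp add: algebra_simps)
  qed
  obtain i where i: "real i > K / p / (?c * (p * \<delta>))" using reals_Archimedean2 by blast
  have pos: "?c * (p * \<delta>) > 0" using c p \<delta>(1) by simp
  have "?c * (\<Sum>j\<in>{Suc k..<n0 + i}. m j) \<le> ?c * (- (real i * (p * \<delta>)))"
    using sum c by (intro mult_left_mono) auto
  also have "\<dots> = - (real i * (?c * (p * \<delta>)))" by (simp only: mult_minus_right mult.left_commute)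
  also have "\<dots> < - (K / p)" using i pos by (simp only: pos_divide_less_eq neg_less_iff_less)
  finally have s: "?c * (\<Sum>j\<in>{Suc k..<n0 + i}. m j) < - (K / p)" .
  have "N0 \<le> n0 + i" by (simp add: n0_def)
  then have "- m (n0 + i) / p \<le> K / p"
    using N0(2)[of "n0 + i"] p by (intro divide_right_mono) auto
  moreover have "(m k - m (n0 + i)) / p = m k / p + - m (n0 + i) / p" by (simp add: diff_divide_distrib)
  moreover have "k < n0 + i" by (simp add: n0_def)
  ultimately have "a (n0 + i) < a k" using bound[of "n0 + i"] s k' by linarith
  then show False using N0(1)[OF \<open>N0 \<le> n0 + i\<close>] \<delta>(1) by linarith
qed

theorem lemma4p8:
  fixes \<Omega> :: "'a::euclidean_space set"
    and p \<gamma> :: real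
    and u :: "nat \<Rightarrow> 'a \<Rightarrow> real"
  assumes "open \<Omega>" and "bounded \<Omega>" and "convex \<Omega>" and "\<Omega> \<noteq> {}"
    and "1 < p"
    and "DIM('a) \<ge> 3 \<Longrightarrow> p < (real DIM('a) + 2) / (real DIM('a) - 2)"
    and "\<gamma> = p / (p - 1)"
    and "u 0 \<in> H10 \<Omega>"
    and "\<not> (AE x in lebesgue_on \<Omega>. u 0 x = 0)"
    and "\<And>n. AE x in lebesgue_on \<Omega>. u (Suc n) x = iter_map \<Omega> p \<gamma> (u n) x"
  shows "(\<forall>k n. k < n \<and> 0 < M \<Omega> p (u k) \<and> M \<Omega> p (u k) \<le> M \<Omega> p (u n) \<and> M \<Omega> p (u n) \<le> 1 \<longrightarrow>
            EM \<Omega> p (u n) \<le> EM \<Omega> p (u k) \<and>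
            (M \<Omega> p (u k) < M \<Omega> p (u n) \<longrightarrow> EM \<Omega> p (u n) < EM \<Omega> p (u k))) \<and>
         (\<forall>k. 0 < M \<Omega> p (u k) \<and> M \<Omega> p (u k) \<le> 1 \<longrightarrow>
            liminf (\<lambda>n. ereal (E1 \<Omega> p (u n))) \<le> EM \<Omega> p (u k))"
proof -
  interpret subcritical \<Omega> p
    using assms by unfold_locales auto
  have u: "u n \<in> H10 \<Omega> \<and> \<not> (AE x in L. u n x = 0)" for n
  proof (induction n)
    case (Suc n)
    then show ?case
      using iteration_step(1,2)[OF _ _ assms(7) assms(10)[of n]] by blast
  qed (use assms in auto)
  then have uH: "u n \<in> H10 \<Omega>" and nz: "\<not> (AE x in L. u n x = 0)" for n by auto
  define N where "N n = ip (u n) (u n)" for n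
  define a where "a n = ln (N n)" for n
  define m where "m n = ln (M \<Omega> p (u n))" for n
  define c where "c = (p - 1) / (2 * (p + 1))"
  have c: "c > 0" using p by (simp add: c_def)
  have N: "N n > 0" and Ppos: "P (u n) > 0" for n using nontrivial_pos[OF uH nz] by (auto simp: N_def)
  have M: "M \<Omega> p (u n) = N n / P (u n)" for n using M_eq[OF uH] by (simp add: N_def)
  have Mpos: "M \<Omega> p (u n) > 0" for n using N Ppos by (simp add: M)
  have M1: "M \<Omega> p (u (Suc n)) \<le> 1" for n
    by (rule iteration_step(3)[OF uH nz assms(7) assms(10)])
  have neg: "m (Suc n) \<le> 0" for n using M1[of n] Mpos[of "Suc n"] by (simp add: m_def)
  have step: "a (Suc n) \<le> a n + 2 / (p - 1) * m n - m (Suc n) / p" for n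
    using iteration_step(4)[OF uH nz assms(7) assms(10)] by (simp add: a_def m_def N_def)
  have EM: "EM \<Omega> p (u n) = ereal (c * N n)" if "M \<Omega> p (u n) \<le> 1" for n
    using EM_eq[OF uH nz that] by (simp add: c_def N_def)
  show ?thesis
  proof (intro conjI allI impI; elim conjE)
    fix k n assume kn: "k < n" and le: "M \<Omega> p (u k) \<le> M \<Omega> p (u n)" and le1: "M \<Omega> p (u n) \<le> 1"
    have mk: "m k \<le> m n" "m k \<le> 0" using le le1 Mpos[of k] Mpos[of n] by (auto simp: m_def)
    have "(2 / (p - 1) - 1 / p) * (\<Sum>j\<in>{Suc k..<n}. m j) \<le> 0"
      using sum_Suc_nonpos[of m k n, OF neg] p by (intro mult_nonneg_nonpos) (auto simp: field_simps)
    then have an: "a n \<le> a k + (m k - m n) / p"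
      using telescoped_ratio_inequality[where a = a and m = m and p = p, OF step p kn mk(2)] by linarith
    have EMs: "EM \<Omega> p (u n) = ereal (c * N n)" "EM \<Omega> p (u k) = ereal (c * N k)"
      using EM le le1 by auto
    have "(m k - m n) / p \<le> 0" using mk p by (simp add: divide_nonpos_pos)
    then have "a n \<le> a k" using an by linarith
    then have "N n \<le> N k" using N by (simp add: a_def)
    then show "EM \<Omega> p (u n) \<le> EM \<Omega> p (u k)" using c by (simp add: EMs)
    assume "M \<Omega> p (u k) < M \<Omega> p (u n)"
    then have "m k < m n" using Mpos by (simp add: m_def)
    then have "(m k - m n) / p < 0" using p by (simp add: divide_neg_pos)
    then have "a n < a k" using an by linarith
    then have "N n < N k" using N by (simp add: a_def)
    then show "EM \<Omega> p (u n) < EM \<Omega> p (u k)" using c by (simp add: EMs)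
  next
    fix k assume le1: "M \<Omega> p (u k) \<le> 1"
    have mk: "m k \<le> 0" using le1 Mpos[of k] by (simp add: m_def)
    show "liminf (\<lambda>n. ereal (E1 \<Omega> p (u n))) \<le> EM \<Omega> p (u k)"
    proof (rule ccontr)
      assume "\<not> ?thesis"
      then have "ereal (c * N k) < liminf (\<lambda>n. ereal (E1 \<Omega> p (u n)))"
        using EM[OF le1] by (simp add: not_le)
      then obtain r where r: "ereal (c * N k) < ereal r" "ereal r < liminf (\<lambda>n. ereal (E1 \<Omega> p (u n)))"
        using ereal_dense2 by blast
      have ck: "0 < c * N k" "c * N k < r" using c N r by auto
      have "eventually (\<lambda>n. ereal r < ereal (E1 \<Omega> p (u n))) sequentially"
        by (rule less_LiminfD[OF r(2)])
      then have ev: "eventually (\<lambda>n. r < E1 \<Omega> p (u n) \<and> n > 0) sequentially"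
        using eventually_gt_at_top[of 0] by eventually_elim simp
      have *: "a n \<ge> a k + ln (r / (c * N k)) \<and> m n \<ge> - ln ((p + 1) / 2)" if "r < E1 \<Omega> p (u n)" "n > 0" for n
      proof -
        obtain n' where n: "n = Suc n'" using \<open>n > 0\<close> by (cases n) auto
        have NP: "N n = M \<Omega> p (u n) * P (u n)" using Ppos[of n] by (simp add: M)
        have e: "r < 1 / 2 * N n - 1 / (p + 1) * P (u n)" using that(1) by (simp add: E1_eq N_def)
        have "N n \<le> P (u n)" using M1[of n'] Ppos[of n] NP n by (simp add: mult_le_cancel_right1)
        then have "1 / (p + 1) * N n \<le> 1 / (p + 1) * P (u n)" using p by (intro mult_left_mono) auto
        moreover have "1 / 2 * N n - 1 / (p + 1) * N n = c * N n" using p by (simp add: c_def field_simps)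
        \<comment> \<open>Where \<open>M \<le> 1\<close> the energy \<open>E1\<close> lies below \<open>EM\<close>.\<close>
        ultimately have "r < c * N n" using e by linarith
        then have "r / c < N n" using c by (simp add: field_simps)
        then have "ln (r / c) \<le> a n" unfolding a_def using ck c by (intro ln_mono) auto
        moreover have "ln (r / c) = a k + ln (r / (c * N k))"
          using less_trans[OF ck] c N[of k] by (simp add: a_def ln_div ln_mult)
        \<comment> \<open>A positive energy \<open>E1\<close> keeps \<open>M\<close> above \<open>2 / (p + 1)\<close>.\<close>
        moreover have "m n \<ge> - ln ((p + 1) / 2)"
        proof -
          have "1 / (p + 1) * P (u n) < 1 / 2 * (M \<Omega> p (u n) * P (u n))" using e ck NP by linarith
          then have "(2 / (p + 1)) * P (u n) < M \<Omega> p (u n) * P (u n)"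
            by (simp add: mult.commute)
          then have "2 / (p + 1) < M \<Omega> p (u n)" using Ppos[of n] by (simp only: mult_less_cancel_right_pos)
          then have "ln (2 / (p + 1)) \<le> m n" unfolding m_def using p by (intro ln_mono) auto
          then show ?thesis using p by (simp add: ln_div)
        qed
        ultimately show ?thesis by linarith
      qed
      show False
      proof (rule no_persistent_excess[where a = a and m = m and p = p, OF step neg p mk])
        show "ln (r / (c * N k)) > 0" using ck by simp
        show "eventually (\<lambda>n. a k + ln (r / (c * N k)) \<le> a n) sequentially"
          using ev by eventually_elim (use * in blast)
        show "eventually (\<lambda>n. - ln ((p + 1) / 2) \<le> m n) sequentially"
          using ev by eventually_elim (use * in blast)
      qed
    qed
  qed
qed

end
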